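(* Fix a prime $p_0\equiv1\bmod 4$. Then $$\limsup_{\max(p_1,p)\to\infty}\left|\frac{1}{\dim_{\mathbb{C}}F_{(p_0,p_1),p}}\ln\det\big(p_0+1-\Delta^{F_{(p_0,p_1),p}}\big)-\Big(p_0\ln(p_0)-\tfrac12(p_0-1)\ln(p_0-1)-\tfrac12(p_0-1)\ln(p_0+1)\Big)\right|=0,$$ meaning that the supremum of the absolute value over all primes $p_1\equiv1\bmod4$, $p_1\neq p_0$, and all $p\in\mathbb{N}$ with $\max(p_1,p)\geqslant k$ tends to $0$ as $k\to\infty$.
   Context: Let $p_0,p_1$ be distinct primes with $p_0,p_1\equiv1\bmod4$. Let $A$ be the set of $a=(a_0,a_1,a_2,a_3)\in\mathbb{Z}^4$ with $a_0^2+a_1^2+a_2^2+a_3^2=p_0$, $a_0$ positive and odd, $a_1,a_2,a_3$ even; $|A|=p_0+1$. Fix $b\in\mathbb{Z}$ with $b^2\equiv-1\bmod p_1$. For $a\in A$ let $a_{\mathbb{Z}/p_1\mathbb{Z}}$ be the class in $\mathrm{PGL}_2(\mathbb{Z}/p_1\mathbb{Z})$ of $\begin{pmatrix}a_0+ba_1&a_2+ba_3\\-a_2+ba_3&a_0-ba_1\end{pmatrix}$; if the Legendre symbol $\left(\frac{p_0}{p_1}\right)=1$ this class lies in $\mathrm{PSL}_2(\mathbb{Z}/p_1\mathbb{Z})\subset \mathrm{PGL}_2(\mathbb{Z}/p_1\mathbb{Z})$. Let $$a_{\mathbb{R}}=\frac{1}{\sqrt{p_0}}\begin{pmatrix}a_0+\sqrt{-1}a_1&a_2+\sqrt{-1}a_3\\-a_2+\sqrt{-1}a_3&a_0-\sqrt{-1}a_1\end{pmatrix}\in\mathrm{SU}_2(\mathbb{C}).$$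 $X_{(p_0,p_1)}$ is the Cayley graph, with respect to $\{a_{\mathbb{Z}/p_1\mathbb{Z}}: a\in A\}$, of $\mathrm{PGL}_2(\mathbb{Z}/p_1\mathbb{Z})$ if $\left(\frac{p_0}{p_1}\right)=-1$ and of $\mathrm{PSL}_2(\mathbb{Z}/p_1\mathbb{Z})$ if $\left(\frac{p_0}{p_1}\right)=1$; $|X_{(p_0,p_1)}|$ is $p_1(p_1^2-1)$, respectively $\frac12p_1(p_1^2-1)$. For $p\in\mathbb{N}$, $\mathrm{Sym}^p(\mathbb{C}^2)$ is the space of homogeneous polynomials of degree $p$ in $(z_0,z_1)$, with $g\in\mathrm{SU}_2(\mathbb{C})$ acting by $(gs)(z)=s(g^{-1}z)$ and with the $\mathrm{SU}_2(\mathbb{C})$-invariant inner product $\int_{\mathbb{CP}^1}s\,\overline{s'}\,\omega_{\mathrm{FS}}$ (polynomials restricted to the unit sphere; $\omega_{\mathrm{FS}}=c_1(\mathcal{O}_{\mathbb{CP}^1}(1))$ of total mass $1$). The Laplacian acts on functions $u:X_{(p_0,p_1)}\to\mathrm{Sym}^p(\mathbb{C}^2)$ by $$(\Delta^{F_{(p_0,p_1),p}}u)(x)=\sum_{a\in A}a_{\mathbb{R}}\cdot u\big(a_{\mathbb{Z}/p_1\mathbb{Z}}^{-1}\cdot x\big).$$ It is self-adjoint; $\dim_{\mathbb{C}}F_{(p_0,p_1),p}=|X_{(p_0,p_1)}|(p+1)$, and $\lambda_{(p_0,p_1),p,i}$, $1\leqslant i\leqslant\dim_{\mathbb{C}}F_{(p_0,p_1),p}$,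 are its eigenvalues with multiplicity. The log determinant is defined with zero modes removed: $\ln\det(p_0+1-\Delta^{F_{(p_0,p_1),p}})=\sum_{i:\,\lambda_{(p_0,p_1),p,i}\neq p_0+1}\ln(p_0+1-\lambda_{(p_0,p_1),p,i})$. *)

theory Defs
  imports
    "HOL-Analysis.Analysis"
    "HOL-Number_Theory.Number_Theory"
    "HOL-Algebra.Coset"
    "HOL-Library.Function_Algebras"
begin

section \<open>The groups PGL(2) and PSL(2) over a commutative ring\<close>

definition mat2 :: "'a \<Rightarrow> 'a \<Rightarrow> 'a \<Rightarrow> 'a \<Rightarrow> 'a^2^2" where
  "mat2 a b c d = (\<chi> i j. if i = 1 then (if j = 1 then a else b) else (if j = 1 then c else d))"

definition det2 :: "('a, 'r) ring_scheme \<Rightarrow> 'a^2^2 \<Rightarrow> 'a" where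
  "det2 R M = M$1$1 \<otimes>\<^bsub>R\<^esub> M$2$2 \<ominus>\<^bsub>R\<^esub> M$1$2 \<otimes>\<^bsub>R\<^esub> M$2$1"

definition GL2 :: "('a, 'r) ring_scheme \<Rightarrow> ('a^2^2) monoid" where
  "GL2 R =
    \<lparr>carrier = {M. (\<forall>i j. M$i$j \<in> carrier R) \<and> det2 R M \<in> Units R},
     monoid.mult = (\<lambda>M N. \<chi> i j. M$i$1 \<otimes>\<^bsub>R\<^esub> N$1$j \<oplus>\<^bsub>R\<^esub> M$i$2 \<otimes>\<^bsub>R\<^esub> N$2$j),
     one = mat2 \<one>\<^bsub>R\<^esub> \<zero>\<^bsub>R\<^esub> \<zero>\<^bsub>R\<^esub> \<one>\<^bsub>R\<^esub>\<rparr>"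

definition scalars2 :: "('a, 'r) ring_scheme \<Rightarrow> ('a^2^2) set" where
  "scalars2 R = {mat2 c \<zero>\<^bsub>R\<^esub> \<zero>\<^bsub>R\<^esub> c | c. c \<in> Units R}"

definition PGL2 :: "('a, 'r) ring_scheme \<Rightarrow> ('a^2^2) set monoid" where
  "PGL2 R = GL2 R Mod scalars2 R"

definition PGL2_class :: "('a, 'r) ring_scheme \<Rightarrow> 'a^2^2 \<Rightarrow> ('a^2^2) set" where
  "PGL2_class R M = scalars2 R #>\<^bsub>GL2 R\<^esub> M"

text \<open>PSL(2) is taken inside PGL(2), as the image of the matrices of determinant one.\<close>

definition PSL2 :: "('a, 'r) ring_scheme \<Rightarrow> ('a^2^2) set monoid" where
  "PSL2 R =
    (PGL2 R)\<lparr>carrier := PGL2_class R ` {M \<in> carrier (GL2 R). det2 R M = \<one>\<^bsub>R\<^esub>}\<rparr>"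


section \<open>The generators\<close>

definition gens :: "nat \<Rightarrow> (int \<times> int \<times> int \<times> int) set" where
  "gens p\<^sub>0 = {(a0, a1, a2, a3).
     a0\<^sup>2 + a1\<^sup>2 + a2\<^sup>2 + a3\<^sup>2 = int p\<^sub>0 \<and> a0 > 0 \<and> odd a0 \<and> even a1 \<and> even a2 \<and> even a3}"

definition gen_PGL :: "nat \<Rightarrow> int \<Rightarrow> int \<times> int \<times> int \<times> int \<Rightarrow> (int^2^2) set" where
  "gen_PGL p\<^sub>1 b = (\<lambda>(a0, a1, a2, a3).
     PGL2_class (residue_ring (int p\<^sub>1))
       (mat2 ((a0 + b * a1) mod int p\<^sub>1) ((a2 + b * a3) mod int p\<^sub>1)
             ((- a2 + b * a3) mod int p\<^sub>1) ((a0 - b * a1) mod int p\<^sub>1)))"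

definition gen_SU :: "nat \<Rightarrow> int \<times> int \<times> int \<times> int \<Rightarrow> complex^2^2" where
  "gen_SU p\<^sub>0 = (\<lambda>(a0, a1, a2, a3).
     (1 / sqrt (real p\<^sub>0)) *\<^sub>R
       mat2 (of_int a0 + \<i> * of_int a1) (of_int a2 + \<i> * of_int a3)
            (- of_int a2 + \<i> * of_int a3) (of_int a0 - \<i> * of_int a1))"

text \<open>The vertices of the Cayley graph are the elements of the following group; its edges, with
  multiplicities, enter only through the sum over \<open>gens\<close> in \<open>laplacian\<close> below.\<close>

definition cayley_group :: "nat \<Rightarrow> nat \<Rightarrow> (int^2^2) set monoid" where
  "cayley_group p\<^sub>0 p\<^sub>1 =
    (if Legendre (int p\<^sub>0) (int p\<^sub>1) = 1 then PSL2 (residue_ring (int p\<^sub>1))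
     else PGL2 (residue_ring (int p\<^sub>1)))"


section \<open>The symmetric powers and the space of sections\<close>

text \<open>Homogeneous polynomials are represented by the functions they induce, which is faithful over
  the complex numbers.\<close>

definition Sym_pow :: "nat \<Rightarrow> (complex^2 \<Rightarrow> complex) set" where
  "Sym_pow p = {s. \<exists>c. \<forall>z. s z = (\<Sum>k\<le>p. c k * (z$1) ^ k * (z$2) ^ (p - k))}"

definition Sym_act :: "complex^2^2 \<Rightarrow> (complex^2 \<Rightarrow> complex) \<Rightarrow> complex^2 \<Rightarrow> complex" where
  "Sym_act g s = (\<lambda>z. s (matrix_inv g *v z))"

type_synonym section_fun = "(int^2^2) set \<Rightarrow> complex^2 \<Rightarrow> complex"

definition section_scale :: "complex \<Rightarrow> section_fun \<Rightarrow> section_fun" where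
  "section_scale c u = (\<lambda>x z. c * u x z)"

global_interpretation section_fun: vector_space section_scale
  by unfold_locales (auto simp: section_scale_def fun_eq_iff algebra_simps)

text \<open>A function on the vertex set is extended by zero to the whole type, so that the functions form
  a linear subspace isomorphic to the space of maps from the vertices to \<open>Sym_pow p\<close>.\<close>

definition sections :: "nat \<Rightarrow> nat \<Rightarrow> nat \<Rightarrow> section_fun set" where
  "sections p\<^sub>0 p\<^sub>1 p =
    {u. (\<forall>x \<in> carrier (cayley_group p\<^sub>0 p\<^sub>1). u x \<in> Sym_pow p) \<and>
        (\<forall>x. x \<notin> carrier (cayley_group p\<^sub>0 p\<^sub>1) \<longrightarrow> u x = 0)}"

definition dim_sections :: "nat \<Rightarrow> nat \<Rightarrow> nat \<Rightarrow> nat" where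
  "dim_sections p\<^sub>0 p\<^sub>1 p = section_fun.dim (sections p\<^sub>0 p\<^sub>1 p)"


section \<open>The Laplacian and its regularised determinant\<close>

definition laplacian :: "nat \<Rightarrow> nat \<Rightarrow> int \<Rightarrow> section_fun \<Rightarrow> section_fun" where
  "laplacian p\<^sub>0 p\<^sub>1 b u =
    (let X = cayley_group p\<^sub>0 p\<^sub>1 in
     (\<lambda>x. if x \<in> carrier X
          then \<Sum>a\<in>gens p\<^sub>0. Sym_act (gen_SU p\<^sub>0 a) (u (inv\<^bsub>X\<^esub> gen_PGL p\<^sub>1 b a \<otimes>\<^bsub>X\<^esub> x))
          else 0))"

definition eigenspace :: "nat \<Rightarrow> nat \<Rightarrow> int \<Rightarrow> nat \<Rightarrow> complex \<Rightarrow> section_fun set" where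
  "eigenspace p\<^sub>0 p\<^sub>1 b p l =
    {u \<in> sections p\<^sub>0 p\<^sub>1 p. laplacian p\<^sub>0 p\<^sub>1 b u = section_scale l u}"

definition eigenvalues :: "nat \<Rightarrow> nat \<Rightarrow> int \<Rightarrow> nat \<Rightarrow> complex set" where
  "eigenvalues p\<^sub>0 p\<^sub>1 b p = {l. \<exists>u \<in> eigenspace p\<^sub>0 p\<^sub>1 b p l. u \<noteq> 0}"

definition eig_mult :: "nat \<Rightarrow> nat \<Rightarrow> int \<Rightarrow> nat \<Rightarrow> complex \<Rightarrow> nat" where
  "eig_mult p\<^sub>0 p\<^sub>1 b p l = section_fun.dim (eigenspace p\<^sub>0 p\<^sub>1 b p l)"

text \<open>The Laplacian is self-adjoint for the invariant inner product, so geometric and algebraic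
  multiplicities agree and all eigenvalues are real, of modulus at most \<open>p\<^sub>0 + 1\<close>. They are kept as
  complex numbers here so that no eigenvalue is discarded by definition; every logarithm below is
  then the real logarithm of a positive number.\<close>

definition ln_det :: "nat \<Rightarrow> nat \<Rightarrow> int \<Rightarrow> nat \<Rightarrow> complex" where
  "ln_det p\<^sub>0 p\<^sub>1 b p =
    (\<Sum>l \<in> eigenvalues p\<^sub>0 p\<^sub>1 b p - {of_nat p\<^sub>0 + 1}.
       of_nat (eig_mult p\<^sub>0 p\<^sub>1 b p l) * ln (of_nat p\<^sub>0 + 1 - l))"

end

theory Submission
  imports Defs "HOL-Computational_Algebra.Fundamental_Theorem_Algebra"
    "HOL-Library.Discrete_Functions"
begin

text \<open>
  Write \<open>q = p\<^sub>0\<close>. On an eigenvector with eigenvalue \<open>x = y + z\<close>, \<open>y z = q\<close>, one has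
  \<open>ln (q + 1 - x) = ln q - (\<Sum>m\<ge>1. (y ^ m + z ^ m) / (m * q ^ m))\<close>, and the power sums are
  combinations of the polynomials \<open>sph q m\<close> which turn the Laplacian into the sum over reduced words
  of length \<open>m\<close> in the generators. A nonempty reduced word is a quaternion that is not divisible by
  \<open>q\<close>, hence not real, so its trace is small compared with the dimension as soon as
  \<open>max p\<^sub>1 p\<close> is large. This determines the limit of every truncation of the series. The same
  traces show that the proportion of eigenvalues outside the region where the series converges
  geometrically is at most a negative power of \<open>max p\<^sub>1 p\<close>.

  It remains to bound the logarithm on these exceptional eigenvalues, for which a polynomial lower
  bound for the spectral gap suffices, so no Ramanujan bound is needed. For \<open>p = 0\<close> this comes from
  averaging an almost invariant vector over the subgroup generated by the generators. For \<open>p > 0\<close>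
  the pigeonhole principle gives two words that agree modulo \<open>p\<^sub>1\<close> and nearly agree in \<open>SU(2)\<close>; their
  quotient is a small rotation, so an almost invariant vector is close to weight zero for it, and a
  generator that does not commute with this rotation moves weight zero by a definite amount.
\<close>

section \<open>Self-adjoint operators on finite-dimensional Hermitian spaces\<close>

locale hermitian_space = vector_space scale
  for scale :: "complex \<Rightarrow> 'v::ab_group_add \<Rightarrow> 'v" +
  fixes ip :: "'v \<Rightarrow> 'v \<Rightarrow> complex" and E :: "'v set"
  assumes ip_add: "ip (x + y) z = ip x z + ip y z"
    and ip_scale: "ip (scale c x) y = c * ip x y"
    and ip_cnj: "ip y x = cnj (ip x y)"
    and finite_E: "finite E"
    and E_orthonormal: "e \<in> E \<Longrightarrow> f \<in> E \<Longrightarrow> ip e f = of_bool (e = f)"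
begin

abbreviation "lin \<equiv> Vector_Spaces.linear scale scale"

definition orthonormal :: "'v set \<Rightarrow> bool" where
  "orthonormal B \<longleftrightarrow> finite B \<and> (\<forall>e\<in>B. \<forall>f\<in>B. ip e f = of_bool (e = f))"

lemma orthonormal_E: "orthonormal E"
  by (simp add: orthonormal_def finite_E E_orthonormal)

lemma cnj_ip [simp]: "cnj (ip x y) = ip y x"
  by (rule ip_cnj[symmetric])

lemma ip_0_left [simp]: "ip 0 y = 0"
  using ip_scale[of 0 0 y] by simp

lemma ip_sum_left: "ip (\<Sum>i\<in>I. f i) y = (\<Sum>i\<in>I. ip (f i) y)"
  by (induction I rule: infinite_finite_induct) (auto simp: ip_add)

lemma ip_add_right: "ip x (y + z) = ip x y + ip x z"
  by (subst (1 2 3) ip_cnj) (simp only: ip_add complex_cnj_add)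

lemma ip_scale_right: "ip x (scale c y) = cnj c * ip x y"
  by (subst (1 2) ip_cnj) (simp only: ip_scale complex_cnj_mult)

lemma ip_0_right [simp]: "ip x 0 = 0"
  by (subst ip_cnj) (simp del: cnj_ip)

lemma ip_sum_right: "ip x (\<Sum>i\<in>I. f i) = (\<Sum>i\<in>I. ip x (f i))"
  by (induction I rule: infinite_finite_induct) (auto simp: ip_add_right)

lemma ip_minus: "ip (- x) y = - ip x y"
  using ip_scale[of "-1" x y] by simp

lemma ip_diff: "ip (x - y) z = ip x z - ip y z"
  using ip_add[of x "-y" z] by (simp add: ip_minus)

lemma ip_diff_right: "ip z (x - y) = ip z x - ip z y"
  by (subst (1 2 3) ip_cnj) (simp only: ip_diff complex_cnj_diff)

lemma orthonormal_expand:
  assumes "orthonormal B" "x \<in> span B"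
  shows "x = (\<Sum>b\<in>B. scale (ip x b) b)"
  using assms(2)
proof (induction rule: span_induct_alt)
  case base
  then show ?case by simp
next
  case (step c b y)
  have "(\<Sum>d\<in>B. scale (ip (scale c b + y) d) d)
      = (\<Sum>d\<in>B. scale (c * ip b d) d) + (\<Sum>d\<in>B. scale (ip y d) d)"
    by (simp add: ip_add ip_scale scale_left_distrib sum.distrib)
  also have "(\<Sum>d\<in>B. scale (c * ip b d) d) = (\<Sum>d\<in>B. if d = b then scale c d else 0)"
    using assms(1) step by (intro sum.cong) (auto simp: orthonormal_def)
  also have "\<dots> = scale c b"
    using assms(1) step by (auto simp: orthonormal_def)
  finally show ?case using step by simp
qed

lemma orthonormal_independent:
  assumes "orthonormal B" shows "independent B"
proof -
  have "u b = 0" if "(\<Sum>v\<in>B. scale (u v) v) = 0" "b \<in> B" for u b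
  proof -
    have "0 = ip (\<Sum>v\<in>B. scale (u v) v) b" using that by simp
    also have "\<dots> = (\<Sum>v\<in>B. if v = b then u v else 0)"
      unfolding ip_sum_left ip_scale using assms that
      by (intro sum.cong) (auto simp: orthonormal_def)
    also have "\<dots> = u b" using assms that by (auto simp: orthonormal_def)
    finally show ?thesis by simp
  qed
  then show ?thesis
    using assms by (auto simp: dependent_finite orthonormal_def)
qed

lemma orthonormal_zero_notin:
  assumes "orthonormal B" shows "0 \<notin> B"
  using assms by (force simp: orthonormal_def)

lemma parseval:
  assumes "orthonormal B" "x \<in> span B"
  shows "ip x y = (\<Sum>b\<in>B. ip x b * cnj (ip y b))"
proof -
  have "ip x y = ip (\<Sum>b\<in>B. scale (ip x b) b) y"
    using orthonormal_expand[OF assms] by simp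
  also have "\<dots> = (\<Sum>b\<in>B. ip x b * ip b y)"
    by (simp add: ip_sum_left ip_scale)
  finally show ?thesis by simp
qed

definition nrm :: "'v \<Rightarrow> real" where
  "nrm x = L2_set (\<lambda>e. cmod (ip x e)) E"

lemma nrm_nonneg [simp]: "nrm x \<ge> 0"
  by (simp add: nrm_def)

lemma ip_self:
  assumes "x \<in> span E" shows "ip x x = of_real ((nrm x)\<^sup>2)"
proof -
  have "ip x x = (\<Sum>e\<in>E. of_real ((cmod (ip x e))\<^sup>2))"
    unfolding parseval[OF orthonormal_E assms, of x]
    by (simp only: complex_norm_square)
  also have "\<dots> = of_real (\<Sum>e\<in>E. (cmod (ip x e))\<^sup>2)" by simp
  finally show ?thesis by (simp add: nrm_def L2_set_def sum_nonneg)
qed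

lemma nrm_triangle: "nrm (x + y) \<le> nrm x + nrm y"
proof -
  have "nrm (x + y) \<le> L2_set (\<lambda>e. cmod (ip x e) + cmod (ip y e)) E"
    unfolding nrm_def ip_add by (intro L2_set_mono norm_triangle_ineq) auto
  also have "\<dots> \<le> nrm x + nrm y"
    unfolding nrm_def by (rule L2_set_triangle_ineq)
  finally show ?thesis .
qed

lemma nrm_scale: "nrm (scale c x) = cmod c * nrm x"
  by (simp add: nrm_def ip_scale norm_mult L2_set_right_distrib)

lemma nrm_0 [simp]: "nrm 0 = 0"
  by (simp add: nrm_def L2_set_def)

lemma nrm_sum: "nrm (\<Sum>i\<in>I. f i) \<le> (\<Sum>i\<in>I. nrm (f i))"
proof (induction I rule: infinite_finite_induct)
  case (insert a I)
  then show ?case using nrm_triangle[of "f a" "\<Sum>i\<in>I. f i"] by simp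
qed auto

lemma nrm_eq_0:
  assumes "x \<in> span E" "nrm x = 0" shows "x = 0"
proof -
  have "\<forall>e\<in>E. ip x e = 0"
    using assms(2) finite_E by (simp add: nrm_def L2_set_eq_0_iff)
  then show ?thesis
    using orthonormal_expand[OF orthonormal_E assms(1)] by simp
qed

lemma ip_bound:
  assumes "x \<in> span E" shows "cmod (ip x y) \<le> nrm x * nrm y"
proof -
  have "cmod (ip x y) \<le> (\<Sum>e\<in>E. \<bar>cmod (ip x e)\<bar> * \<bar>cmod (ip y e)\<bar>)"
    unfolding parseval[OF orthonormal_E assms, of y]
    by (rule order_trans[OF norm_sum]) (simp add: norm_mult del: cnj_ip)
  also have "\<dots> \<le> nrm x * nrm y"
    unfolding nrm_def by (rule L2_set_mult_ineq)
  finally show ?thesis .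
qed

lemma trace_basis_independent:
  assumes "orthonormal B" "orthonormal C" "span B = span C" "lin S"
    and S: "\<And>x. x \<in> span C \<Longrightarrow> S x \<in> span C"
  shows "(\<Sum>b\<in>B. ip (S b) b) = (\<Sum>c\<in>C. ip (S c) c)"
proof -
  interpret S: Vector_Spaces.linear scale scale S by fact
  have "(\<Sum>b\<in>B. ip (S b) b) = (\<Sum>b\<in>B. \<Sum>c\<in>C. ip (S b) c * ip c b)"
  proof (intro sum.cong refl)
    fix b assume "b \<in> B"
    then have "S b \<in> span C" using assms(3) S span_base by blast
    from parseval[OF assms(2) this, of b]
    show "ip (S b) b = (\<Sum>c\<in>C. ip (S b) c * ip c b)"
      by simp
  qed
  also have "\<dots> = (\<Sum>c\<in>C. \<Sum>b\<in>B. ip (S b) c * ip c b)" by (rule sum.swap)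
  also have "\<dots> = (\<Sum>c\<in>C. ip (S c) c)"
  proof (intro sum.cong refl)
    fix c assume "c \<in> C"
    then have c: "c \<in> span B" using assms(3) span_base by blast
    have "ip (S c) c = ip (S (\<Sum>b\<in>B. scale (ip c b) b)) c"
      using orthonormal_expand[OF assms(1) c] by simp
    also have "\<dots> = (\<Sum>b\<in>B. ip c b * ip (S b) c)"
      by (simp add: S.sum S.scale ip_sum_left ip_scale)
    finally show "(\<Sum>b\<in>B. ip (S b) c * ip c b) = ip (S c) c" by (simp add: mult.commute)
  qed
  finally show ?thesis .
qed

definition poly_act :: "('v \<Rightarrow> 'v) \<Rightarrow> complex poly \<Rightarrow> 'v \<Rightarrow> 'v" where
  "poly_act T q v = (\<Sum>i\<le>degree q. scale (poly.coeff q i) ((T ^^ i) v))"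

lemma poly_act_bound:
  assumes "degree q \<le> n"
  shows "poly_act T q v = (\<Sum>i\<le>n. scale (poly.coeff q i) ((T ^^ i) v))"
  unfolding poly_act_def using assms
  by (intro sum.mono_neutral_left) (auto simp: coeff_eq_0 not_le)

lemma poly_act_linear_factor:
  assumes "lin T"
  shows "poly_act T ([:- l, 1:] * r) v = T (poly_act T r v) - scale l (poly_act T r v)"
proof -
  interpret T: Vector_Spaces.linear scale scale T by fact
  have "degree ([:- l, 1:] * r) \<le> Suc (degree r)"
    using degree_mult_le[of "[:- l, 1:]" r] by simp
  then have "poly_act T ([:- l, 1:] * r) v
      = (\<Sum>i\<le>Suc (degree r). scale (poly.coeff ([:- l, 1:] * r) i) ((T ^^ i) v))"
    by (rule poly_act_bound)
  also have "\<dots> = (\<Sum>i\<le>Suc (degree r). scale (poly.coeff (pCons 0 r) i) ((T ^^ i) v))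
      - (\<Sum>i\<le>Suc (degree r). scale l (scale (poly.coeff r i) ((T ^^ i) v)))"
    by (simp add: sum_subtractf[symmetric] scale_left_diff_distrib algebra_simps
        scale_left_distrib del: sum.atMost_Suc)
  also have "(\<Sum>i\<le>Suc (degree r). scale l (scale (poly.coeff r i) ((T ^^ i) v)))
      = scale l (poly_act T r v)"
    unfolding scale_sum_right[symmetric]
    by (subst poly_act_bound[of r "Suc (degree r)"]) simp_all
  also have "(\<Sum>i\<le>Suc (degree r). scale (poly.coeff (pCons 0 r) i) ((T ^^ i) v)) = T (poly_act T r v)"
    by (subst sum.atMost_Suc_shift) (simp add: poly_act_def T.sum T.scale)
  finally show ?thesis .
qed

lemma eigenvector_exists:
  assumes T: "lin T" and U: "subspace U" "U \<subseteq> span E" "\<And>x. x \<in> U \<Longrightarrow> T x \<in> U"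
    and v: "v \<in> U" "v \<noteq> 0"
  obtains w l where "w \<in> U" "w \<noteq> 0" "T w = scale l w"
proof -
  interpret T: Vector_Spaces.linear scale scale T by fact
  have pow: "(T ^^ i) v \<in> U" for i
    by (induction i) (auto simp: v U)
  have act_U: "poly_act T q v \<in> U" for q
    unfolding poly_act_def by (intro subspace_sum subspace_scale U pow)
  have "\<exists>q. q \<noteq> 0 \<and> poly_act T q v = 0"
  proof (cases "inj_on (\<lambda>i. (T ^^ i) v) {..card E}")
    case True
    let ?S = "(\<lambda>i. (T ^^ i) v) ` {..card E}"
    have "dependent ?S"
    proof (rule ccontr)
      assume "\<not> dependent ?S"
      then have "card ?S \<le> card E"
        using independent_span_bound[OF finite_E] pow U(2) by blast
      then show False using True by (simp add: card_image)
    qed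
    then obtain u i where u: "(\<Sum>x\<in>?S. scale (u x) x) = 0" "i \<le> card E" "u ((T ^^ i) v) \<noteq> 0"
      by (auto simp: dependent_finite)
    define q where "q = (\<Sum>i\<le>card E. Polynomial.monom (u ((T ^^ i) v)) i)"
    have cq: "poly.coeff q j = (if j \<le> card E then u ((T ^^ j) v) else 0)" for j
      by (simp add: q_def coeff_sum if_distrib cong: if_cong)
    have "degree q \<le> card E" by (intro degree_le) (simp add: cq)
    then have "poly_act T q v = (\<Sum>i\<le>card E. scale (u ((T ^^ i) v)) ((T ^^ i) v))"
      by (simp add: poly_act_bound cq)
    also have "\<dots> = 0" using u(1) True by (simp add: sum.reindex)
    finally show ?thesis using u cq[of i] by (metis coeff_0)
  next
    case False
    then obtain i j where ij: "i \<noteq> j" "(T ^^ i) v = (T ^^ j) v" by (auto simp: inj_on_def)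
    let ?q = "Polynomial.monom 1 i - Polynomial.monom 1 j :: complex poly"
    have "poly.coeff ?q i = 1" using ij by simp
    then have "?q \<noteq> 0" by (metis coeff_0 zero_neq_one)
    moreover have "poly_act T ?q v = 0"
    proof -
      have "poly_act T ?q v = (\<Sum>k\<le>max i j. scale (poly.coeff ?q k) ((T ^^ k) v))"
        by (intro poly_act_bound order_trans[OF degree_diff_le_max])
           (simp add: degree_monom_eq)
      also have "\<dots> = (\<Sum>k\<le>max i j. if k = i then (T ^^ k) v else 0)
          - (\<Sum>k\<le>max i j. if k = j then (T ^^ k) v else 0)"
        by (subst sum_subtractf[symmetric])
           (intro sum.cong, auto simp: scale_left_diff_distrib)
      finally show ?thesis using ij by simp
    qed
    ultimately show ?thesis by blast
  qed
  then obtain q where q: "q \<noteq> 0" "poly_act T q v = 0"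
    and min: "\<And>r. r \<noteq> 0 \<Longrightarrow> poly_act T r v = 0 \<Longrightarrow> degree q \<le> degree r"
    using arg_min_natI[of "\<lambda>q. q \<noteq> 0 \<and> poly_act T q v = 0" _ degree]
      arg_min_nat_le[of "\<lambda>q. q \<noteq> 0 \<and> poly_act T q v = 0" _ degree] by blast
  have "degree q \<noteq> 0"
  proof
    assume "degree q = 0"
    then obtain c where "q = [:c:]" by (rule degree_eq_zeroE)
    with q v(2) show False by (simp add: poly_act_def)
  qed
  then have "\<not> constant (poly q)" by (simp add: constant_degree)
  then obtain l where "poly q l = 0" using fundamental_theorem_of_algebra by blast
  then obtain r where r: "q = [:- l, 1:] * r" by (auto simp: poly_eq_0_iff_dvd)
  then have "r \<noteq> 0" using q by auto
  then have "degree q = Suc (degree r)"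
    unfolding r by (subst degree_mult_eq) auto
  then have "poly_act T r v \<noteq> 0" using min[OF \<open>r \<noteq> 0\<close>] by auto
  moreover have "T (poly_act T r v) = scale l (poly_act T r v)"
    using q(2) unfolding r poly_act_linear_factor[OF T] by simp
  ultimately show ?thesis using that act_U by blast
qed

theorem spectral_theorem:
  assumes T: "lin T" and inv: "\<And>x. x \<in> span E \<Longrightarrow> T x \<in> span E"
    and sa: "\<And>x y. x \<in> span E \<Longrightarrow> y \<in> span E \<Longrightarrow> ip (T x) y = ip x (T y)"
  obtains B and \<mu> :: "'v \<Rightarrow> real"
  where "orthonormal B" "span B = span E" "\<And>b. b \<in> B \<Longrightarrow> T b = scale (of_real (\<mu> b)) b"
proof -
  interpret T: Vector_Spaces.linear scale scale T by fact
  define good where "good B \<longleftrightarrow> orthonormal B \<and> B \<subseteq> span E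
      \<and> (\<forall>b\<in>B. \<exists>r::real. T b = scale (of_real r) b)" for B
  have bound: "card B \<le> card E" if "good B" for B
    using that independent_span_bound[OF finite_E] orthonormal_independent
    unfolding good_def by blast
  have "good {}" by (simp add: good_def orthonormal_def)
  then obtain B where B: "good B" and max: "\<And>C. good C \<Longrightarrow> card C \<le> card B"
    using ex_has_greatest_nat[of good "{}" card "Suc (card E)"] bound by (auto simp: less_Suc_eq_le)
  have orth: "orthonormal B" and BE: "B \<subseteq> span E" using B by (auto simp: good_def)
  have "span E \<subseteq> span B"
  proof (rule ccontr)
    assume "\<not> span E \<subseteq> span B"
    then obtain x where x: "x \<in> span E" "x \<notin> span B" by blast
    define U where "U = {y \<in> span E. \<forall>b\<in>B. ip y b = 0}"
    define y where "y = x - (\<Sum>b\<in>B. scale (ip x b) b)"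
    have "subspace U"
      unfolding U_def subspace_def
      by (auto simp: ip_add ip_scale intro: span_add span_scale span_zero)
    moreover have "T z \<in> U" if "z \<in> U" for z
    proof -
      have "ip (T z) b = 0" if "b \<in> B" for b
      proof -
        obtain r :: real where r: "T b = scale (of_real r) b"
          using B \<open>b \<in> B\<close> unfolding good_def by blast
        have "ip (T z) b = ip z (T b)"
          using \<open>z \<in> U\<close> \<open>b \<in> B\<close> BE by (intro sa) (auto simp: U_def)
        also have "\<dots> = 0"
          unfolding r ip_scale_right using \<open>z \<in> U\<close> \<open>b \<in> B\<close> by (simp add: U_def)
        finally show ?thesis .
      qed
      then show ?thesis using inv \<open>z \<in> U\<close> by (auto simp: U_def)
    qed
    moreover have "y \<in> U"
    proof -
      have "y \<in> span E"
        unfolding y_def using x BE by (intro span_diff span_sum span_scale) auto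
      moreover have "ip y c = 0" if "c \<in> B" for c
      proof -
        have "ip y c = ip x c - (\<Sum>b\<in>B. if b = c then ip x b else 0)"
          unfolding y_def ip_diff ip_sum_left ip_scale using orth that
          by (intro arg_cong2[of _ _ _ _ "(-)"] sum.cong) (auto simp: orthonormal_def)
        then show ?thesis using orth that by (simp add: orthonormal_def)
      qed
      ultimately show ?thesis by (simp add: U_def)
    qed
    moreover have "y \<noteq> 0"
    proof
      assume "y = 0"
      then have "x = (\<Sum>b\<in>B. scale (ip x b) b)" by (simp add: y_def)
      moreover have "\<dots> \<in> span B" by (intro span_sum span_scale span_base)
      ultimately show False using x by simp
    qed
    moreover have "U \<subseteq> span E" by (auto simp: U_def)
    ultimately obtain w l where w: "w \<in> U" "w \<noteq> 0" "T w = scale l w"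
      using eigenvector_exists[OF T, of U y] by blast
    have wE: "w \<in> span E" using w by (simp add: U_def)
    have "nrm w \<noteq> 0" using nrm_eq_0 wE w by blast
    have "l * ip w w = cnj l * ip w w"
      using sa[OF wE wE] w(3) by (simp add: ip_scale ip_scale_right)
    then have "cnj l = l" using ip_self[OF wE] \<open>nrm w \<noteq> 0\<close> by simp
    then have l: "of_real (Re l) = l" by (simp add: complex_eq_iff)
    define u where "u = scale (of_real (1 / nrm w)) w"
    have ipu: "ip u u = 1"
      unfolding u_def ip_scale ip_scale_right ip_self[OF wE]
      using \<open>nrm w \<noteq> 0\<close> by (simp add: power2_eq_square)
    have ub: "ip u b = 0 \<and> ip b u = 0" if "b \<in> B" for b
    proof -
      have "ip w b = 0" using w(1) that by (simp add: U_def)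
      moreover have "ip b w = 0" using cnj_ip[of w b] \<open>ip w b = 0\<close> by (metis complex_cnj_zero)
      ultimately show ?thesis unfolding u_def ip_scale ip_scale_right by simp
    qed
    have "u \<notin> B" using ub ipu by auto
    have "T u = scale (of_real (Re l)) u"
      unfolding u_def T.scale w(3) l by (rule scale_left_commute)
    moreover have "u \<in> span E" unfolding u_def by (rule span_scale[OF wE])
    moreover have "orthonormal (insert u B)"
      using orth ipu ub \<open>u \<notin> B\<close> unfolding orthonormal_def by auto
    ultimately have "good (insert u B)"
      using B unfolding good_def by blast
    moreover have "card (insert u B) = Suc (card B)"
      using \<open>u \<notin> B\<close> orth by (simp add: orthonormal_def)
    ultimately show False using max by fastforce
  qed
  then have "span B = span E"
    using BE by (metis span_minimal subset_antisym subspace_span)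
  moreover obtain \<mu> :: "'v \<Rightarrow> real" where "\<And>b. b \<in> B \<Longrightarrow> T b = scale (of_real (\<mu> b)) b"
    using B unfolding good_def by metis
  ultimately show ?thesis by (rule that[OF orth])
qed

lemma eigenspace_eq_span:
  assumes T: "lin T" and B: "orthonormal B"
    and eig: "\<And>b. b \<in> B \<Longrightarrow> T b = scale (\<mu> b) b"
  shows "{x \<in> span B. T x = scale l x} = span {b \<in> B. \<mu> b = l}"
proof (intro equalityI subsetI)
  interpret T: Vector_Spaces.linear scale scale T by fact
  fix x assume x: "x \<in> {x \<in> span B. T x = scale l x}"
  then have ex: "x = (\<Sum>b\<in>B. scale (ip x b) b)" using orthonormal_expand[OF B] by blast
  have "ip x b = 0" if b: "b \<in> B" "\<mu> b \<noteq> l" for b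
  proof -
    have "l * ip x b = ip (T x) b" using x by (simp add: ip_scale)
    also have "T x = (\<Sum>c\<in>B. scale (ip x c) (scale (\<mu> c) c))"
      by (subst ex) (simp add: T.sum T.scale eig)
    also have "ip \<dots> b = (\<Sum>c\<in>B. if c = b then ip x c * \<mu> c else 0)"
      unfolding ip_sum_left ip_scale using B b
      by (intro sum.cong) (auto simp: orthonormal_def)
    also have "\<dots> = ip x b * \<mu> b" using B b by (simp add: orthonormal_def)
    finally show ?thesis using b by (metis mult.commute mult_cancel_left)
  qed
  then have "x = (\<Sum>b\<in>{b \<in> B. \<mu> b = l}. scale (ip x b) b)"
    using B by (subst ex, intro sum.mono_neutral_right) (auto simp: orthonormal_def)
  also have "\<dots> \<in> span {b \<in> B. \<mu> b = l}" by (intro span_sum span_scale span_base)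
  finally show "x \<in> span {b \<in> B. \<mu> b = l}" .
next
  interpret T: Vector_Spaces.linear scale scale T by fact
  fix x assume "x \<in> span {b \<in> B. \<mu> b = l}"
  then show "x \<in> {x \<in> span B. T x = scale l x}"
  proof (induction rule: span_induct_alt)
    case base then show ?case by (simp add: span_zero T.zero)
  next
    case (step c b y)
    have "scale c b + y \<in> span B" using step by (intro span_add span_scale) (auto intro: span_base)
    then show ?case
      using step by (auto simp: T.add T.scale eig scale_right_distrib mult.commute)
  qed
qed

lemma sum_over_spectrum:
  fixes F :: "complex \<Rightarrow> complex"
  assumes T: "lin T" and B: "orthonormal B"
    and eig: "\<And>b. b \<in> B \<Longrightarrow> T b = scale (\<mu> b) b"
  shows "(\<Sum>l\<in>{l. \<exists>x\<in>{x \<in> span B. T x = scale l x}. x \<noteq> 0} - {c}.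
            of_nat (dim {x \<in> span B. T x = scale l x}) * F l)
       = (\<Sum>b\<in>{b \<in> B. \<mu> b \<noteq> c}. F (\<mu> b))"
proof -
  have fin: "finite B" using B by (simp add: orthonormal_def)
  note eq = eigenspace_eq_span[OF T B eig]
  have orth: "orthonormal {b \<in> B. \<mu> b = l}" for l
    using B by (auto simp: orthonormal_def)
  have dim: "dim (span {b \<in> B. \<mu> b = l}) = card {b \<in> B. \<mu> b = l}" for l
    using dim_eq_card_independent[OF orthonormal_independent[OF orth]] by (simp add: dim_span)
  have "(\<exists>x\<in>span {b \<in> B. \<mu> b = l}. x \<noteq> 0) \<longleftrightarrow> l \<in> \<mu> ` B" for l
  proof
    assume "\<exists>x\<in>span {b \<in> B. \<mu> b = l}. x \<noteq> 0"
    then have "{b \<in> B. \<mu> b = l} \<noteq> {}" by (metis span_empty singletonD)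
    then show "l \<in> \<mu> ` B" by blast
  next
    assume "l \<in> \<mu> ` B"
    then obtain b where "b \<in> B" "\<mu> b = l" by blast
    then show "\<exists>x\<in>span {b \<in> B. \<mu> b = l}. x \<noteq> 0"
      using orthonormal_zero_notin[OF B] by (intro bexI[of _ b] span_base) auto
  qed
  then have "{l. \<exists>x\<in>span {b \<in> B. \<mu> b = l}. x \<noteq> 0} - {c} = \<mu> ` {b \<in> B. \<mu> b \<noteq> c}" by auto
  then have "(\<Sum>l\<in>{l. \<exists>x\<in>{x \<in> span B. T x = scale l x}. x \<noteq> 0} - {c}.
            of_nat (dim {x \<in> span B. T x = scale l x}) * F l)
     = (\<Sum>l\<in>\<mu> ` {b \<in> B. \<mu> b \<noteq> c}. of_nat (card {b \<in> B. \<mu> b = l}) * F l)"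
    by (simp only: eq dim)
  also have "\<dots> = (\<Sum>l\<in>\<mu> ` {b \<in> B. \<mu> b \<noteq> c}. \<Sum>b\<in>{b \<in> {b \<in> B. \<mu> b \<noteq> c}. \<mu> b = l}. F (\<mu> b))"
  proof (intro sum.cong refl)
    fix l assume "l \<in> \<mu> ` {b \<in> B. \<mu> b \<noteq> c}"
    then have "{b \<in> {b \<in> B. \<mu> b \<noteq> c}. \<mu> b = l} = {b \<in> B. \<mu> b = l}" by auto
    then show "of_nat (card {b \<in> B. \<mu> b = l}) * F l
        = (\<Sum>b\<in>{b \<in> {b \<in> B. \<mu> b \<noteq> c}. \<mu> b = l}. F (\<mu> b))" by simp
  qed
  also have "\<dots> = (\<Sum>b\<in>{b \<in> B. \<mu> b \<noteq> c}. F (\<mu> b))"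
    using fin by (intro sum.image_gen[symmetric]) auto
  finally show ?thesis .
qed

lemma card_orthonormal_basis:
  assumes "orthonormal B" shows "dim (span B) = card B"
  using dim_eq_card_independent[OF orthonormal_independent[OF assms]] by (simp add: dim_span)

end

section \<open>Integral quaternions\<close>

type_synonym quat = "int \<times> int \<times> int \<times> int"

definition qmul :: "quat \<Rightarrow> quat \<Rightarrow> quat" where
  "qmul = (\<lambda>(a0, a1, a2, a3) (b0, b1, b2, b3).
     (a0 * b0 - a1 * b1 - a2 * b2 - a3 * b3, a0 * b1 + a1 * b0 + a2 * b3 - a3 * b2,
      a0 * b2 - a1 * b3 + a2 * b0 + a3 * b1, a0 * b3 + a1 * b2 - a2 * b1 + a3 * b0))"

definition qcnj :: "quat \<Rightarrow> quat" where
  "qcnj = (\<lambda>(a0, a1, a2, a3). (a0, - a1, - a2, - a3))"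

definition qnorm :: "quat \<Rightarrow> int" where
  "qnorm = (\<lambda>(a0, a1, a2, a3). a0\<^sup>2 + a1\<^sup>2 + a2\<^sup>2 + a3\<^sup>2)"

definition qscal :: "int \<Rightarrow> quat \<Rightarrow> quat" where
  "qscal c = (\<lambda>(a0, a1, a2, a3). (c * a0, c * a1, c * a2, c * a3))"

abbreviation qone :: quat where "qone \<equiv> (1, 0, 0, 0)"

definition qreal :: "quat \<Rightarrow> bool" where
  "qreal = (\<lambda>(a0, a1, a2, a3). a1 = 0 \<and> a2 = 0 \<and> a3 = 0)"

lemmas quat_defs = qmul_def qcnj_def qnorm_def qscal_def qreal_def

lemma qmul_assoc: "qmul (qmul a b) c = qmul a (qmul b c)"
  by (cases a; cases b; cases c) (simp add: quat_defs algebra_simps)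

lemma qmul_one [simp]: "qmul qone a = a" "qmul a qone = a"
  by (cases a; simp add: quat_defs)+

lemma qnorm_mult: "qnorm (qmul a b) = qnorm a * qnorm b"
  by (cases a; cases b) (simp add: quat_defs power2_eq_square algebra_simps)

lemma qcnj_mult: "qcnj (qmul a b) = qmul (qcnj b) (qcnj a)"
  by (cases a; cases b) (simp add: quat_defs)

lemma qcnj_qcnj [simp]: "qcnj (qcnj a) = a"
  by (cases a) (simp add: quat_defs)

lemma qcnj_one [simp]: "qcnj qone = qone"
  by (simp add: quat_defs)

lemma qnorm_cnj [simp]: "qnorm (qcnj a) = qnorm a"
  by (cases a) (simp add: quat_defs)

lemma qmul_cnj: "qmul a (qcnj a) = (qnorm a, 0, 0, 0)" "qmul (qcnj a) a = (qnorm a, 0, 0, 0)"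
  by (cases a; simp add: quat_defs power2_eq_square)+

lemma qmul_real: "qmul (c, 0, 0, 0) a = qscal c a" "qmul a (c, 0, 0, 0) = qscal c a"
  by (cases a; simp add: quat_defs)+

lemma qmul_scal: "qmul (qscal c a) b = qscal c (qmul a b)" "qmul a (qscal c b) = qscal c (qmul a b)"
  by (cases a; cases b; simp add: quat_defs algebra_simps)+

lemma qreal_scal [simp]: "qreal (qscal c a) \<longleftrightarrow> c = 0 \<or> qreal a"
  by (cases a) (auto simp: quat_defs)

lemma qnorm_scal: "qnorm (qscal c a) = c\<^sup>2 * qnorm a"
  by (cases a) (simp add: quat_defs power_mult_distrib algebra_simps)

definition qdvd :: "int \<Rightarrow> quat \<Rightarrow> bool" where
  "qdvd d q \<longleftrightarrow> (\<exists>r. q = qscal d r)"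

lemma qdvd_iff: "qdvd d (a0, a1, a2, a3) \<longleftrightarrow> d dvd a0 \<and> d dvd a1 \<and> d dvd a2 \<and> d dvd a3"
  by (auto simp: qdvd_def qscal_def dvd_def)

lemma qdvd_mult: "qdvd d a \<Longrightarrow> qdvd d (qmul a b)" "qdvd d b \<Longrightarrow> qdvd d (qmul a b)"
  unfolding qdvd_def by (metis qmul_scal)+

lemma gens_iff:
  "(a0, a1, a2, a3) \<in> gens p \<longleftrightarrow>
    qnorm (a0, a1, a2, a3) = int p \<and> a0 > 0 \<and> odd a0 \<and> even a1 \<and> even a2 \<and> even a3"
  by (simp add: gens_def qnorm_def)

lemma gens_norm: "a \<in> gens p \<Longrightarrow> qnorm a = int p"
  by (cases a) (simp add: gens_iff)

lemma gens_cnj [simp]: "qcnj a \<in> gens p \<longleftrightarrow> a \<in> gens p"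
  by (cases a) (auto simp: gens_iff qcnj_def qnorm_def)

lemma bij_betw_qcnj_gens: "bij_betw qcnj (gens p) (gens p)"
  by (rule bij_betw_byWitness[where f' = qcnj]) auto

lemma qnorm_coord_bound:
  assumes "qnorm (a0, a1, a2, a3) \<le> n"
  shows "\<bar>a0\<bar> \<le> n" "\<bar>a1\<bar> \<le> n" "\<bar>a2\<bar> \<le> n" "\<bar>a3\<bar> \<le> n"
proof -
  have sq: "\<bar>x\<bar> \<le> x\<^sup>2" for x :: int
    using self_le_power[of "\<bar>x\<bar>" 2] by (cases "x = 0") auto
  show "\<bar>a0\<bar> \<le> n" "\<bar>a1\<bar> \<le> n" "\<bar>a2\<bar> \<le> n" "\<bar>a3\<bar> \<le> n"
    using assms sq[of a0] sq[of a1] sq[of a2] sq[of a3] zero_le_power2[of a0]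
      zero_le_power2[of a1] zero_le_power2[of a2] zero_le_power2[of a3]
    unfolding qnorm_def by auto
qed

lemma finite_gens [simp]: "finite (gens p)"
proof (rule finite_subset)
  let ?I = "{- int p..int p}"
  show "gens p \<subseteq> ?I \<times> ?I \<times> ?I \<times> ?I"
  proof
    fix a assume a: "a \<in> gens p"
    obtain a0 a1 a2 a3 where aa: "a = (a0, a1, a2, a3)" by (cases a)
    have "qnorm (a0, a1, a2, a3) \<le> int p" using gens_norm[OF a] by (simp add: aa)
    from qnorm_coord_bound[OF this] show "a \<in> ?I \<times> ?I \<times> ?I \<times> ?I"
      by (auto simp: aa)
  qed
qed auto

subsection \<open>Reduced words\<close>

lemma gens_eq:
  assumes p: "prime p" "odd p" and a: "a \<in> gens p" and b: "b \<in> gens p"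
    and d: "qdvd (int p) (qmul a (qcnj b))"
  shows "a = b"
proof -
  obtain r where r: "qmul a (qcnj b) = qscal (int p) r" using d by (auto simp: qdvd_def)
  have p0: "int p \<noteq> 0" using p by auto
  have "qnorm (qmul a (qcnj b)) = (int p)\<^sup>2"
    using a b by (simp add: qnorm_mult gens_norm power2_eq_square)
  then have nr: "qnorm r = 1" using p0 by (simp add: r qnorm_scal)
  obtain r0 r1 r2 r3 where rr: "r = (r0, r1, r2, r3)" by (cases r)
  obtain a0 a1 a2 a3 where aa: "a = (a0, a1, a2, a3)" by (cases a)
  obtain b0 b1 b2 b3 where bb: "b = (b0, b1, b2, b3)" by (cases b)
  have "int p * r0 = a0 * b0 + a1 * b1 + a2 * b2 + a3 * b3"
    using r unfolding aa bb rr by (simp add: quat_defs)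
  moreover have "odd (a0 * b0 + a1 * b1 + a2 * b2 + a3 * b3)"
    using a b unfolding aa bb by (simp add: gens_iff)
  ultimately have "odd (int p * r0)" by simp
  then have "r0 \<noteq> 0" by auto
  then have "r0\<^sup>2 \<ge> 1" by (simp add: int_one_le_iff_zero_less)
  then have sq: "r0\<^sup>2 = 1" "r1\<^sup>2 = 0" "r2\<^sup>2 = 0" "r3\<^sup>2 = 0"
    using nr zero_le_power2[of r1] zero_le_power2[of r2] zero_le_power2[of r3]
    unfolding rr qnorm_def prod.case by linarith+
  then have r123: "r1 = 0" "r2 = 0" "r3 = 0" and r0: "r0 = 1 \<or> r0 = -1"
    by (auto simp: power2_eq_1_iff)
  have "qscal (int p) a = qmul (qmul a (qcnj b)) b"
    using gens_norm[OF b] by (simp add: qmul_assoc qmul_cnj qmul_real)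
  also have "\<dots> = qscal (int p) (qscal r0 b)"
    unfolding r rr r123 by (simp add: qmul_scal qmul_real)
  finally have "a = qscal r0 b" using p0 unfolding aa bb by (simp add: quat_defs)
  with r0 show ?thesis using a b unfolding aa bb by (auto simp: gens_iff quat_defs)
qed

lemma gens_not_dvd:
  assumes "prime p" "a \<in> gens p" shows "\<not> qdvd (int p) a"
proof
  assume "qdvd (int p) a"
  then obtain r where "a = qscal (int p) r" by (auto simp: qdvd_def)
  then have "int p = (int p)\<^sup>2 * qnorm r" using gens_norm[OF assms(2)] by (simp add: qnorm_scal)
  then have "int p * qnorm r = 1" using assms(1) by (auto simp: power2_eq_square)
  then show False using assms(1) by (auto simp: zmult_eq_1_iff prime_nat_iff)
qed

definition qprod :: "quat list \<Rightarrow> quat" where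
  "qprod w = foldr qmul w qone"

lemma qprod_simps [simp]: "qprod [] = qone" "qprod (a # w) = qmul a (qprod w)"
  by (simp_all add: qprod_def)

lemma qprod_append: "qprod (u @ v) = qmul (qprod u) (qprod v)"
  by (induction u) (auto simp: qmul_assoc)

lemma qcnj_qprod: "qcnj (qprod w) = qprod (rev (map qcnj w))"
  by (induction w) (auto simp: qprod_append qcnj_mult)

lemma qnorm_qprod: "set w \<subseteq> gens p \<Longrightarrow> qnorm (qprod w) = int p ^ length w"
  by (induction w) (auto simp: qnorm_mult gens_norm, simp add: qnorm_def)

definition reduced :: "quat list \<Rightarrow> bool" where
  "reduced w \<longleftrightarrow> successively (\<lambda>x y. y \<noteq> qcnj x) w"


lemma qdvd_add: "qdvd d a \<Longrightarrow> qdvd d b \<Longrightarrow> qdvd d (a + b)"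
  by (cases a; cases b) (auto simp: qdvd_iff)

lemma qdvd_scal: "d dvd c \<Longrightarrow> qdvd d (qscal c a)"
  by (cases a) (auto simp: qdvd_iff qscal_def)

lemma qdvd_scal_cancel:
  assumes "prime p" "qdvd p (qscal c a)" "\<not> qdvd p a" shows "p dvd c"
  using assms by (cases a) (auto simp: qdvd_iff qscal_def prime_dvd_mult_iff)

text \<open>Cayley-Hamilton for \<open>b x\<close>, multiplied by \<open>a\<close> on the left. Modulo a prime dividing
  \<open>qnorm b\<close> only the trace term survives.\<close>

lemma qmul_sandwich:
  "qmul (qmul a (qmul b x)) b
    = qscal (2 * fst (qmul b x)) (qmul a b) - qscal (qnorm b) (qmul a (qcnj x))"
  by (cases a; cases b; cases x) (simp add: quat_defs power2_eq_square algebra_simps)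

lemma qdvd_left_cancel:
  assumes p: "prime (p :: int)" "odd p" "p dvd qnorm b" and ab: "\<not> qdvd p (qmul a b)"
    and d: "qdvd p (qmul a (qmul b x))"
  shows "qdvd p (qmul b x)"
proof -
  have re: "p dvd fst (qmul b (qmul x y))" for y
  proof -
    have "qdvd p (qmul (qmul a (qmul b (qmul x y))) b + qscal (qnorm b) (qmul a (qcnj (qmul x y))))"
      using d p(3) by (intro qdvd_add qdvd_scal) (auto simp: qmul_assoc[symmetric] intro: qdvd_mult)
    then have "p dvd 2 * fst (qmul b (qmul x y))"
      unfolding qmul_sandwich using ab by (intro qdvd_scal_cancel[OF p(1) _ ab]) simp
    moreover have "\<not> p dvd 2"
      using zdvd_imp_le[of p 2] prime_ge_2_int[OF p(1)] p(2) by auto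
    ultimately show ?thesis using p(1) by (simp add: prime_dvd_mult_iff)
  qed
  obtain z0 z1 z2 z3 where z: "qmul b x = (z0, z1, z2, z3)" by (cases "qmul b x")
  have "p dvd fst (qmul (z0, z1, z2, z3) y)" for y
    using re[of y] by (simp add: qmul_assoc[symmetric] z)
  from this[of qone] this[of "(0, 1, 0, 0)"] this[of "(0, 0, 1, 0)"] this[of "(0, 0, 0, 1)"]
  show ?thesis unfolding z qdvd_iff by (simp add: qmul_def)
qed

lemma reduced_not_dvd:
  assumes p: "prime p" "odd p" and "set w \<subseteq> gens p" "reduced w" "w \<noteq> []"
  shows "\<not> qdvd (int p) (qprod w)"
  using assms(3-)
proof (induction w rule: induct_list012)
  case (2 a)
  then show ?case using gens_not_dvd p by auto
next
  case (3 a b w)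
  then have "\<not> qdvd (int p) (qmul b (qprod w))" by (simp add: reduced_def)
  moreover have "\<not> qdvd (int p) (qmul a b)"
  proof
    assume "qdvd (int p) (qmul a b)"
    then have "a = qcnj b" using 3 p by (intro gens_eq[OF p]) auto
    then show False using 3 by (simp add: reduced_def)
  qed
  moreover have "int p dvd qnorm b" using 3 gens_norm[of b p] by simp
  ultimately show ?case using qdvd_left_cancel[of "int p" b a "qprod w"] p by auto
qed simp

lemma reduced_not_real:
  assumes p: "prime p" "odd p" and w: "set w \<subseteq> gens p" "reduced w" "w \<noteq> []"
  shows "\<not> qreal (qprod w)"
proof
  assume "qreal (qprod w)"
  then obtain c where c: "qprod w = (c, 0, 0, 0)" by (cases "qprod w") (auto simp: qreal_def)
  then have "c\<^sup>2 = int p ^ length w" using qnorm_qprod[OF w(1)] by (simp add: qnorm_def)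
  then have "int p dvd c"
    using w(3) p(1) by (metis dvd_power length_greater_0_conv prime_dvd_power prime_nat_int_transfer)
  then have "qdvd (int p) (qprod w)" by (simp add: c qdvd_iff)
  then show False using reduced_not_dvd[OF p w] by simp
qed

lemma reduced_quotient_not_real:
  assumes p: "prime p" "odd p" and len: "length u = length w"
    and "set u \<subseteq> gens p" "set w \<subseteq> gens p" "reduced u" "reduced w" "u \<noteq> w"
  shows "\<not> qreal (qmul (qcnj (qprod u)) (qprod w))"
  using assms(3-)
proof (induction u w rule: list_induct2)
  case (Cons x u y w)
  have red: "reduced u" "reduced w"
    using Cons.prems by (auto simp: reduced_def successively_Cons)
  show ?case
  proof (cases "x = y")
    case True
    have "qmul (qcnj (qprod (x # u))) (qprod (y # w))
        = qmul (qcnj (qprod u)) (qmul (qmul (qcnj x) x) (qprod w))"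
      using True by (simp add: qcnj_mult qmul_assoc)
    also have "\<dots> = qscal (int p) (qmul (qcnj (qprod u)) (qprod w))"
      using Cons.prems gens_norm[of x p] by (simp add: qmul_cnj qmul_real qmul_scal)
    finally show ?thesis using Cons True red p by auto
  next
    case False
    have "successively (\<lambda>x y. y \<noteq> qcnj x) (rev (map qcnj (x # u)))"
      using Cons.prems(3)
      unfolding reduced_def successively_rev successively_map
      by (rule successively_mono) auto
    then have "reduced (rev (map qcnj (x # u)) @ (y # w))"
      using Cons.prems(4) False unfolding reduced_def successively_append_iff by auto
    moreover have "set (rev (map qcnj (x # u)) @ (y # w)) \<subseteq> gens p"
      using Cons.prems by auto
    ultimately have "\<not> qreal (qprod (rev (map qcnj (x # u)) @ (y # w)))"
      by (intro reduced_not_real[OF p]) auto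
    then show ?thesis unfolding qprod_append qcnj_qprod .
  qed
qed simp

subsection \<open>The matrix of a quaternion modulo a prime, and the number of generators\<close>

definition qm11 :: "int \<Rightarrow> quat \<Rightarrow> int" where "qm11 c = (\<lambda>(a0, a1, a2, a3). a0 + c * a1)"
definition qm12 :: "int \<Rightarrow> quat \<Rightarrow> int" where "qm12 c = (\<lambda>(a0, a1, a2, a3). a2 + c * a3)"
definition qm21 :: "int \<Rightarrow> quat \<Rightarrow> int" where "qm21 c = (\<lambda>(a0, a1, a2, a3). - a2 + c * a3)"
definition qm22 :: "int \<Rightarrow> quat \<Rightarrow> int" where "qm22 c = (\<lambda>(a0, a1, a2, a3). a0 - c * a1)"

lemmas qm_defs = qm11_def qm12_def qm21_def qm22_def

lemma qm_mult:
  assumes "p dvd c\<^sup>2 + 1"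
  shows "[qm11 c (qmul a b) = qm11 c a * qm11 c b + qm12 c a * qm21 c b] (mod p)"
    "[qm12 c (qmul a b) = qm11 c a * qm12 c b + qm12 c a * qm22 c b] (mod p)"
    "[qm21 c (qmul a b) = qm21 c a * qm11 c b + qm22 c a * qm21 c b] (mod p)"
    "[qm22 c (qmul a b) = qm21 c a * qm12 c b + qm22 c a * qm22 c b] (mod p)"
proof -
  obtain a0 a1 a2 a3 b0 b1 b2 b3 where a: "a = (a0, a1, a2, a3)" and b: "b = (b0, b1, b2, b3)"
    by (cases a; cases b)
  have "qm11 c (qmul a b) - (qm11 c a * qm11 c b + qm12 c a * qm21 c b)
      = (c\<^sup>2 + 1) * - (a1 * b1 + a3 * b3)"
    "qm12 c (qmul a b) - (qm11 c a * qm12 c b + qm12 c a * qm22 c b)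
      = (c\<^sup>2 + 1) * (a3 * b1 - a1 * b3)"
    "qm21 c (qmul a b) - (qm21 c a * qm11 c b + qm22 c a * qm21 c b)
      = (c\<^sup>2 + 1) * (a1 * b3 - a3 * b1)"
    "qm22 c (qmul a b) - (qm21 c a * qm12 c b + qm22 c a * qm22 c b)
      = (c\<^sup>2 + 1) * - (a1 * b1 + a3 * b3)"
    by (simp_all add: a b qm_defs qmul_def power2_eq_square algebra_simps)
  then show "[qm11 c (qmul a b) = qm11 c a * qm11 c b + qm12 c a * qm21 c b] (mod p)"
    "[qm12 c (qmul a b) = qm11 c a * qm12 c b + qm12 c a * qm22 c b] (mod p)"
    "[qm21 c (qmul a b) = qm21 c a * qm11 c b + qm22 c a * qm21 c b] (mod p)"
    "[qm22 c (qmul a b) = qm21 c a * qm12 c b + qm22 c a * qm22 c b] (mod p)"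
    using assms by (simp_all add: cong_iff_dvd_diff)
qed

lemma qm_det:
  assumes "p dvd c\<^sup>2 + 1"
  shows "[qm11 c a * qm22 c a - qm12 c a * qm21 c a = qnorm a] (mod p)"
proof -
  obtain a0 a1 a2 a3 where a: "a = (a0, a1, a2, a3)" by (cases a)
  have "qm11 c a * qm22 c a - qm12 c a * qm21 c a - qnorm a = (c\<^sup>2 + 1) * - (a1\<^sup>2 + a3\<^sup>2)"
    by (simp add: a qm_defs qnorm_def power2_eq_square algebra_simps)
  then show ?thesis using assms by (simp add: cong_iff_dvd_diff)
qed

lemma sqrt_neg_one_not_dvd:
  fixes p c :: int
  assumes "prime p" "p dvd c\<^sup>2 + 1" shows "\<not> p dvd c"
proof
  assume "p dvd c"
  then have "p dvd c\<^sup>2" by (simp add: power2_eq_square)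
  then have "p dvd 1" using assms(2) by (simp add: dvd_add_right_iff)
  then show False using assms(1) not_prime_unit by blast
qed

lemma qm_eq_0:
  assumes p: "prime p" "odd p" and c: "p dvd c\<^sup>2 + 1"
    and d: "p dvd qm12 c a" "p dvd qm21 c a"
  shows "p dvd fst (snd (snd a))" "p dvd snd (snd (snd a))"
proof -
  obtain a0 a1 a2 a3 where a: "a = (a0, a1, a2, a3)" by (cases a)
  have 2: "\<not> p dvd 2" using zdvd_imp_le[of p 2] prime_ge_2_int[OF p(1)] p(2) by auto
  note pc = sqrt_neg_one_not_dvd[OF p(1) c]
  have "p dvd qm12 c a - qm21 c a" "p dvd qm12 c a + qm21 c a"
    using d by (auto intro: dvd_diff dvd_add)
  then have "p dvd 2 * a2" "p dvd 2 * (a3 * c)" by (simp_all add: a qm_defs mult.commute)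
  then show "p dvd fst (snd (snd a))" "p dvd snd (snd (snd a))"
    unfolding prime_dvd_mult_iff[OF p(1)] using 2 pc by (simp_all add: a)
qed

lemma qm_eq_0':
  assumes p: "prime p" "odd p" and c: "p dvd c\<^sup>2 + 1" and d: "p dvd qm11 c a - qm22 c a"
  shows "p dvd fst (snd a)"
proof -
  obtain a0 a1 a2 a3 where a: "a = (a0, a1, a2, a3)" by (cases a)
  have 2: "\<not> p dvd 2" using zdvd_imp_le[of p 2] prime_ge_2_int[OF p(1)] p(2) by auto
  note pc = sqrt_neg_one_not_dvd[OF p(1) c]
  have "p dvd 2 * (a1 * c)" using d by (simp add: a qm_defs mult.commute)
  then show ?thesis unfolding prime_dvd_mult_iff[OF p(1)] using 2 pc by (simp add: a)
qed

lemma qm_all_dvd: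
  assumes p: "prime p" "odd p" and c: "p dvd c\<^sup>2 + 1"
    and d: "p dvd qm11 c a" "p dvd qm12 c a" "p dvd qm21 c a" "p dvd qm22 c a"
  shows "qdvd p a"
proof -
  obtain a0 a1 a2 a3 where a: "a = (a0, a1, a2, a3)" by (cases a)
  have a1: "p dvd a1" using qm_eq_0'[OF p c, of a] d by (simp add: a dvd_diff)
  have "p dvd qm11 c a - c * a1" using d a1 by (intro dvd_diff) auto
  then have "p dvd a0" by (simp add: a qm_defs)
  then show ?thesis using a1 qm_eq_0[OF p c d(2,3)] by (simp add: a qdvd_iff)
qed

definition kills :: "int \<Rightarrow> int \<Rightarrow> int \<times> int \<Rightarrow> quat \<Rightarrow> bool" where
  "kills p c v a \<longleftrightarrow> p dvd qm11 c a * fst v + qm12 c a * snd v \<and>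
     p dvd qm21 c a * fst v + qm22 c a * snd v"

lemma kills_mult:
  assumes c: "p dvd c\<^sup>2 + 1" and k: "kills p c v a"
  shows "kills p c v (qmul b a)"
proof -
  obtain x y where v: "v = (x, y)" by (cases v)
  note m = qm_mult[OF c, of b a]
  have e1: "[qm11 c a * x + qm12 c a * y = 0] (mod p)" "[qm21 c a * x + qm22 c a * y = 0] (mod p)"
    using k by (auto simp: kills_def v cong_0_iff)
  have "[qm11 c (qmul b a) * x + qm12 c (qmul b a) * y
      = (qm11 c b * qm11 c a + qm12 c b * qm21 c a) * x
        + (qm11 c b * qm12 c a + qm12 c b * qm22 c a) * y] (mod p)"
    by (intro cong_add cong_mult m cong_refl)
  also have "(qm11 c b * qm11 c a + qm12 c b * qm21 c a) * x
        + (qm11 c b * qm12 c a + qm12 c b * qm22 c a) * y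
      = qm11 c b * (qm11 c a * x + qm12 c a * y) + qm12 c b * (qm21 c a * x + qm22 c a * y)"
    by (simp add: algebra_simps)
  also have "[\<dots> = qm11 c b * 0 + qm12 c b * 0] (mod p)"
    by (intro cong_add cong_mult e1 cong_refl)
  finally have 1: "p dvd qm11 c (qmul b a) * x + qm12 c (qmul b a) * y" by (simp add: cong_0_iff)
  have "[qm21 c (qmul b a) * x + qm22 c (qmul b a) * y
      = (qm21 c b * qm11 c a + qm22 c b * qm21 c a) * x
        + (qm21 c b * qm12 c a + qm22 c b * qm22 c a) * y] (mod p)"
    by (intro cong_add cong_mult m cong_refl)
  also have "(qm21 c b * qm11 c a + qm22 c b * qm21 c a) * x
        + (qm21 c b * qm12 c a + qm22 c b * qm22 c a) * y
      = qm21 c b * (qm11 c a * x + qm12 c a * y) + qm22 c b * (qm21 c a * x + qm22 c a * y)"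
    by (simp add: algebra_simps)
  also have "[\<dots> = qm21 c b * 0 + qm22 c b * 0] (mod p)"
    by (intro cong_add cong_mult e1 cong_refl)
  finally have "p dvd qm21 c (qmul b a) * x + qm22 c (qmul b a) * y" by (simp add: cong_0_iff)
  with 1 show ?thesis by (simp add: kills_def v)
qed

definition proj_points :: "int \<Rightarrow> (int \<times> int) set" where
  "proj_points p = insert (0, 1) (Pair 1 ` {0..<p})"

lemma card_proj_points: "card (proj_points (int p)) = p + 1" and
  finite_proj_points: "finite (proj_points (int p))"
proof -
  have "card (Pair (1::int) ` {0..<int p}) = p"
    by (subst card_image) (auto simp: inj_on_def)
  then show "card (proj_points (int p)) = p + 1"
    unfolding proj_points_def by (subst card_insert_disjoint) auto
qed (simp add: proj_points_def)

lemma kills_norm: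
  assumes p: "prime p" and c: "p dvd c\<^sup>2 + 1" and v: "v \<in> proj_points p" and k: "kills p c v a"
  shows "p dvd qnorm a"
proof -
  let ?D = "qm11 c a * qm22 c a - qm12 c a * qm21 c a"
  consider "v = (0, 1)" | t where "v = (1, t)" using v by (auto simp: proj_points_def)
  then have "p dvd ?D"
  proof cases
    case 1
    then show ?thesis using k by (auto simp: kills_def)
  next
    case 2
    then have "?D = (qm11 c a + qm12 c a * t) * qm22 c a - qm12 c a * (qm21 c a + qm22 c a * t)"
      by (simp add: algebra_simps)
    then show ?thesis using k 2 by (auto simp: kills_def intro!: dvd_diff)
  qed
  then show ?thesis using cong_dvd_iff[OF qm_det[OF c, of a]] by simp
qed

lemma qm_cnj:
  "qm11 c (qcnj a) = qm22 c a" "qm22 c (qcnj a) = qm11 c a"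
  "qm12 c (qcnj a) = - qm12 c a" "qm21 c (qcnj a) = - qm21 c a"
  by (cases a; simp add: qm_defs qcnj_def)+

text \<open>If \<open>a\<close> and \<open>b\<close> kill the same line, then that line is the image of the conjugate of \<open>a\<close>,
  so \<open>b\<close> times the conjugate of \<open>a\<close> vanishes modulo \<open>p\<close>.\<close>

lemma kills_unique:
  assumes p: "prime p" "odd p" and c: "int p dvd c\<^sup>2 + 1" and v: "v \<in> proj_points (int p)"
    and a: "a \<in> gens p" "kills (int p) c v a" and b: "b \<in> gens p" "kills (int p) c v b"
  shows "a = b"
proof -
  have "qdvd (int p) (qmul b (qcnj a))"
  proof (rule qm_all_dvd[OF _ _ c])
    note m = cong_dvd_iff[OF qm_mult(1)[OF c, of b "qcnj a"]]
      cong_dvd_iff[OF qm_mult(2)[OF c, of b "qcnj a"]]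
      cong_dvd_iff[OF qm_mult(3)[OF c, of b "qcnj a"]]
      cong_dvd_iff[OF qm_mult(4)[OF c, of b "qcnj a"]]
    have *: "int p dvd x * w - y * z" if "int p dvd x + y * t" "int p dvd z + w * t" for x y z w t :: int
    proof -
      have "x * w - y * z = (x + y * t) * w - y * (z + w * t)" by (simp add: algebra_simps)
      then show ?thesis using that by (auto intro!: dvd_diff)
    qed
    consider "v = (0, 1)" | t where "v = (1, t)" using v by (auto simp: proj_points_def)
    note cs = this
    show "int p dvd qm11 c (qmul b (qcnj a))"
      using cs *[of "qm11 c b" "qm12 c b" _ "qm21 c a" "qm22 c a"] a(2) b(2)
      unfolding m qm_cnj by cases (auto simp: kills_def)
    show "int p dvd qm12 c (qmul b (qcnj a))"
      using cs *[of "qm11 c a" "qm12 c a" _ "qm11 c b" "qm12 c b"] a(2) b(2)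
      unfolding m qm_cnj by cases (auto simp: kills_def mult.commute)
    show "int p dvd qm21 c (qmul b (qcnj a))"
      using cs *[of "qm21 c b" "qm22 c b" _ "qm21 c a" "qm22 c a"] a(2) b(2)
      unfolding m qm_cnj by cases (auto simp: kills_def)
    show "int p dvd qm22 c (qmul b (qcnj a))"
      using cs *[of "qm11 c a" "qm12 c a" _ "qm21 c b" "qm22 c b"] a(2) b(2)
      unfolding m qm_cnj by cases (auto simp: kills_def mult.commute)
  qed (use p in auto)
  then show ?thesis using gens_eq[OF p b(1) a(1)] by simp
qed

lemma kills_point_exists:
  assumes p: "prime p" and c: "p dvd c\<^sup>2 + 1" and n: "p dvd qnorm a"
  shows "\<exists>v\<in>proj_points p. kills p c v a"
proof -
  let ?D = "qm11 c a * qm22 c a - qm12 c a * qm21 c a"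
  have D: "p dvd ?D" using n cong_dvd_iff[OF qm_det[OF c, of a]] by simp
  have solve: "\<exists>t\<in>{0..<p}. p dvd x + y * t" if "\<not> p dvd y" for x y
  proof -
    have "coprime y p" using that p by (simp add: prime_imp_coprime coprime_commute)
    then obtain z where z: "[y * z = 1] (mod p)" using cong_solve_coprime_int by blast
    have "[x + y * ((- x * z) mod p) = x + y * (- x * z)] (mod p)"
      by (intro cong_add cong_mult cong_refl) (simp add: cong_def)
    also have "x + y * (- x * z) = x + (y * z) * (- x)" by (simp add: algebra_simps)
    also have "[\<dots> = x + 1 * (- x)] (mod p)" by (intro cong_add cong_mult cong_refl z)
    finally have "p dvd x + y * ((- x * z) mod p)" by (simp add: cong_0_iff)
    moreover have "(- x * z) mod p \<in> {0..<p}" using prime_gt_0_int[OF p] by simp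
    ultimately show ?thesis by blast
  qed
  consider "\<not> p dvd qm12 c a" | "p dvd qm12 c a" "p dvd qm22 c a"
    | "p dvd qm12 c a" "\<not> p dvd qm22 c a" by blast
  then show ?thesis
  proof cases
    case 1
    then obtain t where t: "t \<in> {0..<p}" "p dvd qm11 c a + qm12 c a * t" using solve by blast
    have "qm12 c a * (qm21 c a + qm22 c a * t) = (qm11 c a + qm12 c a * t) * qm22 c a - ?D"
      by (simp add: algebra_simps)
    also have "p dvd \<dots>" using dvd_diff[OF dvd_mult2[OF t(2)] D] .
    finally have "p dvd qm21 c a + qm22 c a * t" using 1 p by (simp add: prime_dvd_mult_iff)
    then show ?thesis using t by (intro bexI[of _ "(1, t)"]) (auto simp: kills_def proj_points_def)
  next
    case 2
    then show ?thesis by (intro bexI[of _ "(0, 1)"]) (auto simp: kills_def proj_points_def)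
  next
    case 3
    have "p dvd ?D + qm12 c a * qm21 c a" using 3 D by (intro dvd_add) auto
    then have "p dvd qm11 c a" using 3 p by (simp add: prime_dvd_mult_iff)
    moreover obtain t where t: "t \<in> {0..<p}" "p dvd qm21 c a + qm22 c a * t" using solve 3 by blast
    ultimately show ?thesis
      using t 3 by (intro bexI[of _ "(1, t)"]) (auto simp: kills_def proj_points_def)
  qed
qed

lemma kills_two_points:
  assumes p: "prime p" and v: "v \<in> proj_points p" "w \<in> proj_points p" "v \<noteq> w"
    and k: "kills p c v a" "kills p c w a"
  shows "p dvd qm11 c a" "p dvd qm12 c a" "p dvd qm21 c a" "p dvd qm22 c a"
proof -
  have *: "p dvd x \<and> p dvd y"
    if "p dvd x * fst v + y * snd v" "p dvd x * fst w + y * snd w" for x y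
  proof -
    have tw: "p dvd x \<and> p dvd y"
      if st: "s \<in> {0..<p}" "t \<in> {0..<p}" "s \<noteq> t" "p dvd x + y * s" "p dvd x + y * t" for s t
    proof -
      have "p dvd (x + y * s) - (x + y * t)" using st by (intro dvd_diff)
      then have "p dvd y * (s - t)" by (simp add: algebra_simps)
      moreover have "\<not> p dvd s - t"
        using st dvd_imp_le_int[of "s - t" p] by auto
      ultimately have "p dvd y" using p by (simp add: prime_dvd_mult_iff)
      then show ?thesis using st(4) by (simp add: dvd_add_left_iff)
    qed
    consider "v = (0, 1)" "w = (0, 1)"
      | t where "v = (0, 1)" "w = (1, t)" | t where "v = (1, t)" "w = (0, 1)"
      | s t where "v = (1, s)" "w = (1, t)" "s \<in> {0..<p}" "t \<in> {0..<p}"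
      using v unfolding proj_points_def by blast
    then show ?thesis
    proof cases
      case 4
      then show ?thesis using tw[of s t] that v(3) by auto
    qed (use that v(3) in \<open>auto simp: dvd_add_left_iff\<close>)
  qed
  show "p dvd qm11 c a" "p dvd qm12 c a" "p dvd qm21 c a" "p dvd qm22 c a"
    using *[of "qm11 c a" "qm12 c a"] *[of "qm21 c a" "qm22 c a"] k by (auto simp: kills_def)
qed

lemma kills_descend:
  assumes p: "prime p" and c: "p dvd c\<^sup>2 + 1" and k: "kills p c v a"
    and q: "qmul u a = qscal d b" and d: "\<not> p dvd d"
  shows "kills p c v b"
proof -
  have *: "qm11 c (qscal d b) = d * qm11 c b" "qm12 c (qscal d b) = d * qm12 c b"
    "qm21 c (qscal d b) = d * qm21 c b" "qm22 c (qscal d b) = d * qm22 c b"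
    by (cases b; simp add: qm_defs qscal_def algebra_simps)+
  have "kills p c v (qscal d b)" using kills_mult[OF c k, of u] q by simp
  then have "p dvd d * (qm11 c b * fst v + qm12 c b * snd v)"
    "p dvd d * (qm21 c b * fst v + qm22 c b * snd v)"
    unfolding kills_def * by (simp_all add: algebra_simps)
  then show ?thesis using p d by (simp add: kills_def prime_dvd_mult_iff)
qed

lemma kills_short_exists:
  assumes p: "prime p"
  shows "\<exists>a. kills (int p) c v a \<and> 0 < qnorm a \<and> qnorm a < 4 * int p"
proof -
  obtain r :: nat where r: "r\<^sup>2 \<le> p" "p < (Suc r)\<^sup>2"
    using floor_sqrt_power2_le[of p] Suc_floor_sqrt_power2_gt[of p] by blast
  have "r\<^sup>2 \<noteq> p" using p prime_power_iff[of r 2] by auto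
  then have r': "(int r)\<^sup>2 < int p" using r by (metis le_neq_implies_less of_nat_less_iff of_nat_power)
  let ?I = "{0..int r}"
  let ?B = "?I \<times> ?I \<times> ?I \<times> ?I"
  let ?f = "\<lambda>a. ((qm11 c a * fst v + qm12 c a * snd v) mod int p,
                (qm21 c a * fst v + qm22 c a * snd v) mod int p)"
  let ?R = "{0..<int p} \<times> {0..<int p}"
  have "?f ` ?B \<subseteq> ?R" using prime_gt_0_nat[OF p] by auto
  then have "card (?f ` ?B) \<le> card ?R" by (intro card_mono) auto
  also have "card ?R = p * p" by (simp add: card_cartesian_product)
  also have "\<dots> < (Suc r)\<^sup>2 * (Suc r)\<^sup>2" using r(2) by (intro mult_strict_mono) auto
  also have "\<dots> = card ?B" 
  proof -
    have "card ?I = Suc r" by (simp add: nat_add_distrib)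
    then show ?thesis by (simp only: card_cartesian_product power2_eq_square mult.assoc)
  qed
  finally have "\<not> inj_on ?f ?B" using pigeonhole by blast
  moreover have "\<exists>a\<in>B. \<exists>b\<in>B. a \<noteq> b \<and> f a = f b" if "\<not> inj_on f B"
    for f :: "quat \<Rightarrow> int \<times> int" and B
    using that unfolding inj_on_def by blast
  ultimately obtain a b where ab: "a \<in> ?B" "b \<in> ?B" "a \<noteq> b" "?f a = ?f b"
    by meson
  obtain a0 a1 a2 a3 b0 b1 b2 b3 where aa: "a = (a0, a1, a2, a3)" and bb: "b = (b0, b1, b2, b3)"
    by (cases a; cases b)
  have "kills (int p) c v (a - b)"
  proof -
    have *: "qm11 c (a - b) = qm11 c a - qm11 c b" "qm12 c (a - b) = qm12 c a - qm12 c b"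
      "qm21 c (a - b) = qm21 c a - qm21 c b" "qm22 c (a - b) = qm22 c a - qm22 c b"
      by (cases a; cases b; simp add: qm_defs algebra_simps)+
    have "int p dvd (qm11 c a * fst v + qm12 c a * snd v) - (qm11 c b * fst v + qm12 c b * snd v)"
      "int p dvd (qm21 c a * fst v + qm22 c a * snd v) - (qm21 c b * fst v + qm22 c b * snd v)"
      using ab(4) by (auto simp: mod_eq_dvd_iff)
    then show ?thesis unfolding kills_def * by (simp add: algebra_simps)
  qed
  moreover have "qnorm (a - b) > 0"
  proof -
    have "qnorm (a - b) \<noteq> 0"
      using ab(3) zero_le_power2[of "a0 - b0"] zero_le_power2[of "a1 - b1"]
        zero_le_power2[of "a2 - b2"] zero_le_power2[of "a3 - b3"]
      unfolding aa bb qnorm_def by (auto simp: add_nonneg_eq_0_iff)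
    moreover have "qnorm (a - b) \<ge> 0" unfolding aa bb qnorm_def by simp
    ultimately show ?thesis by simp
  qed
  moreover have "qnorm (a - b) < 4 * int p"
  proof -
    have sq: "(x - y)\<^sup>2 \<le> (int r)\<^sup>2" if "x \<in> ?I" "y \<in> ?I" for x y
      using that by (intro power2_le_iff_abs_le[THEN iffD2]) auto
    have "(a0 - b0)\<^sup>2 \<le> (int r)\<^sup>2" "(a1 - b1)\<^sup>2 \<le> (int r)\<^sup>2" "(a2 - b2)\<^sup>2 \<le> (int r)\<^sup>2"
      "(a3 - b3)\<^sup>2 \<le> (int r)\<^sup>2" using ab unfolding aa bb by (auto intro!: sq)
    moreover have "qnorm (a - b) = (a0 - b0)\<^sup>2 + (a1 - b1)\<^sup>2 + (a2 - b2)\<^sup>2 + (a3 - b3)\<^sup>2"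
      unfolding aa bb qnorm_def by simp
    ultimately show ?thesis using r' by linarith
  qed
  ultimately show ?thesis by blast
qed

lemma qnorm_descend_2:
  assumes "qnorm a = 2 * n"
  shows "\<exists>u b. qmul u a = qscal 2 b \<and> qnorm b = n"
proof -
  obtain x0 x1 x2 x3 where a: "a = (x0, x1, x2, x3)" by (cases a)
  have "even (x0\<^sup>2 + x1\<^sup>2 + x2\<^sup>2 + x3\<^sup>2)" using assms by (simp add: a qnorm_def)
  then have ev: "even (x0 + x1 + x2 + x3)" by simp
  have "\<exists>u b. qmul u a = qscal 2 b \<and> qnorm u = 2"
  proof -
    consider "even (x0 + x1)" "even (x2 + x3)" | "even (x0 + x2)" "even (x1 + x3)"
      | "even (x0 + x3)" "even (x1 + x2)" using ev by fastforce
    then show ?thesis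
    proof cases
      case 1
      then show ?thesis
        by (intro exI[of _ "(1, -1, 0, 0)"]
            exI[of _ "((x0+x1) div 2, (x1-x0) div 2, (x2+x3) div 2, (x3-x2) div 2)"])
          (simp add: a quat_defs)
    next
      case 2
      then show ?thesis
        by (intro exI[of _ "(1, 0, -1, 0)"]
            exI[of _ "((x0+x2) div 2, (x1-x3) div 2, (x2-x0) div 2, (x3+x1) div 2)"])
          (simp add: a quat_defs)
    next
      case 3
      then show ?thesis
        by (intro exI[of _ "(1, 0, 0, -1)"]
            exI[of _ "((x0+x3) div 2, (x1+x2) div 2, (x2-x1) div 2, (x3-x0) div 2)"])
          (simp add: a quat_defs)
    qed
  qed
  then obtain u b where ub: "qmul u a = qscal 2 b" "qnorm u = 2" by blast
  have "2 * (2 * n) = qnorm (qmul u a)" unfolding qnorm_mult ub(2) assms ..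
  also have "\<dots> = 4 * qnorm b" unfolding ub(1) qnorm_scal by simp
  finally have "qnorm b = n" by simp
  then show ?thesis using ub by blast
qed

lemma qnorm_descend_3:
  assumes "qnorm a = 3 * n" "\<not> 3 dvd n"
  shows "\<exists>u b. qmul u a = qscal 3 b \<and> qnorm b = n"
proof -
  obtain x0 x1 x2 x3 where a: "a = (x0, x1, x2, x3)" by (cases a)
  define rep :: "int \<Rightarrow> int" where "rep x = (x + 1) mod 3 - 1" for x
  define del :: "int \<Rightarrow> int" where "del x = (x + 1) div 3" for x
  have x: "x = 3 * del x + rep x" for x
    using mult_div_mod_eq[of 3 "x + 1"] unfolding rep_def del_def by linarith
  have rep: "rep x = -1 \<or> rep x = 0 \<or> rep x = 1" for x unfolding rep_def by presburger
  then have rep01: "(rep x)\<^sup>2 = 0 \<or> (rep x)\<^sup>2 = 1" for x by (metis power2_minus power_one zero_power2)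
  define g where "g = (rep x0, rep x1, rep x2, rep x3)"
  define e where "e = (del x0, del x1, del x2, del x3)"
  have age: "a = qscal 3 e + g"
    using x[of x0] x[of x1] x[of x2] x[of x3] by (simp add: a g_def e_def qscal_def)
  have "3 dvd x\<^sup>2 - (rep x)\<^sup>2" for x
  proof -
    have "x\<^sup>2 - (rep x)\<^sup>2 = (x - rep x) * (x + rep x)" by (simp add: power2_eq_square algebra_simps)
    also have "x - rep x = 3 * del x" using x[of x] by simp
    finally show ?thesis by simp
  qed
  then have "3 dvd (x0\<^sup>2 - (rep x0)\<^sup>2) + (x1\<^sup>2 - (rep x1)\<^sup>2) + (x2\<^sup>2 - (rep x2)\<^sup>2) + (x3\<^sup>2 - (rep x3)\<^sup>2)"
    by (intro dvd_add)
  then have "3 dvd qnorm a - qnorm g" by (simp add: a g_def qnorm_def algebra_simps)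
  then have "3 dvd qnorm g" using assms(1) by presburger
  moreover have "qnorm g \<noteq> 0"
  proof
    assume "qnorm g = 0"
    then have "rep x0 = 0" "rep x1 = 0" "rep x2 = 0" "rep x3 = 0"
      using zero_le_power2[of "rep x0"] zero_le_power2[of "rep x1"] zero_le_power2[of "rep x2"]
        zero_le_power2[of "rep x3"]
      unfolding g_def qnorm_def by (auto simp: add_nonneg_eq_0_iff)
    then have "a = qscal 3 e" by (simp add: age g_def qscal_def e_def)
    then have "3 * n = 9 * qnorm e" using assms(1) by (simp add: qnorm_scal)
    then show False using assms(2) by presburger
  qed
  ultimately have ng: "qnorm g = 3"
    using rep01[of x0] rep01[of x1] rep01[of x2] rep01[of x3]
    unfolding g_def qnorm_def by auto
  define b where "b = qmul (qcnj g) e + qone"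
  have "qmul (qcnj g) a = qmul (qcnj g) (qscal 3 e) + qmul (qcnj g) g"
    unfolding age by (cases g; cases e) (simp add: quat_defs algebra_simps)
  also have "\<dots> = qscal 3 b"
    unfolding qmul_cnj ng b_def by (cases g; cases e) (simp add: quat_defs algebra_simps)
  finally have gb: "qmul (qcnj g) a = qscal 3 b" .
  have "3 * (3 * n) = qnorm (qmul (qcnj g) a)" using assms(1) ng by (simp add: qnorm_mult)
  also have "\<dots> = 9 * qnorm b" unfolding gb qnorm_scal by simp
  finally have "qnorm b = n" by simp
  then show ?thesis using gb by blast
qed

lemma qnorm_to_gens:
  assumes "qnorm a = int p" "[p = 1] (mod 4)"
  shows "\<exists>u. qmul u a \<in> gens p"
proof -
  obtain x0 x1 x2 x3 where a: "a = (x0, x1, x2, x3)" by (cases a)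
  have sq: "x\<^sup>2 mod 4 = x mod 2" for x :: int
  proof (cases "even x")
    case True
    then obtain k where "x = 2 * k" by blast
    then show ?thesis by (simp add: power2_eq_square)
  next
    case False
    then obtain k where "x = 2 * k + 1" by (elim oddE)
    then have "x\<^sup>2 = 4 * (k * k + k) + 1" by (simp add: power2_eq_square algebra_simps)
    then have "x\<^sup>2 mod 4 = 1" by presburger
    then show ?thesis using False by (simp add: odd_iff_mod_2_eq_one)
  qed
  have e: "x mod 2 = 0 \<or> x mod 2 = 1" for x :: int by presburger
  have mod4: "(s0 mod 4 + s1 mod 4 + s2 mod 4 + s3 mod 4) mod 4 = 1"
    if "(s0 + s1 + s2 + s3) mod 4 = 1" for s0 s1 s2 s3 :: int
    using that by presburger
  have "int p mod 4 = 1" using assms(2) by (simp add: cong_def flip: of_nat_mod) presburger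
  then have "(x0\<^sup>2 + x1\<^sup>2 + x2\<^sup>2 + x3\<^sup>2) mod 4 = 1" using assms(1) by (simp add: a qnorm_def)
  then have "(x0 mod 2 + x1 mod 2 + x2 mod 2 + x3 mod 2) mod 4 = 1"
    unfolding sq[symmetric] by (rule mod4)
  then consider "odd x0" "even x1" "even x2" "even x3" | "even x0" "odd x1" "even x2" "even x3"
    | "even x0" "even x1" "odd x2" "even x3" | "even x0" "even x1" "even x2" "odd x3"
    using e[of x0] e[of x1] e[of x2] e[of x3] unfolding even_iff_mod_2_eq_zero by auto
  then obtain u where u: "qnorm u = 1"
    "\<And>y0 y1 y2 y3. qmul u a = (y0, y1, y2, y3) \<Longrightarrow> odd y0 \<and> even y1 \<and> even y2 \<and> even y3"
  proof cases
    case 1 then show ?thesis by (intro that[of qone]) (auto simp: a quat_defs)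
  next
    case 2 then show ?thesis by (intro that[of "(0, 1, 0, 0)"]) (auto simp: a quat_defs)
  next
    case 3 then show ?thesis by (intro that[of "(0, 0, 1, 0)"]) (auto simp: a quat_defs)
  next
    case 4 then show ?thesis by (intro that[of "(0, 0, 0, 1)"]) (auto simp: a quat_defs)
  qed
  obtain y0 y1 y2 y3 where y: "qmul u a = (y0, y1, y2, y3)" by (cases "qmul u a")
  have n: "qnorm (y0, y1, y2, y3) = int p" using assms(1) u(1) by (simp add: y[symmetric] qnorm_mult)
  have "y0 \<noteq> 0" using u(2)[OF y] by auto
  then consider "y0 > 0" | "y0 < 0" by linarith
  then show ?thesis
  proof cases
    case 1
    then show ?thesis using u(2)[OF y] n y by (intro exI[of _ u]) (simp add: gens_iff)
  next
    case 2
    have "qmul (qscal (-1) u) a = (- y0, - y1, - y2, - y3)"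
      unfolding qmul_scal y by (simp add: qscal_def)
    then show ?thesis using u(2)[OF y] n 2
      by (intro exI[of _ "qscal (-1) u"]) (simp add: gens_iff qnorm_def)
  qed
qed

lemma kills_gens_exists:
  assumes p: "prime p" "[p = 1] (mod 4)" and c: "int p dvd c\<^sup>2 + 1"
    and v: "v \<in> proj_points (int p)"
  shows "\<exists>a\<in>gens p. kills (int p) c v a"
proof -
  have pp: "prime (int p)" using p by simp
  have p4: "p mod 4 = 1" using p(2) by (simp add: cong_def)
  then have "p \<noteq> 2" "p \<noteq> 3" by auto
  then have p23: "\<not> int p dvd 2" "\<not> int p dvd 3" "\<not> 3 dvd int p"
    using p(1) primes_dvd_imp_eq[of p 2] primes_dvd_imp_eq[of p 3] primes_dvd_imp_eq[of 3 p]
    by (auto simp: int_dvd_int_iff[of _ 2, simplified] int_dvd_int_iff[of _ 3, simplified]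
        int_dvd_int_iff[of 3, simplified])
  obtain a where a: "kills (int p) c v a" "0 < qnorm a" "qnorm a < 4 * int p"
    using kills_short_exists[OF p(1)] by blast
  obtain n where n: "qnorm a = int p * n" using kills_norm[OF pp c v a(1)] by blast
  have "n > 0" using a(2) n by (simp add: zero_less_mult_iff)
  moreover have "n < 4" using a(3) n prime_gt_0_nat[OF p(1)] by simp
  ultimately consider "n = 1" | "n = 2" | "n = 3" by linarith
  then obtain b where b: "kills (int p) c v b" "qnorm b = int p"
  proof cases
    case 1 then show ?thesis using that a n by simp
  next
    case 2
    then obtain u b where "qmul u a = qscal 2 b" "qnorm b = int p"
      using qnorm_descend_2[of a "int p"] n by auto
    then show ?thesis using that kills_descend[OF pp c a(1) _ p23(1)] by blast
  next
    case 3
    then obtain u b where "qmul u a = qscal 3 b" "qnorm b = int p"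
      using qnorm_descend_3[of a "int p"] n p23(3) by auto
    then show ?thesis using that kills_descend[OF pp c a(1) _ p23(2)] by blast
  qed
  then show ?thesis using qnorm_to_gens[OF b(2) p(2)] kills_mult[OF c b(1)] by blast
qed

theorem card_gens:
  assumes p: "prime p" "[p = 1] (mod 4)"
  shows "card (gens p) = p + 1"
proof -
  have p4: "p mod 4 = 1" using p(2) by (simp add: cong_def)
  have "p > 2" using p4 prime_ge_2_nat[OF p(1)] by (cases "p = 2") auto
  have "odd p" using p4 by presburger
  have "even ((p - 1) div 2)" using p4 by presburger
  then have "[Legendre (-1) (int p) = 1] (mod int p)"
    using euler_criterion[OF p(1) \<open>p > 2\<close>, of "-1"] by simp
  moreover have "\<not> [-1 = 1] (mod int p)" "\<not> [0 = 1] (mod int p)"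
    using \<open>p > 2\<close> by (auto simp: cong_iff_dvd_diff dest: zdvd_imp_le)
  ultimately have "Legendre (-1) (int p) = 1"
    by (auto simp: Legendre_def split: if_splits)
  then obtain c where "[c\<^sup>2 = -1] (mod int p)"
    by (auto simp: Legendre_def QuadRes_def split: if_splits)
  then have c: "int p dvd c\<^sup>2 + 1" by (simp add: cong_iff_dvd_diff)
  define f where "f v = (SOME a. a \<in> gens p \<and> kills (int p) c v a)" for v
  have f: "f v \<in> gens p \<and> kills (int p) c v (f v)" if "v \<in> proj_points (int p)" for v
    using kills_gens_exists[OF p c that] unfolding f_def by (metis (mono_tags, lifting) someI_ex)
  have "bij_betw f (proj_points (int p)) (gens p)"
    unfolding bij_betw_def
  proof
    show "inj_on f (proj_points (int p))"
    proof (rule inj_onI, rule ccontr)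
      fix v w assume vw: "v \<in> proj_points (int p)" "w \<in> proj_points (int p)" "f v = f w" "v \<noteq> w"
      have "qdvd (int p) (f v)"
        using kills_two_points[OF _ vw(1,2,4), of c "f v"] f[OF vw(1)] f[OF vw(2)] vw(3) p
          \<open>odd p\<close> c by (intro qm_all_dvd) auto
      then show False using gens_not_dvd p(1) f[OF vw(1)] by blast
    qed
    show "f ` proj_points (int p) = gens p"
    proof (intro equalityI subsetI)
      fix a assume a: "a \<in> gens p"
      then obtain v where v: "v \<in> proj_points (int p)" "kills (int p) c v a"
        using kills_point_exists[of "int p" c a] gens_norm[OF a] p(1) c by auto
      then have "f v = a" using kills_unique[OF p(1) \<open>odd p\<close> c v(1)] f[OF v(1)] a by blast
      then show "a \<in> f ` proj_points (int p)" using v by blast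
    qed (use f in blast)
  qed
  then show ?thesis using bij_betw_same_card card_proj_points by metis
qed

section \<open>The groups PGL(2) and PSL(2) over a prime field\<close>

definition red :: "int \<Rightarrow> int^2^2 \<Rightarrow> int^2^2" where
  "red m M = (\<chi> i j. M$i$j mod m)"

definition idet :: "int^2^2 \<Rightarrow> int" where
  "idet M = M$1$1 * M$2$2 - M$1$2 * M$2$1"

lemma mat2_nth [simp]:
  "mat2 a b c d $ 1 $ 1 = a" "mat2 a b c d $ 1 $ 2 = b"
  "mat2 a b c d $ 2 $ 1 = c" "mat2 a b c d $ 2 $ 2 = d"
  by (simp_all add: mat2_def)

lemma matrix_mult_2:
  fixes M N :: "'a::semiring_1^2^2"
  shows "(M ** N) $ i $ j = M$i$1 * N$1$j + M$i$2 * N$2$j"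
  by (simp add: matrix_matrix_mult_def sum_2)

lemma idet_mult: "idet (M ** N) = idet M * idet N"
  by (simp add: idet_def matrix_mult_2 algebra_simps)

lemma red_red [simp]: "red m (red m M) = red m M"
  by (simp add: red_def vec_eq_iff)

lemma red_mult: "red m (red m M ** N) = red m (M ** N)" "red m (M ** red m N) = red m (M ** N)"
proof -
  have 1: "(a mod m * b + c mod m * d) mod m = (a * b + c * d) mod m" for a b c d :: int
    by (metis mod_add_eq mod_mult_left_eq)
  have 2: "(a * (b mod m) + c * (d mod m)) mod m = (a * b + c * d) mod m" for a b c d :: int
    by (metis mod_add_eq mod_mult_right_eq)
  show "red m (red m M ** N) = red m (M ** N)" "red m (M ** red m N) = red m (M ** N)"
    by (simp_all add: vec_eq_iff red_def matrix_mult_2 1 2)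
qed

lemma idet_red: "idet (red m M) mod m = idet M mod m"
proof -
  have "[idet (red m M) = idet M] (mod m)"
    unfolding idet_def red_def by (intro cong_diff cong_mult) simp_all
  then show ?thesis by (simp add: cong_def)
qed

locale prime_field_matrices =
  fixes p :: nat
  assumes prime_p: "prime p"
begin

abbreviation "R \<equiv> residue_ring (int p)"
abbreviation "G \<equiv> GL2 R"
abbreviation "Z \<equiv> scalars2 R"
abbreviation cls :: "int^2^2 \<Rightarrow> (int^2^2) set" where "cls M \<equiv> PGL2_class R (red (int p) M)"

lemma p_gt_1: "int p > 1"
  using prime_gt_1_nat[OF prime_p] by simp

sublocale residues_prime p R
  by unfold_locales (simp_all add: prime_p)

lemma Units_iff: "c \<in> Units R \<longleftrightarrow> 0 < c \<and> c < int p"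
  using res_prime_units_eq by auto

lemma carrier_iff: "c \<in> carrier R \<longleftrightarrow> 0 \<le> c \<and> c < int p"
  by (auto simp: residue_ring_def)

lemma det2_eq: "det2 R M = idet M mod int p"
  unfolding det2_def idet_def a_minus_def res_neg_eq res_add_eq res_mult_eq
  by (simp add: mod_simps)

lemma mod_in_Units: "c mod int p \<in> Units R \<longleftrightarrow> \<not> int p dvd c"
  using p_gt_1 pos_mod_bound[of "int p" c] pos_mod_sign[of "int p" c]
  by (auto simp: Units_iff dvd_eq_mod_eq_0 less_le)

lemma carrier_GL2: "M \<in> carrier G \<longleftrightarrow> red (int p) M = M \<and> \<not> int p dvd idet M"
proof -
  have "(\<forall>i j. M$i$j \<in> carrier R) \<longleftrightarrow> red (int p) M = M"
    using p_gt_1 by (auto simp: carrier_iff red_def vec_eq_iff mod_pos_pos_trivial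
        intro: pos_mod_bound pos_mod_sign) (metis pos_mod_sign pos_mod_bound zless_imp_add1_zle
        of_nat_0_less_iff prime_p prime_gt_0_nat)+
  then show ?thesis by (simp add: GL2_def det2_eq mod_in_Units)
qed

lemma mult_GL2: "M \<otimes>\<^bsub>G\<^esub> N = red (int p) (M ** N)"
  by (simp add: GL2_def res_mult_eq res_add_eq vec_eq_iff red_def matrix_mult_2 mod_simps)

lemma one_GL2: "\<one>\<^bsub>G\<^esub> = mat2 1 0 0 1"
  by (simp add: GL2_def res_one_eq res_zero_eq)

lemma red_in_GL2: "\<not> int p dvd idet M \<Longrightarrow> red (int p) M \<in> carrier G"
  using idet_red[of "int p" M] by (simp add: carrier_GL2 dvd_eq_mod_eq_0)

lemma mult_red: "red (int p) M \<otimes>\<^bsub>G\<^esub> red (int p) N = red (int p) (M ** N)"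
  by (simp add: mult_GL2 red_mult)

lemma not_dvd_mult: "\<not> int p dvd a \<Longrightarrow> \<not> int p dvd b \<Longrightarrow> \<not> int p dvd a * b"
  using prime_p by (simp add: prime_dvd_mult_iff)

lemma inverse_exists:
  assumes "\<not> int p dvd c" obtains d where "[c * d = 1] (mod int p)" "\<not> int p dvd d"
proof -
  have "coprime c (int p)"
    using assms prime_p prime_imp_coprime[of "int p" c] by (simp add: coprime_commute)
  then obtain d where d: "[c * d = 1] (mod int p)" using cong_solve_coprime_int by blast
  moreover have "\<not> int p dvd d"
  proof
    assume "int p dvd d"
    then have "int p dvd c * d" by simp
    then have "int p dvd 1" using d by (simp add: cong_dvd_iff)
    then show False using p_gt_1 by simp
  qed
  ultimately show ?thesis by (rule that)
qed

lemma group_GL2: "group G"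
proof (rule groupI)
  fix M N assume "M \<in> carrier G" "N \<in> carrier G"
  then show "M \<otimes>\<^bsub>G\<^esub> N \<in> carrier G"
    unfolding mult_GL2 by (intro red_in_GL2) (simp add: carrier_GL2 idet_mult not_dvd_mult)
next
  show "\<one>\<^bsub>G\<^esub> \<in> carrier G"
    using p_gt_1 unfolding one_GL2 carrier_GL2
    by (simp add: idet_def red_def vec_eq_iff forall_2)
next
  fix M N K assume "M \<in> carrier G" "N \<in> carrier G" "K \<in> carrier G"
  then show "M \<otimes>\<^bsub>G\<^esub> N \<otimes>\<^bsub>G\<^esub> K = M \<otimes>\<^bsub>G\<^esub> (N \<otimes>\<^bsub>G\<^esub> K)"
    by (simp add: mult_GL2 red_mult matrix_mul_assoc)
next
  fix M assume "M \<in> carrier G"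
  then show "\<one>\<^bsub>G\<^esub> \<otimes>\<^bsub>G\<^esub> M = M"
    by (simp add: mult_GL2 carrier_GL2 one_GL2 vec_eq_iff forall_2 red_def matrix_mult_2)
next
  fix M assume M: "M \<in> carrier G"
  then have "\<not> int p dvd idet M" by (simp add: carrier_GL2)
  then obtain d where d: "[idet M * d = 1] (mod int p)" "\<not> int p dvd d" using inverse_exists by blast
  define N where "N = mat2 (d * M$2$2) (- d * M$1$2) (- d * M$2$1) (d * M$1$1)"
  have "idet N = d * d * idet M" by (simp add: N_def idet_def algebra_simps)
  then have "red (int p) N \<in> carrier G"
    using d M by (intro red_in_GL2) (auto simp: carrier_GL2 not_dvd_mult)
  moreover have "red (int p) N \<otimes>\<^bsub>G\<^esub> M = \<one>\<^bsub>G\<^esub>"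
  proof -
    have "N ** M = mat2 (idet M * d) 0 0 (idet M * d)"
      by (simp add: vec_eq_iff forall_2 matrix_mult_2 N_def idet_def algebra_simps)
    then have "red (int p) (N ** M) = mat2 1 0 0 1"
      using d(1) p_gt_1 by (simp add: red_def vec_eq_iff forall_2 cong_def)
    then show ?thesis by (simp add: mult_GL2 red_mult one_GL2)
  qed
  ultimately show "\<exists>N\<in>carrier G. N \<otimes>\<^bsub>G\<^esub> M = \<one>\<^bsub>G\<^esub>" by blast
qed

interpretation GL: group G by (rule group_GL2)

lemma scalars2_iff: "M \<in> Z \<longleftrightarrow> (\<exists>c. M = mat2 c 0 0 c \<and> 0 < c \<and> c < int p)"
  by (auto simp: scalars2_def Units_iff res_zero_eq)

lemma scalar_mult: "mat2 c 0 0 c ** M = M ** mat2 c 0 0 (c :: int)"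
  by (simp add: vec_eq_iff forall_2 matrix_mult_2 mult.commute)

lemma red_scalar_in_Z:
  assumes "\<not> int p dvd c" shows "red (int p) (mat2 c 0 0 c) \<in> Z"
proof -
  have "red (int p) (mat2 c 0 0 c) = mat2 (c mod int p) 0 0 (c mod int p)"
    by (simp add: red_def vec_eq_iff forall_2)
  then show ?thesis using assms mod_in_Units[of c] unfolding scalars2_iff Units_iff by blast
qed

lemma Z_scalar:
  assumes "M \<in> Z" obtains c where "M = red (int p) (mat2 c 0 0 c)" "\<not> int p dvd c"
proof -
  obtain c where c: "M = mat2 c 0 0 c" "0 < c" "c < int p" using assms scalars2_iff by blast
  then have "M = red (int p) (mat2 c 0 0 c)" by (simp add: red_def vec_eq_iff forall_2)
  moreover have "\<not> int p dvd c" using c by (auto dest: zdvd_imp_le)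
  ultimately show ?thesis by (rule that)
qed

lemma Z_subset: "Z \<subseteq> carrier G"
proof
  fix M assume "M \<in> Z"
  then obtain c where "M = red (int p) (mat2 c 0 0 c)" "\<not> int p dvd c" by (rule Z_scalar)
  then show "M \<in> carrier G" by (auto intro!: red_in_GL2 simp: idet_def not_dvd_mult)
qed

lemma subgroup_Z: "subgroup Z G"
proof (rule GL.subgroupI)
  show "Z \<noteq> {}" using red_scalar_in_Z[of 1] p_gt_1 by auto
next
  fix M assume "M \<in> Z"
  then obtain c where c: "M = red (int p) (mat2 c 0 0 c)" "\<not> int p dvd c" by (rule Z_scalar)
  obtain d where d: "[c * d = 1] (mod int p)" "\<not> int p dvd d" using inverse_exists c(2) by blast
  have "mat2 d 0 0 d ** mat2 c 0 0 c = mat2 (c * d) 0 0 (c * d)"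
    by (simp add: vec_eq_iff forall_2 matrix_mult_2 mult.commute)
  moreover have "red (int p) (mat2 (c * d) 0 0 (c * d)) = mat2 1 0 0 1"
    using d(1) p_gt_1 by (simp add: red_def vec_eq_iff forall_2 cong_def)
  ultimately have "red (int p) (mat2 d 0 0 d) \<otimes>\<^bsub>G\<^esub> M = \<one>\<^bsub>G\<^esub>"
    unfolding c(1) mult_red one_GL2 by simp
  then have "inv\<^bsub>G\<^esub> M = red (int p) (mat2 d 0 0 d)"
    using Z_subset \<open>M \<in> Z\<close> red_scalar_in_Z[OF d(2)] by (intro GL.inv_equality) auto
  then show "inv\<^bsub>G\<^esub> M \<in> Z" using red_scalar_in_Z[OF d(2)] by simp
next
  fix M N assume "M \<in> Z" "N \<in> Z"
  then obtain c d where c: "M = red (int p) (mat2 c 0 0 c)" "\<not> int p dvd c"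
    and d: "N = red (int p) (mat2 d 0 0 d)" "\<not> int p dvd d" by (meson Z_scalar)
  have "mat2 c 0 0 c ** mat2 d 0 0 d = mat2 (c * d) 0 0 (c * d)"
    by (simp add: vec_eq_iff forall_2 matrix_mult_2)
  then show "M \<otimes>\<^bsub>G\<^esub> N \<in> Z"
    unfolding c d mult_red using red_scalar_in_Z not_dvd_mult c d by metis
qed (rule Z_subset)

lemma normal_Z: "Z \<lhd> G"
proof (rule GL.normalI[OF subgroup_Z], intro ballI)
  fix M assume "M \<in> carrier G"
  have "N \<otimes>\<^bsub>G\<^esub> M = M \<otimes>\<^bsub>G\<^esub> N" if "N \<in> Z" for N
    using that unfolding scalars2_iff mult_GL2 by (auto simp: scalar_mult)
  then show "Z #>\<^bsub>G\<^esub> M = M <#\<^bsub>G\<^esub> Z"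
    by (auto simp: r_coset_def l_coset_def)
qed

lemma group_PGL2: "group (PGL2 R)"
  unfolding PGL2_def by (rule normal.factorgroup_is_group[OF normal_Z])

lemma carrier_PGL2: "carrier (PGL2 R) = PGL2_class R ` carrier G"
  by (auto simp: PGL2_def FactGroup_def RCOSETS_def PGL2_class_def)

lemma cls_in_PGL2: "\<not> int p dvd idet M \<Longrightarrow> cls M \<in> carrier (PGL2 R)"
  unfolding carrier_PGL2 by (intro imageI red_in_GL2)

lemma PGL2_class_mult:
  assumes "M \<in> carrier G" "N \<in> carrier G"
  shows "PGL2_class R M \<otimes>\<^bsub>PGL2 R\<^esub> PGL2_class R N = PGL2_class R (M \<otimes>\<^bsub>G\<^esub> N)"
  using normal.rcos_sum[OF normal_Z assms] by (simp add: PGL2_def FactGroup_def PGL2_class_def)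

lemma cls_mult:
  assumes "\<not> int p dvd idet M" "\<not> int p dvd idet N"
  shows "cls M \<otimes>\<^bsub>PGL2 R\<^esub> cls N = cls (M ** N)"
  using PGL2_class_mult[OF red_in_GL2[OF assms(1)] red_in_GL2[OF assms(2)]] by (simp add: mult_red)

lemma one_PGL2: "\<one>\<^bsub>PGL2 R\<^esub> = Z"
  by (simp add: PGL2_def FactGroup_def)

lemma cls_eq_one_iff:
  assumes "\<not> int p dvd idet M"
  shows "cls M = \<one>\<^bsub>PGL2 R\<^esub> \<longleftrightarrow> int p dvd M$1$2 \<and> int p dvd M$2$1 \<and> int p dvd M$1$1 - M$2$2"
proof -
  have "cls M = \<one>\<^bsub>PGL2 R\<^esub> \<longleftrightarrow> red (int p) M \<in> Z"
    unfolding PGL2_class_def one_PGL2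
    using GL.coset_join1[OF _ red_in_GL2[OF assms] subgroup_Z]
      GL.coset_join2[OF red_in_GL2[OF assms] subgroup_Z] Z_subset by blast
  also have "\<dots> \<longleftrightarrow> int p dvd M$1$2 \<and> int p dvd M$2$1 \<and> int p dvd M$1$1 - M$2$2"
  proof
    assume "red (int p) M \<in> Z"
    then obtain c where "red (int p) M = mat2 c 0 0 c" using scalars2_iff by blast
    then have "red (int p) M $ i $ j = mat2 c 0 0 c $ i $ j" for i j by simp
    from this[of 1 1] this[of 1 2] this[of 2 1] this[of 2 2]
    show "int p dvd M$1$2 \<and> int p dvd M$2$1 \<and> int p dvd M$1$1 - M$2$2"
      by (simp add: red_def dvd_eq_mod_eq_0 mod_diff_eq[symmetric])
  next
    assume *: "int p dvd M$1$2 \<and> int p dvd M$2$1 \<and> int p dvd M$1$1 - M$2$2"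
    then have "\<not> int p dvd M$1$1 * M$2$2" using assms by (auto simp: idet_def dvd_diff)
    then have "\<not> int p dvd M$1$1" by auto
    moreover have "red (int p) M = red (int p) (mat2 (M$1$1) 0 0 (M$1$1))"
      using * by (auto simp: red_def vec_eq_iff forall_2 mod_eq_dvd_iff dvd_diff_commute)
    ultimately show "red (int p) M \<in> Z" using red_scalar_in_Z by simp
  qed
  finally show ?thesis .
qed

lemma cls_scalar_mult:
  assumes "\<not> int p dvd c" "\<not> int p dvd idet M"
  shows "cls (mat2 c 0 0 c ** M) = cls M"
proof -
  interpret PGL: group "PGL2 R" by (rule group_PGL2)
  have d: "\<not> int p dvd idet (mat2 c 0 0 c)" using assms by (simp add: idet_def not_dvd_mult)
  have "cls (mat2 c 0 0 c) = \<one>\<^bsub>PGL2 R\<^esub>" using cls_eq_one_iff[OF d] by simp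
  then show ?thesis using cls_mult[OF d assms(2)] cls_in_PGL2[OF assms(2)] by simp
qed

lemma finite_carrier_G: "finite (carrier G)" and card_carrier_G: "card (carrier G) \<le> p ^ 4"
proof -
  let ?I = "{0..<int p}"
  let ?f = "\<lambda>M :: int^2^2. (M$1$1, M$1$2, M$2$1, M$2$2)"
  have inj: "inj_on ?f (carrier G)" by (auto simp: inj_on_def vec_eq_iff forall_2)
  have "?f ` carrier G \<subseteq> ?I \<times> ?I \<times> ?I \<times> ?I"
    by (auto simp: GL2_def carrier_iff)
  note sub = this
  show "finite (carrier G)" by (rule inj_on_finite[OF inj sub]) simp
  have "card (carrier G) \<le> card (?I \<times> ?I \<times> ?I \<times> ?I)" by (rule card_inj_on_le[OF inj sub]) simp
  also have "\<dots> = p ^ 4" by (simp add: card_cartesian_product power4_eq_xxxx mult.assoc)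
  finally show "card (carrier G) \<le> p ^ 4" .
qed

lemma finite_PGL2: "finite (carrier (PGL2 R))" and card_PGL2: "card (carrier (PGL2 R)) \<le> p ^ 4"
  using finite_carrier_G card_carrier_G card_image_le[OF finite_carrier_G]
  unfolding carrier_PGL2 by (auto intro: order_trans)

lemma carrier_PSL2: "carrier (PSL2 R) = PGL2_class R ` {M \<in> carrier G. idet M mod int p = 1}"
  using p_gt_1 by (simp add: PSL2_def det2_eq res_one_eq)

lemma subgroup_PSL2: "subgroup (carrier (PSL2 R)) (PGL2 R)"
proof -
  interpret PGL: group "PGL2 R" by (rule group_PGL2)
  let ?S = "{M \<in> carrier G. idet M mod int p = 1}"
  show ?thesis
  proof (rule PGL.subgroupI)
    show "carrier (PSL2 R) \<subseteq> carrier (PGL2 R)" unfolding carrier_PSL2 carrier_PGL2 by blast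
    have "\<one>\<^bsub>G\<^esub> \<in> ?S" using p_gt_1 by (simp add: one_GL2[symmetric] idet_def) (simp add: one_GL2)
    then show "carrier (PSL2 R) \<noteq> {}" unfolding carrier_PSL2 by blast
  next
    fix x assume "x \<in> carrier (PSL2 R)"
    then obtain M where M: "M \<in> carrier G" "idet M mod int p = 1" "x = PGL2_class R M"
      unfolding carrier_PSL2 by blast
    let ?N = "inv\<^bsub>G\<^esub> M"
    have N: "?N \<in> carrier G" using M by simp
    have "idet (?N \<otimes>\<^bsub>G\<^esub> M) = 1" using M by (simp add: one_GL2 idet_def)
    then have "idet (?N ** M) mod int p = 1"
      using idet_red[of "int p" "?N ** M"] p_gt_1 by (simp add: mult_GL2)
    then have "idet ?N * (idet M mod int p) mod int p = 1" by (simp add: idet_mult mod_simps)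
    then have "idet ?N mod int p = 1" using M by simp
    moreover have "inv\<^bsub>PGL2 R\<^esub> x = PGL2_class R ?N"
    proof (rule PGL.inv_equality)
      have "PGL2_class R ?N \<otimes>\<^bsub>PGL2 R\<^esub> x = PGL2_class R \<one>\<^bsub>G\<^esub>"
        using PGL2_class_mult[OF N M(1)] M by simp
      also have "\<dots> = \<one>\<^bsub>PGL2 R\<^esub>"
        by (simp add: PGL2_class_def one_PGL2 GL.coset_mult_one Z_subset)
      finally show "PGL2_class R ?N \<otimes>\<^bsub>PGL2 R\<^esub> x = \<one>\<^bsub>PGL2 R\<^esub>" .
    qed (use M N in \<open>auto simp: carrier_PGL2\<close>)
    ultimately show "inv\<^bsub>PGL2 R\<^esub> x \<in> carrier (PSL2 R)" using N unfolding carrier_PSL2 by blast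
  next
    fix x y assume "x \<in> carrier (PSL2 R)" "y \<in> carrier (PSL2 R)"
    then obtain M N where M: "M \<in> carrier G" "idet M mod int p = 1" "x = PGL2_class R M"
      and N: "N \<in> carrier G" "idet N mod int p = 1" "y = PGL2_class R N"
      unfolding carrier_PSL2 by blast
    have "idet (M \<otimes>\<^bsub>G\<^esub> N) mod int p = (idet M * idet N) mod int p"
      by (simp add: mult_GL2 idet_red idet_mult)
    also have "\<dots> = ((idet M mod int p) * (idet N mod int p)) mod int p" by (simp add: mod_simps)
    also have "\<dots> = 1" using M N p_gt_1 by simp
    finally show "x \<otimes>\<^bsub>PGL2 R\<^esub> y \<in> carrier (PSL2 R)"
      unfolding carrier_PSL2 M N PGL2_class_mult[OF M(1) N(1)] using M N by blast
  qed
qed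

lemma group_PSL2: "group (PSL2 R)"
  using subgroup.subgroup_is_group[OF subgroup_PSL2 group_PGL2] by (simp add: PSL2_def)

lemma cls_in_PSL2:
  assumes "[idet M = s\<^sup>2] (mod int p)" "\<not> int p dvd s"
  shows "cls M \<in> carrier (PSL2 R)"
proof -
  obtain e where e: "[s * e = 1] (mod int p)" "\<not> int p dvd e" using inverse_exists assms(2) by blast
  have nd: "\<not> int p dvd idet M"
    using cong_dvd_iff[OF assms(1)] assms(2) not_dvd_mult by (simp add: power2_eq_square)
  let ?N = "mat2 e 0 0 e ** M"
  have "[idet ?N = e\<^sup>2 * s\<^sup>2] (mod int p)"
    unfolding idet_mult using assms(1) by (intro cong_mult) (auto simp: idet_def power2_eq_square)
  also have "e\<^sup>2 * s\<^sup>2 = (s * e)\<^sup>2" by (simp add: power_mult_distrib mult.commute)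
  also have "[(s * e)\<^sup>2 = 1\<^sup>2] (mod int p)" by (intro cong_pow e)
  finally have "idet (red (int p) ?N) mod int p = 1"
    using p_gt_1 by (simp add: idet_red cong_def)
  moreover have "red (int p) ?N \<in> carrier G"
    using nd e by (intro red_in_GL2) (simp add: idet_mult not_dvd_mult idet_def[of "mat2 e 0 0 e"])
  ultimately have "cls ?N \<in> carrier (PSL2 R)" unfolding carrier_PSL2 by blast
  then show ?thesis using cls_scalar_mult[OF e(2) nd] by simp
qed

end

subsection \<open>The vertex group\<close>

locale cayley_data =
  fixes p\<^sub>0 p\<^sub>1 :: nat and b :: int
  assumes prime_p0: "prime p\<^sub>0" and prime_p1: "prime p\<^sub>1" and distinct: "p\<^sub>1 \<noteq> p\<^sub>0"
    and odd_p1: "odd p\<^sub>1" and b: "[b\<^sup>2 = -1] (mod int p\<^sub>1)"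
begin

sublocale prime_field_matrices p\<^sub>1
  by unfold_locales (rule prime_p1)

abbreviation "X \<equiv> cayley_group p\<^sub>0 p\<^sub>1"

lemma b_dvd: "int p\<^sub>1 dvd b\<^sup>2 + 1"
  using b by (simp add: cong_iff_dvd_diff)

lemma p1_not_dvd_power: "\<not> int p\<^sub>1 dvd int p\<^sub>0 ^ m"
proof
  assume "int p\<^sub>1 dvd int p\<^sub>0 ^ m"
  then have "p\<^sub>1 dvd p\<^sub>0 ^ m" by (metis int_dvd_int_iff of_nat_power)
  then show False using prime_p0 prime_p1 distinct by (metis prime_dvd_power primes_dvd_imp_eq)
qed

definition qmat :: "quat \<Rightarrow> int^2^2" where
  "qmat q = mat2 (qm11 b q) (qm12 b q) (qm21 b q) (qm22 b q)"

lemma gen_PGL_eq_cls: "gen_PGL p\<^sub>1 b q = cls (qmat q)"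
proof -
  obtain q0 q1 q2 q3 where q: "q = (q0, q1, q2, q3)" by (cases q)
  have "red (int p\<^sub>1) (mat2 x y z w) = mat2 (x mod int p\<^sub>1) (y mod int p\<^sub>1) (z mod int p\<^sub>1) (w mod int p\<^sub>1)"
    for x y z w by (simp add: red_def vec_eq_iff forall_2)
  then show ?thesis by (simp add: gen_PGL_def q qmat_def qm_defs)
qed

lemma idet_qmat: "[idet (qmat q) = qnorm q] (mod int p\<^sub>1)"
  using qm_det[OF b_dvd, of q] by (simp add: idet_def qmat_def)

lemma red_qmat_mult: "red (int p\<^sub>1) (qmat (qmul q r)) = red (int p\<^sub>1) (qmat q ** qmat r)"
  using qm_mult[OF b_dvd, of q r]
  by (simp add: red_def vec_eq_iff forall_2 matrix_mult_2 qmat_def cong_def)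

lemma one_X: "\<one>\<^bsub>X\<^esub> = \<one>\<^bsub>PGL2 R\<^esub>" and mult_X: "(\<otimes>\<^bsub>X\<^esub>) = (\<otimes>\<^bsub>PGL2 R\<^esub>)"
  by (auto simp: cayley_group_def PSL2_def)

lemma group_X: "group X"
  using group_PSL2 group_PGL2 by (simp add: cayley_group_def)

lemma finite_X: "finite (carrier X)" and card_X: "card (carrier X) \<le> p\<^sub>1 ^ 4"
proof -
  have sub: "carrier X \<subseteq> carrier (PGL2 R)"
    using subgroup.subset[OF subgroup_PSL2] by (simp add: cayley_group_def)
  show "finite (carrier X)" using finite_subset[OF sub finite_PGL2] .
  show "card (carrier X) \<le> p\<^sub>1 ^ 4" using card_mono[OF finite_PGL2 sub] card_PGL2 by simp
qed

lemma not_dvd_idet_qmat: "qnorm q = int p\<^sub>0 ^ m \<Longrightarrow> \<not> int p\<^sub>1 dvd idet (qmat q)"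
  using cong_dvd_iff[OF idet_qmat[of q]] p1_not_dvd_power by simp

lemma gen_PGL_in_X:
  assumes "qnorm q = int p\<^sub>0 ^ m" shows "gen_PGL p\<^sub>1 b q \<in> carrier X"
proof (cases "Legendre (int p\<^sub>0) (int p\<^sub>1) = 1")
  case True
  then obtain s where s: "[s\<^sup>2 = int p\<^sub>0] (mod int p\<^sub>1)"
    by (auto simp: Legendre_def QuadRes_def split: if_splits)
  have "[(s ^ m)\<^sup>2 = int p\<^sub>0 ^ m] (mod int p\<^sub>1)"
    using cong_pow[OF s, of m] by (simp add: power_mult[symmetric] mult.commute)
  then have eq: "[idet (qmat q) = (s ^ m)\<^sup>2] (mod int p\<^sub>1)"
    using idet_qmat[of q] assms by (metis cong_sym cong_trans)
  moreover have "\<not> int p\<^sub>1 dvd s ^ m"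
    using not_dvd_idet_qmat[OF assms] cong_dvd_iff[OF eq] by (auto simp: power2_eq_square)
  ultimately show ?thesis using True cls_in_PSL2 by (simp add: cayley_group_def gen_PGL_eq_cls)
next
  case False
  then show ?thesis
    using cls_in_PGL2[OF not_dvd_idet_qmat[OF assms]] by (simp add: cayley_group_def gen_PGL_eq_cls)
qed

lemma gen_PGL_mult:
  assumes "qnorm q = int p\<^sub>0 ^ m" "qnorm r = int p\<^sub>0 ^ n"
  shows "gen_PGL p\<^sub>1 b (qmul q r) = gen_PGL p\<^sub>1 b q \<otimes>\<^bsub>X\<^esub> gen_PGL p\<^sub>1 b r"
  using cls_mult[OF assms[THEN not_dvd_idet_qmat]] by (simp add: gen_PGL_eq_cls mult_X red_qmat_mult)

lemma gen_PGL_eq_one_iff: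
  assumes "qnorm (q0, q1, q2, q3) = int p\<^sub>0 ^ m"
  shows "gen_PGL p\<^sub>1 b (q0, q1, q2, q3) = \<one>\<^bsub>X\<^esub> \<longleftrightarrow>
    int p\<^sub>1 dvd q1 \<and> int p\<^sub>1 dvd q2 \<and> int p\<^sub>1 dvd q3"
proof -
  let ?q = "(q0, q1, q2, q3)"
  have pp: "prime (int p\<^sub>1)" "odd (int p\<^sub>1)" using prime_p1 odd_p1 by auto
  have "gen_PGL p\<^sub>1 b ?q = \<one>\<^bsub>X\<^esub> \<longleftrightarrow>
      int p\<^sub>1 dvd qm12 b ?q \<and> int p\<^sub>1 dvd qm21 b ?q \<and> int p\<^sub>1 dvd qm11 b ?q - qm22 b ?q"
    using cls_eq_one_iff[OF not_dvd_idet_qmat[OF assms]]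
    by (simp add: gen_PGL_eq_cls one_X) (simp add: qmat_def)
  also have "\<dots> \<longleftrightarrow> int p\<^sub>1 dvd q1 \<and> int p\<^sub>1 dvd q2 \<and> int p\<^sub>1 dvd q3"
    using qm_eq_0[OF pp b_dvd, of ?q] qm_eq_0'[OF pp b_dvd, of ?q] by (auto simp: qm_defs)
  finally show ?thesis .
qed

lemma gen_PGL_one: "gen_PGL p\<^sub>1 b qone = \<one>\<^bsub>X\<^esub>"
  using gen_PGL_eq_one_iff[of 1 0 0 0 0] by (simp add: qnorm_def)

end

section \<open>Unit quaternions acting on homogeneous polynomials\<close>

text \<open>The pair \<open>(a, b)\<close> stands for the quaternion \<open>a + b j\<close>, that is, for the matrix with rows
  \<open>(a, b)\<close> and \<open>(- cnj b, cnj a)\<close>.\<close>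

type_synonym cquat = "complex \<times> complex"

definition cmul :: "cquat \<Rightarrow> cquat \<Rightarrow> cquat" where
  "cmul = (\<lambda>(a, b) (c, d). (a * c - b * cnj d, a * d + b * cnj c))"

definition ccnj :: "cquat \<Rightarrow> cquat" where
  "ccnj = (\<lambda>(a, b). (cnj a, - b))"

definition cnorm :: "cquat \<Rightarrow> real" where
  "cnorm = (\<lambda>(a, b). (cmod a)\<^sup>2 + (cmod b)\<^sup>2)"

abbreviation cone :: cquat where "cone \<equiv> (1, 0)"

lemmas cquat_defs = cmul_def ccnj_def cnorm_def

lemma cmul_assoc: "cmul (cmul g h) k = cmul g (cmul h k)"
  by (cases g; cases h; cases k) (simp add: cmul_def algebra_simps)

lemma cmul_one [simp]: "cmul cone g = g" "cmul g cone = g"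
  by (cases g; simp add: cmul_def)+

lemma cnorm_eq: "complex_of_real (cnorm (a, b)) = a * cnj a + b * cnj b"
  unfolding cnorm_def prod.case of_real_add complex_norm_square ..

lemma cnorm_mult: "cnorm (cmul g h) = cnorm g * cnorm h"
proof -
  obtain a b c d where gh: "g = (a, b)" "h = (c, d)" by (cases g; cases h)
  have "complex_of_real (cnorm (cmul g h)) = of_real (cnorm g * cnorm h)"
    unfolding of_real_mult gh cmul_def prod.case cnorm_eq by (simp add: algebra_simps)
  then show ?thesis by (simp only: of_real_eq_iff)
qed

lemma cnorm_ccnj [simp]: "cnorm (ccnj g) = cnorm g"
  by (cases g) (simp add: cquat_defs)

lemma ccnj_ccnj [simp]: "ccnj (ccnj g) = g"
  by (cases g) (simp add: cquat_defs)

lemma cmul_ccnj: "cmul g (ccnj g) = (of_real (cnorm g), 0)" "cmul (ccnj g) g = (of_real (cnorm g), 0)"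
  by (cases g; simp add: cmul_def ccnj_def cnorm_eq del: of_real_add; simp add: algebra_simps)+

lemma ccnj_mult: "ccnj (cmul g h) = cmul (ccnj h) (ccnj g)"
  by (cases g; cases h) (simp add: cmul_def ccnj_def algebra_simps)

lemma ccnj_one [simp]: "ccnj cone = cone"
  by (simp add: ccnj_def)

lemma cnorm_one [simp]: "cnorm cone = 1"
  by (simp add: cnorm_def)

definition cq :: "real \<Rightarrow> quat \<Rightarrow> cquat" where
  "cq r = (\<lambda>(q0, q1, q2, q3). (Complex (q0 / r) (q1 / r), Complex (q2 / r) (q3 / r)))"

lemma cq_mult: "r \<noteq> 0 \<Longrightarrow> s \<noteq> 0 \<Longrightarrow> cmul (cq r q) (cq s t) = cq (r * s) (qmul q t)"
  by (cases q; cases t)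
    (simp add: cq_def cmul_def qmul_def complex_eq_iff field_simps)

lemma cq_cnj: "ccnj (cq r q) = cq r (qcnj q)"
  by (cases q) (simp add: cq_def ccnj_def qcnj_def complex_eq_iff)

lemma cnorm_cq: "r \<noteq> 0 \<Longrightarrow> cnorm (cq r q) = qnorm q / r\<^sup>2"
  by (cases q) (simp add: cq_def cnorm_def qnorm_def cmod_power2 power_divide add_divide_distrib)

lemma cq_real: "c \<noteq> 0 \<Longrightarrow> cq (real_of_int c) (c, 0, 0, 0) = cone"
  by (simp add: cq_def complex_eq_iff)

lemma unit_diagonalize:
  assumes "cnorm q = 1"
  obtains h t where "cnorm h = 1" "q = cmul (cmul h (cis t, 0)) (ccnj h)"
proof -
  obtain a b where q: "q = (a, b)" by (cases q)
  have n: "a * cnj a + b * cnj b = 1" using assms cnorm_eq[of a b] by (simp add: q)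
  have nr: "(cmod a)\<^sup>2 + (cmod b)\<^sup>2 = 1" using assms by (simp add: q cnorm_def)
  show ?thesis
  proof (cases "b = 0")
    case True
    then have "cmod a = 1" using nr by (simp add: power2_eq_1_iff) (use norm_ge_zero[of a] in linarith)
    then have "cis (Arg a) = a" by (subst cis_Arg) (auto simp: sgn_div_norm)
    then show ?thesis using that[of cone "Arg a"] True by (simp add: q)
  next
    case False
    define c where "c = Re a"
    have "c\<^sup>2 \<le> 1" using nr zero_le_power2[of "cmod b"] zero_le_power2[of "Im a"]
      unfolding c_def cmod_power2[of a] by linarith
    then obtain t where t: "c = cos t" using arccos_cos_eq_abs abs_le_square_iff[of c 1]
      by (metis abs_le_iff abs_one cos_arccos_abs power_one)
    define m where "m = cis t"
    have mm: "m * m - (a + cnj a) * m + 1 = 0"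
    proof -
      have "a + cnj a = 2 * of_real c" by (simp add: c_def complex_eq_iff)
      then have aa: "a + cnj a = m + cnj m" by (simp add: t m_def complex_eq_iff)
      have "m * cnj m = 1" by (simp add: m_def complex_eq_iff cis_cnj cis_mult)
      then show ?thesis unfolding aa by (simp add: algebra_simps)
    qed
    define u v where "u = b" and "v = m - a"
    define r where "r = sqrt ((cmod u)\<^sup>2 + (cmod v)\<^sup>2)"
    have r: "r > 0" using False by (simp add: r_def u_def add_pos_nonneg)
    have r2: "r\<^sup>2 = (cmod u)\<^sup>2 + (cmod v)\<^sup>2" by (simp add: r_def)
    define h where "h = (u / r, - cnj v / r)"
    have h1: "cnorm h = 1"
    proof -
      have "cnorm h = ((cmod u)\<^sup>2 + (cmod v)\<^sup>2) / r\<^sup>2"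
        using r by (simp add: h_def cnorm_def norm_divide power_divide add_divide_distrib)
      then show ?thesis using r by (simp add: r2[symmetric])
    qed
    have e1: "a * u + b * v = m * u" by (simp add: u_def v_def algebra_simps)
    have e2: "- cnj b * u + cnj a * v = m * v"
    proof -
      have "m * v - (- cnj b * u + cnj a * v)
          = (m * m - (a + cnj a) * m + 1) + (a * cnj a + b * cnj b - 1)"
        by (simp add: u_def v_def algebra_simps)
      then show ?thesis using mm n by simp
    qed
    then have e3: "- b * cnj u + a * cnj v = cnj m * cnj v"
      by (metis (no_types, lifting) complex_cnj_add complex_cnj_cnj complex_cnj_minus complex_cnj_mult)
    have "cmul q h = cmul h (m, 0)"
    proof -
      have "a * (u / r) - b * cnj (- cnj v / r) = (a * u + b * v) / r"
        by (simp add: add_divide_distrib)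
      moreover have "a * (- cnj v / r) + b * cnj (u / r) = - ((- b * cnj u + a * cnj v) / r)"
        by (simp add: diff_divide_distrib)
      ultimately show ?thesis
        unfolding q h_def cmul_def prod.case e1 e3 by simp
    qed
    then have "cmul (cmul q h) (ccnj h) = cmul (cmul h (m, 0)) (ccnj h)" by simp
    then show ?thesis using h1 that[of h t] by (simp add: cmul_assoc cmul_ccnj m_def)
  qed
qed

lemma Re_conjugate:
  assumes "cnorm h = 1"
  shows "Re (fst (cmul (cmul h g) (ccnj h))) = Re (fst g)"
proof -
  obtain a b c d where gh: "g = (a, b)" "h = (c, d)" by (cases g; cases h)
  have "Re (fst (cmul (cmul h g) (ccnj h))) = Re a * (Re (c * cnj c + d * cnj d))"
    by (simp add: gh cmul_def ccnj_def algebra_simps)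
  also have "c * cnj c + d * cnj d = 1" using assms cnorm_eq[of c d] by (simp add: gh)
  finally show ?thesis by (simp add: gh)
qed

subsection \<open>Homogeneous polynomials\<close>

definition vec2 :: "complex \<Rightarrow> complex \<Rightarrow> complex^2" where
  "vec2 x y = (\<chi> i. if i = 1 then x else y)"

lemma vec2_nth [simp]: "vec2 x y $ 1 = x" "vec2 x y $ 2 = y"
  by (simp_all add: vec2_def)

lemma vec2_eta: "vec2 (z $ 1) (z $ 2) = z"
  by (simp add: vec_eq_iff forall_2)

definition capp :: "cquat \<Rightarrow> complex^2 \<Rightarrow> complex^2" where
  "capp = (\<lambda>(a, b) z. vec2 (a * z$1 + b * z$2) (- cnj b * z$1 + cnj a * z$2))"

definition qact :: "cquat \<Rightarrow> (complex^2 \<Rightarrow> complex) \<Rightarrow> complex^2 \<Rightarrow> complex" where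
  "qact g s = (\<lambda>z. s (capp (ccnj g) z))"

lemma capp_mult: "capp (cmul g h) z = capp g (capp h z)"
  by (cases g; cases h) (simp add: capp_def cmul_def vec_eq_iff forall_2 algebra_simps)

lemma capp_one [simp]: "capp cone z = z"
  by (simp add: capp_def vec2_eta)

lemma qact_mult: "qact (cmul g h) s = qact g (qact h s)"
  by (simp add: qact_def ccnj_mult capp_mult)

lemma qact_one [simp]: "qact cone s = s"
  by (simp add: qact_def)

lemma qact_0 [simp]: "qact g 0 = 0"
  by (simp add: qact_def fun_eq_iff)

lemma Sym_pow_add: "s \<in> Sym_pow p \<Longrightarrow> t \<in> Sym_pow p \<Longrightarrow> (\<lambda>z. s z + t z) \<in> Sym_pow p"
proof -
  assume "s \<in> Sym_pow p" "t \<in> Sym_pow p"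
  then obtain c d where "\<forall>z. s z = (\<Sum>k\<le>p. c k * (z$1) ^ k * (z$2) ^ (p - k))"
    "\<forall>z. t z = (\<Sum>k\<le>p. d k * (z$1) ^ k * (z$2) ^ (p - k))"
    unfolding Sym_pow_def by blast
  then show ?thesis unfolding Sym_pow_def
    by (intro CollectI exI[of _ "\<lambda>k. c k + d k"]) (simp add: sum.distrib[symmetric] algebra_simps)
qed

lemma Sym_pow_scale: "s \<in> Sym_pow p \<Longrightarrow> (\<lambda>z. c * s z) \<in> Sym_pow p"
proof -
  assume "s \<in> Sym_pow p"
  then obtain d where "\<forall>z. s z = (\<Sum>k\<le>p. d k * (z$1) ^ k * (z$2) ^ (p - k))"
    unfolding Sym_pow_def by blast
  then show ?thesis unfolding Sym_pow_def
    by (intro CollectI exI[of _ "\<lambda>k. c * d k"]) (simp add: sum_distrib_left algebra_simps)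
qed

lemma Sym_pow_0: "0 \<in> Sym_pow p" "(\<lambda>z. 0) \<in> Sym_pow p"
  unfolding Sym_pow_def by (intro CollectI exI[of _ "\<lambda>k. 0"]; simp)+

lemma Sym_pow_sum:
  "(\<And>i. i \<in> I \<Longrightarrow> s i \<in> Sym_pow p) \<Longrightarrow> (\<lambda>z. \<Sum>i\<in>I. s i z) \<in> Sym_pow p"
  by (induction I rule: infinite_finite_induct) (auto simp: Sym_pow_0 Sym_pow_add)

lemma Sym_pow_linear_mult:
  assumes "s \<in> Sym_pow p" shows "(\<lambda>z. (a * z$1 + b * z$2) * s z) \<in> Sym_pow (Suc p)"
proof -
  obtain d where d: "\<forall>z. s z = (\<Sum>k\<le>p. d k * (z$1) ^ k * (z$2) ^ (p - k))"
    using assms unfolding Sym_pow_def by blast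
  have "(\<lambda>z. z$1 * s z) \<in> Sym_pow (Suc p)"
    unfolding Sym_pow_def
    by (intro CollectI exI[of _ "\<lambda>k. case k of 0 \<Rightarrow> 0 | Suc l \<Rightarrow> d l"] allI)
      (subst sum.atMost_Suc_shift, simp add: d sum_distrib_left algebra_simps)
  moreover have "(\<lambda>z. z$2 * s z) \<in> Sym_pow (Suc p)"
    unfolding Sym_pow_def
    by (intro CollectI exI[of _ "\<lambda>k. if k \<le> p then d k else 0"] allI)
      (simp add: d sum_distrib_left Suc_diff_le algebra_simps)
  ultimately have "(\<lambda>z. a * (z$1 * s z) + b * (z$2 * s z)) \<in> Sym_pow (Suc p)"
    by (intro Sym_pow_add Sym_pow_scale)
  then show ?thesis by (simp add: algebra_simps)
qed

lemma Sym_pow_linear_power: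
  "(\<lambda>z. (a * z$1 + b * z$2) ^ k * (c * z$1 + d * z$2) ^ l) \<in> Sym_pow (k + l)"
proof (induction k)
  case 0
  show ?case
  proof (induction l)
    case 0
    show ?case unfolding Sym_pow_def by (intro CollectI exI[of _ "\<lambda>k. 1"]) simp
  next
    case (Suc l)
    show ?case using Sym_pow_linear_mult[OF Suc, of c d] by (simp add: mult.assoc)
  qed
next
  case (Suc k)
  show ?case using Sym_pow_linear_mult[OF Suc, of a b] by (simp add: mult.assoc)
qed

lemma qact_Sym_pow: assumes "s \<in> Sym_pow p" shows "qact g s \<in> Sym_pow p"
proof -
  obtain c where c: "\<forall>z. s z = (\<Sum>k\<le>p. c k * (z$1) ^ k * (z$2) ^ (p - k))"
    using assms unfolding Sym_pow_def by blast
  obtain a b where g: "ccnj g = (a, b)" by (cases "ccnj g")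
  have "qact g s = (\<lambda>z. \<Sum>k\<le>p. c k * ((a * z$1 + b * z$2) ^ k * (- cnj b * z$1 + cnj a * z$2) ^ (p - k)))"
    by (simp add: qact_def c g capp_def mult.assoc)
  also have "\<dots> \<in> Sym_pow p"
  proof (intro Sym_pow_sum Sym_pow_scale)
    fix k assume "k \<in> {..p}"
    then have "k + (p - k) = p" by simp
    then show "(\<lambda>z. (a * z$1 + b * z$2) ^ k * (- cnj b * z$1 + cnj a * z$2) ^ (p - k)) \<in> Sym_pow p"
      using Sym_pow_linear_power[of a b k "- cnj b" "cnj a" "p - k"] by metis
  qed
  finally show ?thesis .
qed

text \<open>The coefficients are read off by a discrete Fourier transform on the circle.\<close>

definition root_pt :: "nat \<Rightarrow> nat \<Rightarrow> complex" where
  "root_pt p j = cis (2 * pi * real j / real (p + 1))"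

definition coef :: "nat \<Rightarrow> (complex^2 \<Rightarrow> complex) \<Rightarrow> nat \<Rightarrow> complex" where
  "coef p s k = (\<Sum>j\<le>p. s (vec2 (root_pt p j) 1) * cnj (root_pt p j) ^ k) / of_nat (p + 1)"

lemma cmod_root_pt [simp]: "cmod (root_pt p j) = 1"
  by (simp add: root_pt_def)

lemma sum_root_pt_power:
  assumes "0 < k" "k \<le> p"
  shows "(\<Sum>j\<le>p. root_pt p j ^ k) = 0"
proof -
  define x where "x = cis (2 * pi * real k / real (p + 1))"
  have pw: "root_pt p j ^ k = x ^ j" for j
    unfolding root_pt_def x_def Complex.DeMoivre by (rule arg_cong[of _ _ cis]) (simp add: field_simps)
  have "x ^ (p + 1) = cis (2 * pi * real k)"
    unfolding x_def Complex.DeMoivre by (rule arg_cong[of _ _ cis]) simp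
  also have "\<dots> = 1" by (simp add: cis_multiple_2pi)
  finally have x1: "x ^ Suc p = 1" by simp
  have "x \<noteq> 1"
  proof
    assume "x = 1"
    then have "cos (2 * pi * real k / real (p + 1)) = 1" by (simp add: x_def complex_eq_iff)
    then obtain n :: int where n: "2 * pi * real k / real (p + 1) = of_int n * 2 * pi"
      using cos_one_2pi_int by auto
    then have "(2 * pi) * real k = (2 * pi) * (of_int n * real (p + 1))" by (simp add: field_simps)
    then have "real k = of_int n * real (p + 1)" unfolding mult_cancel_left by simp
    then have "int k = n * int (p + 1)" by (metis of_int_eq_iff of_int_mult of_int_of_nat_eq)
    then have "int (p + 1) dvd int k" by simp
    then show False using assms zdvd_imp_le[of "int (p + 1)" "int k"] by simp
  qed
  then have "(\<Sum>j\<le>p. x ^ j) = 0" using x1 geometric_sum[of x "Suc p"] by (simp add: lessThan_Suc_atMost)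
  then show ?thesis by (simp add: pw)
qed

lemma root_pt_orthogonal:
  assumes "k \<le> p" "l \<le> p"
  shows "(\<Sum>j\<le>p. root_pt p j ^ l * cnj (root_pt p j) ^ k) = (if k = l then of_nat (p + 1) else 0)"
proof -
  have u: "root_pt p j * cnj (root_pt p j) = 1" for j
    using complex_norm_square[of "root_pt p j"] by simp
  have lt: "(\<Sum>j\<le>p. root_pt p j ^ l * cnj (root_pt p j) ^ k) = 0" if "k < l" "l \<le> p" for k l
  proof -
    have "root_pt p j ^ l * cnj (root_pt p j) ^ k = root_pt p j ^ (l - k)" for j
    proof -
      have "root_pt p j ^ l = root_pt p j ^ (l - k) * root_pt p j ^ k"
        using that by (simp flip: power_add)
      then show ?thesis by (simp add: mult.assoc u flip: power_mult_distrib)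
    qed
    then show ?thesis using sum_root_pt_power[of "l - k" p] that by simp
  qed
  consider "k < l" | "l < k" | "k = l" by linarith
  then show ?thesis
  proof cases
    case 1 then show ?thesis using lt[of k l] assms by simp
  next
    case 2
    have "(\<Sum>j\<le>p. root_pt p j ^ l * cnj (root_pt p j) ^ k)
        = cnj (\<Sum>j\<le>p. root_pt p j ^ k * cnj (root_pt p j) ^ l)"
      by (simp add: mult.commute)
    then show ?thesis using lt[of l k] 2 assms by simp
  next
    case 3 then show ?thesis by (simp add: u flip: power_mult_distrib)
  qed
qed

lemma coef_polynomial:
  assumes s: "\<And>z. s z = (\<Sum>k\<le>p. c k * (z$1) ^ k * (z$2) ^ (p - k))" and "k \<le> p"
  shows "coef p s k = c k"
proof -
  have "(\<Sum>j\<le>p. s (vec2 (root_pt p j) 1) * cnj (root_pt p j) ^ k)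
      = (\<Sum>j\<le>p. \<Sum>l\<le>p. c l * (root_pt p j ^ l * cnj (root_pt p j) ^ k))"
    by (simp add: s sum_distrib_left sum_distrib_right mult.assoc)
  also have "\<dots> = (\<Sum>l\<le>p. c l * (\<Sum>j\<le>p. root_pt p j ^ l * cnj (root_pt p j) ^ k))"
    by (subst sum.swap) (simp add: sum_distrib_left)
  also have "\<dots> = (\<Sum>l\<le>p. if l = k then c l * of_nat (p + 1) else 0)"
    using assms(2) by (intro sum.cong) (auto simp: root_pt_orthogonal)
  also have "\<dots> = c k * of_nat (p + 1)" using assms(2) by simp
  finally show ?thesis by (simp add: coef_def del: of_nat_Suc of_nat_add)
qed

lemma coef_add: "coef p (\<lambda>z. s z + t z) k = coef p s k + coef p t k"
  by (simp add: coef_def sum.distrib algebra_simps add_divide_distrib)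

lemma coef_scale: "coef p (\<lambda>z. c * s z) k = c * coef p s k"
  by (simp add: coef_def sum_distrib_left mult.assoc)

lemma coef_zero [simp]: "coef p (\<lambda>z. 0) k = 0"
  by (simp add: coef_def)

lemma Sym_pow_expand:
  assumes "s \<in> Sym_pow p"
  shows "s z = (\<Sum>k\<le>p. coef p s k * ((z$1) ^ k * (z$2) ^ (p - k)))"
proof -
  obtain c where c: "\<And>z. s z = (\<Sum>k\<le>p. c k * (z$1) ^ k * (z$2) ^ (p - k))"
    using assms unfolding Sym_pow_def by blast
  show ?thesis by (subst c) (intro sum.cong refl, simp add: coef_polynomial[OF c] mult.assoc)
qed

definition sip :: "nat \<Rightarrow> (complex^2 \<Rightarrow> complex) \<Rightarrow> (complex^2 \<Rightarrow> complex) \<Rightarrow> complex" where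
  "sip p s t = (\<Sum>k\<le>p. coef p s k * cnj (coef p t k) / of_nat (p choose k))"

lemma sip_add: "sip p (\<lambda>z. s z + s' z) t = sip p s t + sip p s' t"
  by (simp add: sip_def coef_add sum.distrib algebra_simps add_divide_distrib)

lemma sip_scale: "sip p (\<lambda>z. c * s z) t = c * sip p s t"
  by (simp add: sip_def coef_scale sum_distrib_left mult.assoc)

lemma sip_cnj: "sip p t s = cnj (sip p s t)"
  by (simp add: sip_def mult.commute)

text \<open>Powers of linear forms are reproducing kernels; as they span, this yields invariance.\<close>

definition kern :: "nat \<Rightarrow> complex^2 \<Rightarrow> complex^2 \<Rightarrow> complex" where
  "kern p w = (\<lambda>z. (cnj (w$1) * z$1 + cnj (w$2) * z$2) ^ p)"

lemma coef_kern:
  assumes "k \<le> p"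
  shows "coef p (kern p w) k = of_nat (p choose k) * cnj (w$1) ^ k * cnj (w$2) ^ (p - k)"
proof -
  have "kern p w z = (\<Sum>k\<le>p. (of_nat (p choose k) * cnj (w$1) ^ k * cnj (w$2) ^ (p - k))
      * (z$1) ^ k * (z$2) ^ (p - k))" for z
    unfolding kern_def by (subst binomial_ring) (simp add: power_mult_distrib mult_ac)
  from coef_polynomial[OF this assms] show ?thesis .
qed

lemma kern_Sym_pow: "kern p w \<in> Sym_pow p"
  using Sym_pow_linear_power[of "cnj (w$1)" "cnj (w$2)" p 0 0 0] by (simp add: kern_def)

lemma sip_kern:
  assumes "s \<in> Sym_pow p" shows "sip p s (kern p w) = s w"
  unfolding sip_def Sym_pow_expand[OF assms, of w]
  by (intro sum.cong refl) (simp add: coef_kern)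

lemma qact_kern: "qact g (kern p w) = kern p (capp g w)"
  by (cases g) (simp add: qact_def kern_def capp_def ccnj_def fun_eq_iff algebra_simps)

lemma qact_sip:
  assumes s: "s \<in> Sym_pow p" and t: "t \<in> Sym_pow p"
  shows "sip p (qact g s) t = sip p s (qact (ccnj g) t)"
proof -
  define m where "m k = (\<lambda>z::complex^2. (z$1) ^ k * (z$2) ^ (p - k))" for k
  define D where "D t = cnj (sip p (qact g s) t) - cnj (sip p s (qact (ccnj g) t))" for t
  have D_lin: "D (\<lambda>z. \<Sum>k\<le>p. c k * m k z) = (\<Sum>k\<le>p. c k * D (m k))" for c
  proof -
    have "sip p (\<lambda>z. \<Sum>k\<in>K. c k * f k z) t = (\<Sum>k\<in>K. c k * sip p (f k) t)" for c K f t
    proof (induction K rule: infinite_finite_induct)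
      case (insert x K) then show ?case by (simp add: sip_add sip_scale)
    qed (simp_all add: sip_def)
    note lin = this
    have "qact (ccnj g) (\<lambda>z. \<Sum>k\<le>p. c k * m k z) = (\<lambda>z. \<Sum>k\<le>p. c k * qact (ccnj g) (m k) z)"
      by (simp add: qact_def)
    then show ?thesis
      unfolding D_def sip_cnj[symmetric] by (simp add: lin sum_subtractf algebra_simps)
  qed
  have Dk: "D (kern p w) = 0" for w
    unfolding D_def by (simp add: sip_kern s qact_Sym_pow qact_kern) (simp add: qact_def)
  have "D (m k) = 0" if "k \<le> p" for k
  proof -
    have "(\<Sum>k\<le>p. (of_nat (p choose k) * D (m k)) * (z$1) ^ k * (z$2) ^ (p - k)) = 0" for z
    proof -
      have "kern p (vec2 (cnj (z$1)) (cnj (z$2)))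
          = (\<lambda>y. \<Sum>k\<le>p. (of_nat (p choose k) * (z$1) ^ k * (z$2) ^ (p - k)) * m k y)"
        using Sym_pow_expand[OF kern_Sym_pow]
        by (simp add: fun_eq_iff coef_kern m_def del: of_nat_binomial_eq_mult_binomial_Suc)
      then have "0 = (\<Sum>k\<le>p. (of_nat (p choose k) * (z$1) ^ k * (z$2) ^ (p - k)) * D (m k))"
        using Dk[of "vec2 (cnj (z$1)) (cnj (z$2))"] D_lin by simp
      then show ?thesis by (simp add: mult_ac)
    qed
    then have "coef p (\<lambda>z. 0) k = of_nat (p choose k) * D (m k)"
      using that by (intro coef_polynomial) simp_all
    then show ?thesis using that by simp
  qed
  then have "D (\<lambda>z. \<Sum>k\<le>p. coef p t k * m k z) = 0" unfolding D_lin by simp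
  moreover have "(\<lambda>z. \<Sum>k\<le>p. coef p t k * m k z) = t"
    using Sym_pow_expand[OF t] by (simp add: fun_eq_iff m_def)
  ultimately show ?thesis by (simp add: D_def)
qed

definition hmono :: "nat \<Rightarrow> nat \<Rightarrow> complex^2 \<Rightarrow> complex" where
  "hmono p k = (\<lambda>z. of_real (sqrt (p choose k)) * ((z$1) ^ k * (z$2) ^ (p - k)))"

lemma coef_mono:
  assumes "k \<le> p" "l \<le> p"
  shows "coef p (hmono p k) l = (if k = l then of_real (sqrt (p choose k)) else 0)"
proof -
  have "hmono p k z = (\<Sum>l\<le>p. (if k = l then of_real (sqrt (p choose k)) else 0) * (z$1) ^ l * (z$2) ^ (p - l))" for z
  proof -
    have "(\<Sum>l\<le>p. (if k = l then of_real (sqrt (p choose k)) else 0) * (z$1) ^ l * (z$2) ^ (p - l))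
       = (\<Sum>l\<le>p. if l = k then hmono p k z else 0)"
      by (intro sum.cong) (auto simp: hmono_def)
    then show ?thesis using assms by simp
  qed
  from coef_polynomial[OF this assms(2)] show ?thesis .
qed

lemma hmono_Sym_pow: "k \<le> p \<Longrightarrow> hmono p k \<in> Sym_pow p"
  using Sym_pow_scale[OF Sym_pow_linear_power[of 1 0 k 0 1 "p - k"]] by (simp add: hmono_def)

lemma sip_mono_right:
  assumes "k \<le> p" shows "sip p s (hmono p k) = coef p s k / of_real (sqrt (p choose k))"
proof -
  have "sip p s (hmono p k) = (\<Sum>l\<le>p. if l = k then coef p s k / of_real (sqrt (p choose k)) else 0)"
    unfolding sip_def
  proof (intro sum.cong refl)
    fix l assume "l \<in> {..p}"
    have "complex_of_nat (p choose k) = of_real (sqrt (p choose k)) * of_real (sqrt (p choose k))"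
      by (metis of_nat_0_le_iff of_real_mult of_real_of_nat_eq real_sqrt_mult_self abs_of_nat)
    then show "coef p s l * cnj (coef p (hmono p k) l) / of_nat (p choose l)
        = (if l = k then coef p s k / of_real (sqrt (p choose k)) else 0)"
      using \<open>l \<in> {..p}\<close> assms by (auto simp: coef_mono)
  qed
  also have "\<dots> = coef p s k / of_real (sqrt (p choose k))" using assms by simp
  finally show ?thesis .
qed

lemma sip_mono:
  assumes "k \<le> p" "l \<le> p" shows "sip p (hmono p k) (hmono p l) = of_bool (k = l)"
  using assms by (simp add: sip_mono_right coef_mono)

lemma Sym_pow_expand_mono:
  assumes "s \<in> Sym_pow p" shows "s z = (\<Sum>k\<le>p. sip p s (hmono p k) * hmono p k z)"
  by (subst Sym_pow_expand[OF assms], intro sum.cong refl) (simp add: sip_mono_right, simp add: hmono_def)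

lemma qact_diag_mono:
  assumes "k \<le> p"
  shows "qact (cis t, 0) (hmono p k) = (\<lambda>z. cis ((real p - 2 * real k) * t) * hmono p k z)"
proof -
  have "cis (- t) ^ k * cis t ^ (p - k) = cis ((real p - 2 * real k) * t)"
    unfolding Complex.DeMoivre cis_mult using assms
    by (intro arg_cong[of _ _ cis]) (simp add: of_nat_diff algebra_simps)
  then show ?thesis
    by (simp add: qact_def hmono_def capp_def ccnj_def fun_eq_iff power_mult_distrib cis_cnj mult_ac)
qed

lemma sum_weights_bound:
  assumes "sin t \<noteq> 0"
  shows "cmod (\<Sum>k\<le>p. cis ((real p - 2 * real k) * t)) \<le> 1 / \<bar>sin t\<bar>"
proof -
  let ?x = "cis (- 2 * t)"
  have *: "cis ((real p - 2 * real k) * t) = cis (real p * t) * ?x ^ k" for k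
    unfolding Complex.DeMoivre cis_mult by (intro arg_cong[of _ _ cis]) (simp add: algebra_simps)
  have d: "cmod (1 - ?x) = 2 * \<bar>sin t\<bar>"
  proof -
    have "1 - ?x = cis (- t) * cis t - cis (- t) * cis (- t)" by (simp add: cis_mult)
    also have "\<dots> = cis (- t) * (cis t - cis (- t))" by (simp add: right_diff_distrib)
    also have "cis t - cis (- t) = 2 * \<i> * of_real (sin t)" by (simp add: complex_eq_iff)
    finally have "1 - ?x = cis (- t) * (2 * \<i> * of_real (sin t))" .
    then show ?thesis by (simp add: norm_mult)
  qed
  then have nz: "?x \<noteq> 1" using assms by auto
  have "(\<Sum>k\<le>p. cis ((real p - 2 * real k) * t)) = cis (real p * t) * ((?x ^ Suc p - 1) / (?x - 1))"
    unfolding * sum_distrib_left[symmetric] using geometric_sum[OF nz, of "Suc p"]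
    by (simp only: lessThan_Suc_atMost)
  then have "cmod (\<Sum>k\<le>p. cis ((real p - 2 * real k) * t)) = cmod (?x ^ Suc p - 1) / cmod (1 - ?x)"
    by (simp only: norm_mult norm_divide norm_cis mult_1 norm_minus_commute[of ?x 1])
  also have "\<dots> \<le> 2 / cmod (1 - ?x)"
  proof (rule divide_right_mono)
    have "cmod (?x ^ Suc p - 1) \<le> cmod (?x ^ Suc p) + cmod 1" by (rule norm_triangle_ineq4)
    then show "cmod (?x ^ Suc p - 1) \<le> 2" by (simp only: norm_power norm_cis power_one norm_one)
  qed simp
  finally show ?thesis unfolding d by simp
qed

section \<open>The space of sections as a unitary representation\<close>

lemma matrix_inv_eq:
  fixes A B :: "complex^2^2"
  assumes "A ** B = mat 1" "B ** A = mat 1" shows "matrix_inv A = B"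
proof -
  have "A ** matrix_inv A = mat 1 \<and> matrix_inv A ** A = mat 1"
    unfolding matrix_inv_def by (rule someI[of _ B]) (use assms in simp)
  then have "matrix_inv A = B ** (A ** matrix_inv A)"
    by (metis assms(2) matrix_mul_assoc matrix_mul_lid)
  then show ?thesis
    using \<open>A ** matrix_inv A = mat 1 \<and> matrix_inv A ** A = mat 1\<close> by (simp add: matrix_mul_rid)
qed

lemma Sym_act_su:
  assumes "cnorm (a, b) = 1"
  shows "Sym_act (mat2 a b (- cnj b) (cnj a)) s = qact (a, b) s"
proof -
  have n: "a * cnj a + b * cnj b = 1" using assms cnorm_eq[of a b] by simp
  have "matrix_inv (mat2 a b (- cnj b) (cnj a)) = mat2 (cnj a) (- b) (cnj b) a"
    using n by (intro matrix_inv_eq)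
      (simp_all add: vec_eq_iff forall_2 matrix_mult_2 mat_def algebra_simps)
  moreover have "mat2 (cnj a) (- b) (cnj b) a *v z = capp (ccnj (a, b)) z" for z
    by (simp add: capp_def ccnj_def matrix_vector_mult_def vec_eq_iff forall_2 sum_2)
  ultimately show ?thesis by (simp add: Sym_act_def qact_def)
qed

lemma Sym_act_gen_SU:
  assumes "qnorm a = int p" "p > 0"
  shows "Sym_act (gen_SU p a) s = qact (cq (sqrt p) a) s"
proof -
  obtain a0 a1 a2 a3 where a: "a = (a0, a1, a2, a3)" by (cases a)
  obtain x y where xy: "cq (sqrt p) a = (x, y)" by (cases "cq (sqrt p) a")
  have "gen_SU p a = mat2 x y (- cnj y) (cnj x)"
    using xy by (auto simp: a gen_SU_def cq_def vec_eq_iff forall_2 complex_eq_iff scaleR_vec_def)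
  moreover have "cnorm (x, y) = 1"
    using cnorm_cq[of "sqrt p" a] assms by (simp add: xy)
  ultimately show ?thesis using Sym_act_su xy by simp
qed

locale twisted = cayley_data +
  fixes p :: nat
begin

abbreviation "W \<equiv> sections p\<^sub>0 p\<^sub>1 p"

interpretation X: group X by (rule group_X)

definition sec :: "(int^2^2) set \<Rightarrow> nat \<Rightarrow> section_fun" where
  "sec x k = (\<lambda>y. if y = x then hmono p k else 0)"

definition basis :: "section_fun set" where
  "basis = (\<lambda>(x, k). sec x k) ` (carrier X \<times> {..p})"

definition ips :: "section_fun \<Rightarrow> section_fun \<Rightarrow> complex" where
  "ips u v = (\<Sum>x\<in>carrier X. sip p (u x) (v x))"

lemma W_iff:
  "u \<in> W \<longleftrightarrow> (\<forall>x \<in> carrier X. u x \<in> Sym_pow p) \<and> (\<forall>x. x \<notin> carrier X \<longrightarrow> u x = 0)"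
  by (simp add: sections_def)

lemma ips_sec: "x \<in> carrier X \<Longrightarrow> ips u (sec x k) = sip p (u x) (hmono p k)"
proof -
  assume x: "x \<in> carrier X"
  have "ips u (sec x k) = (\<Sum>y\<in>carrier X. if y = x then sip p (u x) (hmono p k) else 0)"
    unfolding ips_def by (intro sum.cong) (auto simp: sec_def sip_def zero_fun_def)
  then show ?thesis using x finite_X by simp
qed

lemma sip_0: "sip p 0 s = 0"
  by (simp add: sip_def zero_fun_def)

lemma ips_sec_sec:
  assumes "x \<in> carrier X" "y \<in> carrier X" "k \<le> p" "l \<le> p"
  shows "ips (sec x k) (sec y l) = of_bool (x = y \<and> k = l)"
  unfolding ips_sec[OF assms(2)] using assms by (cases "x = y") (auto simp: sec_def sip_mono sip_0)

sublocale hermitian_space section_scale ips basis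
proof unfold_locales
  fix x y z :: section_fun and c
  have "sip p (x v + y v) (z v) = sip p (x v) (z v) + sip p (y v) (z v)" for v
    using sip_add[of p "x v" "y v" "z v"] by (simp add: plus_fun_def)
  then show "ips (x + y) z = ips x z + ips y z"
    by (simp add: ips_def plus_fun_def[of x y] sum.distrib)
  show "ips (section_scale c x) y = c * ips x y"
    by (simp add: ips_def section_scale_def sip_scale sum_distrib_left)
  show "ips y x = cnj (ips x y)"
    unfolding ips_def cnj_sum by (intro sum.cong refl) (rule sip_cnj)
  show "finite basis" using finite_X by (simp add: basis_def)
next
  fix e f assume "e \<in> basis" "f \<in> basis"
  then obtain x k y l where e: "e = sec x k" "x \<in> carrier X" "k \<le> p"
    and f: "f = sec y l" "y \<in> carrier X" "l \<le> p" by (auto simp: basis_def)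
  have ip: "ips e f = of_bool (x = y \<and> k = l)"
    unfolding e(1) f(1) using e f by (intro ips_sec_sec)
  have "e = f \<longleftrightarrow> x = y \<and> k = l"
  proof
    assume "e = f"
    have "ips e e = 1" unfolding e(1) using e by (simp add: ips_sec_sec)
    then show "x = y \<and> k = l" using ip \<open>e = f\<close> by (auto split: if_splits)
  qed (simp add: e f)
  then show "ips e f = of_bool (e = f)" using ip by simp
qed

lemma inj_on_sec: "inj_on (\<lambda>(x, k). sec x k) (carrier X \<times> {..p})"
proof (rule inj_onI, clarify)
  fix x k y l assume *: "x \<in> carrier X" "k \<le> p" "y \<in> carrier X" "l \<le> p" "sec x k = sec y l"
  have "ips (sec x k) (sec y l) = 1" using *(3,4) by (subst *(5)) (simp add: ips_sec_sec)
  then show "x = y \<and> k = l" using *(1-4) by (auto simp: ips_sec_sec split: if_splits)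
qed

lemma card_basis: "card basis = card (carrier X) * (p + 1)"
  unfolding basis_def by (simp add: card_image[OF inj_on_sec] card_cartesian_product)

lemma sum_basis: "(\<Sum>e\<in>basis. F e) = (\<Sum>x\<in>carrier X. \<Sum>k\<le>p. F (sec x k))"
  unfolding basis_def
  by (subst sum.reindex[OF inj_on_sec]) (simp add: sum.cartesian_product case_prod_unfold)

lemma W_subspace: "section_fun.subspace W"
proof -
  have "s + t \<in> Sym_pow p" if "s \<in> Sym_pow p" "t \<in> Sym_pow p" for s t
    using Sym_pow_add[OF that] by (simp add: plus_fun_def)
  then show ?thesis
    unfolding section_fun.subspace_def
    by (auto simp: W_iff Sym_pow_0 section_scale_def Sym_pow_scale)
qed

lemma sum_fun_apply: "(\<Sum>i\<in>I. f i) x = (\<Sum>i\<in>I. f i x)"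
  by (induction I rule: infinite_finite_induct) auto

lemma span_basis: "section_fun.span basis = W"
proof (intro equalityI)
  have "basis \<subseteq> W" by (auto simp: basis_def W_iff sec_def hmono_Sym_pow Sym_pow_0)
  then show "section_fun.span basis \<subseteq> W" by (rule section_fun.span_minimal[OF _ W_subspace])
  show "W \<subseteq> section_fun.span basis"
  proof
    fix u assume u: "u \<in> W"
    have "u = (\<Sum>x\<in>carrier X. \<Sum>k\<le>p. section_scale (sip p (u x) (hmono p k)) (sec x k))"
    proof (intro ext)
      fix y z
      have *: "(\<Sum>k\<le>p. section_scale (sip p (u x) (hmono p k)) (sec x k)) y z
          = (if x = y then u y z else 0)" if "x \<in> carrier X" for x
      proof (cases "x = y")
        case True
        have "u y \<in> Sym_pow p" using u that True by (simp add: W_iff)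
        from Sym_pow_expand_mono[OF this, of z] show ?thesis
          using True by (simp add: sum_fun_apply section_scale_def sec_def)
      next
        case False then show ?thesis by (simp add: sum_fun_apply section_scale_def sec_def)
      qed
      have "(\<Sum>x\<in>carrier X. \<Sum>k\<le>p. section_scale (sip p (u x) (hmono p k)) (sec x k)) y z
          = (\<Sum>x\<in>carrier X. if x = y then u y z else 0)"
        unfolding sum_fun_apply[of _ "carrier X"] by (intro sum.cong refl *)
      also have "\<dots> = u y z" using u finite_X by (auto simp: W_iff)
      finally show "u y z = (\<Sum>x\<in>carrier X. \<Sum>k\<le>p. section_scale (sip p (u x) (hmono p k)) (sec x k)) y z" ..
    qed
    also have "\<dots> \<in> section_fun.span basis"
      by (intro section_fun.span_sum section_fun.span_scale section_fun.span_base) (auto simp: basis_def)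
    finally show "u \<in> section_fun.span basis" .
  qed
qed

definition V :: "(int^2^2) set \<Rightarrow> cquat \<Rightarrow> section_fun \<Rightarrow> section_fun" where
  "V g q u = (\<lambda>x. if x \<in> carrier X then qact q (u (inv\<^bsub>X\<^esub> g \<otimes>\<^bsub>X\<^esub> x)) else 0)"

lemma lin_V: "lin (V g q)"
  by unfold_locales (auto simp: V_def section_scale_def qact_def fun_eq_iff algebra_simps)

lemma V_in_W:
  assumes "g \<in> carrier X" "u \<in> W" shows "V g q u \<in> W"
  using assms by (simp add: W_iff V_def qact_Sym_pow)

lemma V_mult:
  assumes g: "g \<in> carrier X" and h: "h \<in> carrier X"
  shows "V g q (V h r u) = V (g \<otimes>\<^bsub>X\<^esub> h) (cmul q r) u"
proof
  fix x
  show "V g q (V h r u) x = V (g \<otimes>\<^bsub>X\<^esub> h) (cmul q r) u x"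
  proof (cases "x \<in> carrier X")
    case True
    then have "inv\<^bsub>X\<^esub> h \<otimes>\<^bsub>X\<^esub> (inv\<^bsub>X\<^esub> g \<otimes>\<^bsub>X\<^esub> x) = inv\<^bsub>X\<^esub> (g \<otimes>\<^bsub>X\<^esub> h) \<otimes>\<^bsub>X\<^esub> x"
      using g h by (simp add: X.inv_mult_group X.m_assoc)
    then show ?thesis using True g h by (simp add: V_def qact_mult)
  qed (simp add: V_def)
qed

lemma V_one: assumes "u \<in> W" shows "V \<one>\<^bsub>X\<^esub> cone u = u"
  using assms by (auto simp: V_def W_iff fun_eq_iff)

lemma V_adjoint:
  assumes g: "g \<in> carrier X" and u: "u \<in> W" and v: "v \<in> W"
  shows "ips (V g q u) v = ips u (V (inv\<^bsub>X\<^esub> g) (ccnj q) v)"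
proof -
  have bij: "bij_betw (\<lambda>x. g \<otimes>\<^bsub>X\<^esub> x) (carrier X) (carrier X)"
    using g by (intro bij_betw_byWitness[where f' = "\<lambda>x. inv\<^bsub>X\<^esub> g \<otimes>\<^bsub>X\<^esub> x"])
      (auto simp: X.m_assoc[symmetric])
  have "ips (V g q u) v = (\<Sum>x\<in>carrier X. sip p (qact q (u (inv\<^bsub>X\<^esub> g \<otimes>\<^bsub>X\<^esub> x))) (v x))"
    unfolding ips_def by (intro sum.cong) (auto simp: V_def)
  also have "\<dots> = (\<Sum>x\<in>carrier X. sip p (qact q (u x)) (v (g \<otimes>\<^bsub>X\<^esub> x)))"
    by (subst sum.reindex_bij_betw[OF bij, symmetric], intro sum.cong)
      (use g in \<open>auto simp: X.m_assoc[symmetric]\<close>)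
  also have "\<dots> = ips u (V (inv\<^bsub>X\<^esub> g) (ccnj q) v)"
    unfolding ips_def using g u v
    by (intro sum.cong) (auto simp: V_def W_iff qact_sip)
  finally show ?thesis .
qed

lemma V_inverse:
  assumes "g \<in> carrier X" "u \<in> W" "cnorm q = 1"
  shows "V (inv\<^bsub>X\<^esub> g) (ccnj q) (V g q u) = u" "V g q (V (inv\<^bsub>X\<^esub> g) (ccnj q) u) = u"
  using assms by (simp_all add: V_mult cmul_ccnj V_one)

lemma V_unitary:
  assumes "g \<in> carrier X" "u \<in> W" "v \<in> W" "cnorm q = 1"
  shows "ips (V g q u) (V g q v) = ips u v"
  using assms by (simp add: V_adjoint V_in_W V_inverse)

lemma nrm_V:
  assumes "g \<in> carrier X" "u \<in> W" "cnorm q = 1"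
  shows "nrm (V g q u) = nrm u"
proof -
  have "complex_of_real ((nrm (V g q u))\<^sup>2) = of_real ((nrm u)\<^sup>2)"
    using ip_self[of "V g q u"] ip_self[of u] assms V_unitary[of g u u q]
    by (simp add: span_basis V_in_W)
  then show ?thesis by (simp only: of_real_eq_iff) simp
qed

subsection \<open>Traces\<close>

definition trace :: "(section_fun \<Rightarrow> section_fun) \<Rightarrow> complex" where
  "trace S = (\<Sum>e\<in>basis. ips (S e) e)"

lemma trace_V_nontrivial:
  assumes g: "g \<in> carrier X" "g \<noteq> \<one>\<^bsub>X\<^esub>" shows "trace (V g q) = 0"
  unfolding trace_def
proof (rule sum.neutral, rule ballI)
  fix e assume "e \<in> basis"
  then obtain x k where e: "e = sec x k" "x \<in> carrier X" by (auto simp: basis_def)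
  have "inv\<^bsub>X\<^esub> g \<otimes>\<^bsub>X\<^esub> x \<noteq> x"
    using g e(2) X.r_cancel_one[of x "inv\<^bsub>X\<^esub> g"] X.inv_eq_1_iff by simp
  then have "V g q e x = 0" using e by (simp add: V_def sec_def)
  then show "ips (V g q e) e = 0"
    unfolding e ips_sec[OF e(2)] by (simp add: sip_def zero_fun_def)
qed

lemma V_diag_sec:
  assumes "x \<in> carrier X" "k \<le> p"
  shows "V \<one>\<^bsub>X\<^esub> (cis t, 0) (sec x k) = section_scale (cis ((real p - 2 * real k) * t)) (sec x k)"
  using assms by (auto simp: V_def section_scale_def sec_def fun_eq_iff qact_diag_mono)

lemma trace_V_central:
  assumes q: "cnorm q = 1" and s: "sin t \<noteq> 0" and t: "cos t = Re (fst q)"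
  shows "cmod (trace (V \<one>\<^bsub>X\<^esub> q)) \<le> card (carrier X) / \<bar>sin t\<bar>"
proof -
  obtain h t' where h: "cnorm h = 1" and qh: "q = cmul (cmul h (cis t', 0)) (ccnj h)"
    using unit_diagonalize[OF q] .
  have "cos t' = cos t" using Re_conjugate[OF h, of "(cis t', 0)"] t by (simp add: qh)
  then have "(sin t')\<^sup>2 = (sin t)\<^sup>2" by (simp add: sin_squared_eq)
  then have st: "\<bar>sin t'\<bar> = \<bar>sin t\<bar>" by (simp add: power2_eq_iff abs_eq_iff)
  let ?H = "V \<one>\<^bsub>X\<^esub> h"
  interpret HV: Vector_Spaces.linear section_scale section_scale ?H by (rule lin_V)
  have basisW: "basis \<subseteq> W" using span_basis section_fun.span_superset by metis
  have ip: "ips (?H e) (?H f) = of_bool (e = f)" if "e \<in> basis" "f \<in> basis" for e f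
    using that basisW h by (subst V_unitary) (auto simp: E_orthonormal)
  have inj: "inj_on ?H basis"
  proof (rule inj_onI)
    fix e f assume ef: "e \<in> basis" "f \<in> basis" "?H e = ?H f"
    have "ips (?H e) (?H f) = 1" using ip[OF ef(1,1)] ef(3) by simp
    then show "e = f" using ip[OF ef(1,2)] by (auto split: if_splits)
  qed
  have orth: "orthonormal (?H ` basis)"
    unfolding orthonormal_def using ip inj by (auto simp: finite_E inj_on_eq_iff)
  have sp: "section_fun.span (?H ` basis) = section_fun.span basis"
  proof
    have "?H ` basis \<subseteq> W" using basisW by (auto simp: V_in_W)
    then show "section_fun.span (?H ` basis) \<subseteq> section_fun.span basis"
      by (intro section_fun.span_minimal section_fun.subspace_span) (simp add: span_basis)
    show "section_fun.span basis \<subseteq> section_fun.span (?H ` basis)"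
    proof
      fix u assume "u \<in> section_fun.span basis"
      then have u: "u \<in> W" by (simp add: span_basis)
      define v where "v = V (inv\<^bsub>X\<^esub> \<one>\<^bsub>X\<^esub>) (ccnj h) u"
      have v: "v \<in> section_fun.span basis" using u by (simp add: v_def span_basis V_in_W del: X.inv_one)
      have "u = ?H v" using u h V_inverse(2)[of "\<one>\<^bsub>X\<^esub>" u h] by (simp add: v_def)
      also have "v = (\<Sum>e\<in>basis. section_scale (ips v e) e)"
        by (rule orthonormal_expand[OF orthonormal_E v])
      also have "?H \<dots> = (\<Sum>e\<in>basis. section_scale (ips v e) (?H e))"
        by (simp only: HV.sum HV.scale)
      also have "\<dots> \<in> section_fun.span (?H ` basis)" by (intro section_fun.span_sum section_fun.span_scale section_fun.span_base) auto
      finally show "u \<in> section_fun.span (?H ` basis)" .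
    qed
  qed
  have "trace (V \<one>\<^bsub>X\<^esub> q) = (\<Sum>e\<in>?H ` basis. ips (V \<one>\<^bsub>X\<^esub> q e) e)"
    unfolding trace_def
    by (rule trace_basis_independent[OF orth orthonormal_E sp lin_V, symmetric])
      (simp add: span_basis V_in_W)
  also have "\<dots> = (\<Sum>e\<in>basis. ips (V \<one>\<^bsub>X\<^esub> q (?H e)) (?H e))" by (simp add: sum.reindex[OF inj])
  also have "\<dots> = (\<Sum>e\<in>basis. ips (V \<one>\<^bsub>X\<^esub> (cis t', 0) e) e)"
  proof (intro sum.cong refl)
    fix e assume "e \<in> basis"
    then have e: "e \<in> W" using basisW by blast
    have "cmul q h = cmul h (cis t', 0)"
      by (simp add: qh cmul_assoc cmul_ccnj h)
    then have "V \<one>\<^bsub>X\<^esub> q (?H e) = ?H (V \<one>\<^bsub>X\<^esub> (cis t', 0) e)" by (simp add: V_mult)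
    then show "ips (V \<one>\<^bsub>X\<^esub> q (?H e)) (?H e) = ips (V \<one>\<^bsub>X\<^esub> (cis t', 0) e) e"
      using e h by (simp add: V_unitary V_in_W)
  qed
  also have "\<dots> = (\<Sum>x\<in>carrier X. \<Sum>k\<le>p. cis ((real p - 2 * real k) * t'))"
    unfolding sum_basis
    by (intro sum.cong refl) (simp add: V_diag_sec ip_scale ips_sec_sec)
  also have "\<dots> = card (carrier X) * (\<Sum>k\<le>p. cis ((real p - 2 * real k) * t'))" by simp
  finally have "cmod (trace (V \<one>\<^bsub>X\<^esub> q)) = card (carrier X) * cmod (\<Sum>k\<le>p. cis ((real p - 2 * real k) * t'))"
    by (simp add: norm_mult)
  also have "\<dots> \<le> card (carrier X) * (1 / \<bar>sin t'\<bar>)"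
    using st s by (intro mult_left_mono sum_weights_bound) auto
  finally show ?thesis by (simp add: st)
qed

end

section \<open>The Laplacian and reduced words\<close>

definition words :: "nat \<Rightarrow> nat \<Rightarrow> quat list set" where
  "words p m = {w. set w \<subseteq> gens p \<and> length w = m \<and> reduced w}"

lemma finite_words [simp]: "finite (words p m)"
  by (rule finite_subset[OF _ finite_lists_length_eq[OF finite_gens[of p], of m]]) (auto simp: words_def)

lemma card_words_le: "card (words p m) \<le> card (gens p) ^ m"
  unfolding card_lists_length_eq[OF finite_gens, symmetric]
  by (rule card_mono[OF finite_lists_length_eq[OF finite_gens[of p], of m]]) (auto simp: words_def)

lemma words_0: "words p 0 = {[]}"
  by (auto simp: words_def reduced_def)

definition extenders :: "nat \<Rightarrow> quat list \<Rightarrow> quat set" where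
  "extenders p w = {x \<in> gens p. w = [] \<or> hd w \<noteq> qcnj x}"

lemma words_Suc: "words p (Suc m) = (\<lambda>(w, x). x # w) ` (SIGMA w:words p m. extenders p w)"
proof (intro equalityI subsetI)
  fix v assume v: "v \<in> words p (Suc m)"
  then obtain x w where "v = x # w" by (auto simp: words_def length_Suc_conv)
  then show "v \<in> (\<lambda>(w, x). x # w) ` (SIGMA w:words p m. extenders p w)"
    using v by (auto simp: words_def reduced_def successively_Cons extenders_def image_iff)
qed (auto simp: words_def reduced_def successively_Cons extenders_def)

lemma sum_words_Suc:
  "(\<Sum>v\<in>words p (Suc m). F v) = (\<Sum>w\<in>words p m. \<Sum>x\<in>extenders p w. F (x # w))"
proof -
  have "inj_on (\<lambda>(w, x). x # w) (SIGMA w:words p m. extenders p w)" by (auto simp: inj_on_def)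
  moreover have "finite (extenders p w)" for w by (simp add: extenders_def)
  ultimately show ?thesis
    unfolding words_Suc by (simp add: sum.reindex sum.Sigma case_prod_unfold)
qed

lemma card_extenders:
  assumes "prime p" "[p = 1] (mod 4)" "w \<in> words p m"
  shows "card (extenders p w) = (if m = 0 then p + 1 else p)"
proof (cases "w = []")
  case True
  then show ?thesis using assms by (simp add: extenders_def card_gens words_def)
next
  case False
  then have "extenders p w = gens p - {qcnj (hd w)}" by (auto simp: extenders_def)
  moreover have "qcnj (hd w) \<in> gens p" using False assms(3) by (auto simp: words_def)
  ultimately show ?thesis using False assms by (simp add: card_gens) (auto simp: words_def)
qed

fun sph :: "real \<Rightarrow> nat \<Rightarrow> real \<Rightarrow> real" where
  "sph q 0 x = 1"
| "sph q (Suc 0) x = x"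
| "sph q (Suc (Suc n)) x = x * sph q (Suc n) x - (if n = 0 then q + 1 else q) * sph q n x"

locale twisted_mod4 = twisted +
  assumes p0_mod4: "[p\<^sub>0 = 1] (mod 4)"
begin

interpretation X: group X by (rule group_X)

lemma odd_p0: "odd p\<^sub>0"
  using p0_mod4 unfolding cong_def by presburger

lemma p0_pos: "p\<^sub>0 > 0"
  using prime_gt_0_nat[OF prime_p0] .

definition op :: "quat list \<Rightarrow> section_fun \<Rightarrow> section_fun" where
  "op w = V (gen_PGL p\<^sub>1 b (qprod w)) (cq (sqrt p\<^sub>0 ^ length w) (qprod w))"

lemma cnorm_word:
  assumes "set w \<subseteq> gens p\<^sub>0" shows "cnorm (cq (sqrt p\<^sub>0 ^ length w) (qprod w)) = 1"
  using cnorm_cq[of "sqrt p\<^sub>0 ^ length w" "qprod w"] qnorm_qprod[OF assms] p0_pos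
  by (simp add: real_sqrt_power[symmetric])

lemma class_word:
  assumes "set w \<subseteq> gens p\<^sub>0" shows "gen_PGL p\<^sub>1 b (qprod w) \<in> carrier X"
  using gen_PGL_in_X[OF qnorm_qprod[OF assms]] .

lemma op_append:
  assumes "set u \<subseteq> gens p\<^sub>0" "set w \<subseteq> gens p\<^sub>0"
  shows "op (u @ w) s = op u (op w s)"
  unfolding op_def qprod_append
  using gen_PGL_mult[OF assms[THEN qnorm_qprod]] assms p0_pos
  by (simp add: V_mult class_word cq_mult power_add)

lemma op_in_W: "set w \<subseteq> gens p\<^sub>0 \<Longrightarrow> u \<in> W \<Longrightarrow> op w u \<in> W"
  unfolding op_def by (intro V_in_W class_word)

lemma lin_op: "lin (op w)"
  unfolding op_def by (rule lin_V)

lemma nrm_op: "set w \<subseteq> gens p\<^sub>0 \<Longrightarrow> u \<in> W \<Longrightarrow> nrm (op w u) = nrm u"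
  unfolding op_def by (intro nrm_V class_word cnorm_word)

lemma op_Nil: "u \<in> W \<Longrightarrow> op [] u = u"
  using V_one cq_real[of 1] by (simp add: op_def gen_PGL_one)

lemma gen_PGL_norm: "gen_PGL p\<^sub>1 b (int p\<^sub>0 ^ m, 0, 0, 0) = \<one>\<^bsub>X\<^esub>"
  using gen_PGL_eq_one_iff[of "int p\<^sub>0 ^ m" 0 0 0 "2 * m"] by (simp add: qnorm_def power_mult[symmetric] mult.commute)

lemma op_cancel:
  assumes "a \<in> gens p\<^sub>0" "u \<in> W"
  shows "op [qcnj a] (op [a] u) = u"
proof -
  have "op [qcnj a] (op [a] u) = op [qcnj a, a] u"
    using op_append[of "[qcnj a]" "[a]"] assms by simp
  also have "\<dots> = V \<one>\<^bsub>X\<^esub> cone u"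
  proof -
    have "qprod [qcnj a, a] = (int p\<^sub>0, 0, 0, 0)"
      using assms by (simp add: qmul_cnj gens_norm[of a p\<^sub>0])
    moreover have "sqrt p\<^sub>0 ^ length [qcnj a, a] = real_of_int (int p\<^sub>0)" by (simp add: power2_eq_square[symmetric])
    moreover have "cq (real_of_int (int p\<^sub>0)) (int p\<^sub>0, 0, 0, 0) = cone" using p0_pos by (intro cq_real) simp
    ultimately show ?thesis using gen_PGL_norm[of 1] unfolding op_def by simp
  qed
  finally show ?thesis using V_one assms by simp
qed

abbreviation "T \<equiv> laplacian p\<^sub>0 p\<^sub>1 b"

lemma laplacian_eq: "T u = (\<Sum>a\<in>gens p\<^sub>0. op [a] u)"
proof
  fix x
  show "T u x = (\<Sum>a\<in>gens p\<^sub>0. op [a] u) x"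
  proof (cases "x \<in> carrier X")
    case True
    have "Sym_act (gen_SU p\<^sub>0 a) s = qact (cq (sqrt p\<^sub>0) a) s" if "a \<in> gens p\<^sub>0" for a s
      using Sym_act_gen_SU[OF gens_norm[OF that]] p0_pos by simp
    then show ?thesis using True by (simp add: laplacian_def sum_fun_apply op_def V_def Let_def)
  qed (simp add: laplacian_def sum_fun_apply op_def V_def Let_def)
qed

lemma lin_T: "lin T"
proof -
  interpret O: Vector_Spaces.linear section_scale section_scale "op w" for w by (rule lin_op)
  show ?thesis
    by unfold_locales (simp_all add: laplacian_eq O.add O.scale sum.distrib section_fun.scale_sum_right)
qed

lemma T_in_W: "u \<in> W \<Longrightarrow> T u \<in> W"
  unfolding laplacian_eq by (rule section_fun.subspace_sum[OF W_subspace]) (auto intro: op_in_W)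

lemma op_adjoint:
  assumes "a \<in> gens p\<^sub>0" "u \<in> W" "v \<in> W"
  shows "ips (op [a] u) v = ips u (op [qcnj a] v)"
proof -
  have "ips u (op [qcnj a] v) = ips (op [a] u) (op [a] (op [qcnj a] v))"
    unfolding op_def[of "[a]"]
    by (rule V_unitary[symmetric]) (use assms class_word[of "[a]"] cnorm_word[of "[a]"] op_in_W in auto)
  also have "op [a] (op [qcnj a] v) = v" using op_cancel[of "qcnj a" v] assms by simp
  finally show ?thesis ..
qed

lemma T_self_adjoint:
  assumes "u \<in> W" "v \<in> W" shows "ips (T u) v = ips u (T v)"
proof -
  have "ips (T u) v = (\<Sum>a\<in>gens p\<^sub>0. ips u (op [qcnj a] v))"
    using assms by (simp add: laplacian_eq ip_sum_left op_adjoint)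
  also have "\<dots> = (\<Sum>a\<in>gens p\<^sub>0. ips u (op [a] v))"
    by (rule sum.reindex_bij_betw[OF bij_betw_qcnj_gens])
  finally show ?thesis by (simp add: laplacian_eq ip_sum_right)
qed

definition sphere_op :: "nat \<Rightarrow> section_fun \<Rightarrow> section_fun" where
  "sphere_op m u = (\<Sum>w\<in>words p\<^sub>0 m. op w u)"

lemma words_gens: "w \<in> words p\<^sub>0 m \<Longrightarrow> set w \<subseteq> gens p\<^sub>0"
  by (simp add: words_def)

lemma T_sphere_op:
  assumes u: "u \<in> W"
  shows "T (sphere_op (Suc m) u) = sphere_op (Suc (Suc m)) u
    + section_scale (of_nat (if m = 0 then p\<^sub>0 + 1 else p\<^sub>0)) (sphere_op m u)"
proof -
  interpret O: Vector_Spaces.linear section_scale section_scale "op w" for w by (rule lin_op)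
  let ?n = "if m = 0 then p\<^sub>0 + 1 else p\<^sub>0"
  have "T (sphere_op (Suc m) u) = (\<Sum>a\<in>gens p\<^sub>0. \<Sum>w\<in>words p\<^sub>0 (Suc m). op [a] (op w u))"
    by (simp add: laplacian_eq sphere_op_def O.sum)
  also have "\<dots> = (\<Sum>w\<in>words p\<^sub>0 (Suc m). \<Sum>a\<in>gens p\<^sub>0. op (a # w) u)"
  proof (subst sum.swap, intro sum.cong refl)
    fix w a assume "w \<in> words p\<^sub>0 (Suc m)" "a \<in> gens p\<^sub>0"
    then show "op [a] (op w u) = op (a # w) u"
      using op_append[of "[a]" w u] words_gens[of w] by simp
  qed
  also have "\<dots> = (\<Sum>w\<in>words p\<^sub>0 (Suc m).
      (\<Sum>a\<in>extenders p\<^sub>0 w. op (a # w) u) + op (qcnj (hd w) # w) u)"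
  proof (intro sum.cong refl)
    fix w assume w: "w \<in> words p\<^sub>0 (Suc m)"
    then have ne: "w \<noteq> []" by (auto simp: words_def)
    then have h: "qcnj (hd w) \<in> gens p\<^sub>0" using w by (auto simp: words_def)
    have "gens p\<^sub>0 = insert (qcnj (hd w)) (extenders p\<^sub>0 w)" and nin: "qcnj (hd w) \<notin> extenders p\<^sub>0 w"
      using ne h by (auto simp: extenders_def)
    then have "(\<Sum>a\<in>gens p\<^sub>0. op (a # w) u)
        = (\<Sum>a\<in>insert (qcnj (hd w)) (extenders p\<^sub>0 w). op (a # w) u)"
      by (intro sum.cong) auto
    also have "\<dots> = (\<Sum>a\<in>extenders p\<^sub>0 w. op (a # w) u) + op (qcnj (hd w) # w) u"
      using nin by (subst sum.insert) (simp_all add: extenders_def add.commute)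
    finally show "(\<Sum>a\<in>gens p\<^sub>0. op (a # w) u)
        = (\<Sum>a\<in>extenders p\<^sub>0 w. op (a # w) u) + op (qcnj (hd w) # w) u" .
  qed
  also have "\<dots> = sphere_op (Suc (Suc m)) u + (\<Sum>w\<in>words p\<^sub>0 (Suc m). op (qcnj (hd w) # w) u)"
    unfolding sum.distrib sphere_op_def by (subst sum_words_Suc[of _ p\<^sub>0 "Suc m"]) (rule refl)
  also have "(\<Sum>w\<in>words p\<^sub>0 (Suc m). op (qcnj (hd w) # w) u)
      = (\<Sum>w\<in>words p\<^sub>0 m. \<Sum>x\<in>extenders p\<^sub>0 w. op w u)"
    unfolding sum_words_Suc
  proof (intro sum.cong refl)
    fix w x assume w: "w \<in> words p\<^sub>0 m" and x: "x \<in> extenders p\<^sub>0 w"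
    then have xg: "x \<in> gens p\<^sub>0" by (simp add: extenders_def)
    have "op (qcnj x # x # w) u = op [qcnj x] (op [x] (op w u))"
      using op_append[of "[qcnj x]" "x # w"] op_append[of "[x]" w] xg words_gens[OF w] by simp
    also have "\<dots> = op w u" using op_cancel[OF xg] op_in_W[OF words_gens[OF w] u] by simp
    finally show "op (qcnj (hd (x # w)) # x # w) u = op w u" by simp
  qed
  also have "\<dots> = section_scale (of_nat ?n) (sphere_op m u)"
    unfolding sphere_op_def section_fun.scale_sum_right
  proof (intro sum.cong refl)
    fix w assume "w \<in> words p\<^sub>0 m"
    from card_extenders[OF prime_p0 p0_mod4 this]
    show "(\<Sum>x\<in>extenders p\<^sub>0 w. op w u) = section_scale (of_nat ?n) (op w u)"
      by (simp add: fun_eq_iff sum_fun_apply section_scale_def)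
  qed
  finally show ?thesis .
qed

lemma sphere_op_eigen:
  assumes u: "u \<in> W" and l: "T u = section_scale (of_real l) u"
  shows "sphere_op m u = section_scale (of_real (sph p\<^sub>0 m l)) u"
proof (induction m rule: induct_nat_012)
  case 0
  then show ?case using u by (simp add: sphere_op_def words_0 op_Nil)
next
  case 1
  have "extenders p\<^sub>0 [] = gens p\<^sub>0" by (simp add: extenders_def)
  then show ?case using l by (simp add: sphere_op_def sum_words_Suc words_0 laplacian_eq)
next
  case (ge2 m)
  interpret T: Vector_Spaces.linear section_scale section_scale T by (rule lin_T)
  have "sphere_op (Suc (Suc m)) u = T (sphere_op (Suc m) u)
      - section_scale (of_nat (if m = 0 then p\<^sub>0 + 1 else p\<^sub>0)) (sphere_op m u)"
    using T_sphere_op[OF u, of m] by simp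
  also have "\<dots> = section_scale (of_real (l * sph p\<^sub>0 (Suc m) l)
      - of_nat (if m = 0 then p\<^sub>0 + 1 else p\<^sub>0) * of_real (sph p\<^sub>0 m l)) u"
    unfolding ge2 T.scale l section_fun.scale_scale section_fun.scale_left_diff_distrib
    by (simp add: mult.commute)
  also have "of_real (l * sph p\<^sub>0 (Suc m) l)
      - of_nat (if m = 0 then p\<^sub>0 + 1 else p\<^sub>0) * complex_of_real (sph p\<^sub>0 m l)
      = of_real (sph p\<^sub>0 (Suc (Suc m)) l)" by simp
  finally show ?case .
qed

lemma trace_op_bound:
  assumes w: "w \<in> words p\<^sub>0 m" and m: "m > 0"
  shows "cmod (trace (op w)) \<le> card basis * real p\<^sub>0 ^ m / max p\<^sub>1 p"
proof (cases "gen_PGL p\<^sub>1 b (qprod w) = \<one>\<^bsub>X\<^esub>")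
  case False
  then show ?thesis
    using trace_V_nontrivial[OF class_word[OF words_gens[OF w]]] by (simp add: op_def)
next
  case True
  obtain q0 q1 q2 q3 where q: "qprod w = (q0, q1, q2, q3)" by (cases "qprod w")
  have len: "length w = m" and ne: "w \<noteq> []" and red: "reduced w"
    using w m by (auto simp: words_def)
  have n: "qnorm (q0, q1, q2, q3) = int p\<^sub>0 ^ m" using qnorm_qprod[OF words_gens[OF w]] by (simp add: q len)
  have d: "int p\<^sub>1 dvd q1" "int p\<^sub>1 dvd q2" "int p\<^sub>1 dvd q3"
    using gen_PGL_eq_one_iff[OF n] True by (auto simp: q)
  have nr: "q1 \<noteq> 0 \<or> q2 \<noteq> 0 \<or> q3 \<noteq> 0"
    using reduced_not_real[OF prime_p0 odd_p0 words_gens[OF w] red ne] by (auto simp: q qreal_def)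
  have sq: "(int p\<^sub>1)\<^sup>2 \<le> x\<^sup>2" if "int p\<^sub>1 dvd x" "x \<noteq> 0" for x
    using that dvd_imp_le_int[of x "int p\<^sub>1"] by (simp add: abs_le_square_iff[symmetric])
  have S: "(int p\<^sub>1)\<^sup>2 \<le> q1\<^sup>2 + q2\<^sup>2 + q3\<^sup>2"
    using nr sq[OF d(1)] sq[OF d(2)] sq[OF d(3)] zero_le_power2[of q1] zero_le_power2[of q2]
      zero_le_power2[of q3] by (smt (verit))
  define r where "r = sqrt p\<^sub>0 ^ m"
  have r: "r > 0" using p0_pos by (simp add: r_def)
  have r2: "r\<^sup>2 = real p\<^sub>0 ^ m" by (simp add: r_def real_sqrt_power[symmetric])
  define c where "c = real_of_int q0 / r"
  have tot: "real_of_int q0 ^ 2 + (real_of_int q1 ^ 2 + real_of_int q2 ^ 2 + real_of_int q3 ^ 2) = r\<^sup>2"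
    using arg_cong[OF n, of real_of_int] unfolding r2 qnorm_def by simp
  have S': "(real p\<^sub>1)\<^sup>2 \<le> real_of_int q1 ^ 2 + real_of_int q2 ^ 2 + real_of_int q3 ^ 2"
    using S by (metis (mono_tags, lifting) of_int_add of_int_le_iff of_int_of_nat_eq of_int_power)
  have "1 - c\<^sup>2 = (r\<^sup>2 - real_of_int q0 ^ 2) / r\<^sup>2"
    using r by (simp add: c_def power_divide diff_divide_distrib)
  also have "\<dots> \<ge> (real p\<^sub>1)\<^sup>2 / r\<^sup>2" using tot S' by (intro divide_right_mono) auto
  finally have c: "1 - c\<^sup>2 \<ge> (real p\<^sub>1 / r)\<^sup>2" by (simp add: power_divide)
  have "c\<^sup>2 \<le> 1" using c zero_le_power2[of "real p\<^sub>1 / r"] by linarith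
  then have "\<bar>c\<bar> \<le> 1" by (simp add: abs_square_le_1)
  then obtain t where t: "cos t = c" by (metis abs_le_iff cos_arccos minus_le_iff)
  have "(sin t)\<^sup>2 \<ge> (real p\<^sub>1 / r)\<^sup>2" using c by (simp add: sin_squared_eq t)
  then have s: "\<bar>sin t\<bar> \<ge> real p\<^sub>1 / r" using r by (simp add: abs_le_square_iff[symmetric])
  have p1: "real p\<^sub>1 > 0" using prime_gt_0_nat[OF prime_p1] by simp
  then have s0: "\<bar>sin t\<bar> > 0" using s r by (meson divide_pos_pos less_le_trans)
  have "cmod (trace (op w)) \<le> card (carrier X) / \<bar>sin t\<bar>"
    unfolding op_def True
    by (rule trace_V_central) (use cnorm_word[OF words_gens[OF w]] s0 in \<open>auto simp: t c_def q cq_def len r_def\<close>)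
  also have "\<dots> \<le> card (carrier X) / (real p\<^sub>1 / r)" using s s0 r p1 by (intro divide_left_mono mult_pos_pos) auto
  also have "\<dots> = card (carrier X) * r / p\<^sub>1" by simp
  also have "\<dots> \<le> card (carrier X) * r\<^sup>2 / p\<^sub>1"
  proof -
    have "r \<ge> 1" unfolding r_def using p0_pos by simp
    then have "r \<le> r\<^sup>2" using self_le_power[of r 2] by simp
    then show ?thesis by (intro divide_right_mono mult_left_mono) auto
  qed
  also have "\<dots> = card basis * real p\<^sub>0 ^ m / (p\<^sub>1 * (p + 1))"
  proof -
    define P where "P = real (p + 1)"
    have "P > 0" "real (card basis) = card (carrier X) * P" "real (p\<^sub>1 * (p + 1)) = p\<^sub>1 * P"
      by (simp_all add: card_basis P_def algebra_simps)
    then show ?thesis using p1 by (simp add: r2)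
  qed
  also have "\<dots> \<le> card basis * real p\<^sub>0 ^ m / max p\<^sub>1 p"
  proof -
    have "p\<^sub>1 \<le> p\<^sub>1 * (p + 1)" "p \<le> p\<^sub>1 * (p + 1)" "0 < max p\<^sub>1 p"
      using prime_gt_0_nat[OF prime_p1] mult_le_mono1[of 1 p\<^sub>1 "p + 1"] by auto
    then have "max p\<^sub>1 p \<le> p\<^sub>1 * (p + 1)" by simp
    then have "real (max p\<^sub>1 p) \<le> real (p\<^sub>1 * (p + 1))" by (rule of_nat_mono)
    then show ?thesis using \<open>0 < max p\<^sub>1 p\<close> p1
      by (intro divide_left_mono mult_nonneg_nonneg mult_pos_pos) auto
  qed
  finally show ?thesis .
qed

end

section \<open>Vectors of weight zero\<close>

lemma unit_diagonalize_pos: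
  assumes "cnorm q = 1"
  obtains h t where "cnorm h = 1" "q = cmul (cmul h (cis t, 0)) (ccnj h)" "0 \<le> t" "t \<le> pi"
proof -
  obtain h s where h: "cnorm h = 1" and q: "q = cmul (cmul h (cis s, 0)) (ccnj h)"
    using unit_diagonalize[OF assms] .
  define t where "t = arccos (cos s)"
  have t: "0 \<le> t" "t \<le> pi" "cos t = cos s"
    by (simp_all add: t_def arccos_lbound arccos_ubound cos_arccos)
  then have "(sin t)\<^sup>2 = (sin s)\<^sup>2" by (simp add: sin_squared_eq)
  then consider "sin t = sin s" | "sin t = - sin s" by (auto simp: power2_eq_iff)
  then show ?thesis
  proof cases
    case 1
    then have "cis s = cis t" using t by (simp add: complex_eq_iff)
    then show ?thesis using that[of h t] h q t by simp
  next
    case 2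
    then have c: "cis (- s) = cis t" using t by (simp add: complex_eq_iff)
    let ?j = "(0, 1) :: cquat"
    have j: "cmul (cmul ?j (cis t, 0)) (ccnj ?j) = (cis s, 0)"
      by (simp add: cmul_def ccnj_def c[symmetric] cis_cnj)
    have "q = cmul (cmul h (cmul (cmul ?j (cis t, 0)) (ccnj ?j))) (ccnj h)" unfolding j by (rule q)
    then have "q = cmul (cmul (cmul h ?j) (cis t, 0)) (ccnj (cmul h ?j))"
      by (simp add: cmul_assoc ccnj_mult)
    moreover have "cnorm (cmul h ?j) = 1" using h by (simp add: cnorm_mult) (simp add: cnorm_def)
    ultimately show ?thesis using that t by blast
  qed
qed

lemma abs_sin_mult_le: "\<bar>sin (real k * x)\<bar> \<le> real k * \<bar>sin x\<bar>"
proof (induction k)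
  case (Suc k)
  have "sin (real (Suc k) * x) = sin (real k * x) * cos x + cos (real k * x) * sin x"
    by (simp add: distrib_right sin_add add.commute)
  also have "\<bar>\<dots>\<bar> \<le> \<bar>sin (real k * x)\<bar> * \<bar>cos x\<bar> + \<bar>cos (real k * x)\<bar> * \<bar>sin x\<bar>"
    by (metis abs_mult abs_triangle_ineq)
  also have "\<dots> \<le> \<bar>sin (real k * x)\<bar> * 1 + 1 * \<bar>sin x\<bar>"
    by (intro add_mono mult_mono) auto
  finally show ?case using Suc by (simp add: algebra_simps)
qed simp

lemma angle_bound:
  assumes "0 \<le> t" "t \<le> pi" "p > 0" "cos t \<ge> 1 - 2 / (real p)\<^sup>2"
  shows "real p * t \<le> pi"
proof (rule ccontr)
  assume "\<not> real p * t \<le> pi"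
  then have "pi / real p < t" using assms(3) by (simp add: field_simps)
  then have "cos t < cos (pi / real p)" using assms by (intro cos_monotone_0_pi) auto
  also have "\<dots> = 1 - 2 * (sin (pi / (2 * real p)))\<^sup>2"
    using cos_double_sin[of "pi / (2 * real p)"] by simp
  also have "\<dots> \<le> 1 - 2 * (1 / real p)\<^sup>2"
  proof -
    have half: "real p * (pi / (2 * real p)) = pi / 2" using assms(3) by simp
    have "1 \<le> real p * \<bar>sin (pi / (2 * real p))\<bar>"
      using abs_sin_mult_le[of p "pi / (2 * real p)"] unfolding half by simp
    then have "1 / real p \<le> \<bar>sin (pi / (2 * real p))\<bar>" using assms(3) by (simp add: field_simps)
    then have "(1 / real p)\<^sup>2 \<le> (sin (pi / (2 * real p)))\<^sup>2"
      by (metis abs_of_nat abs_le_square_iff abs_divide abs_one)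
    then show ?thesis by simp
  qed
  finally show False using assms(4) by (simp add: power_divide)
qed

lemma weight_separation:
  assumes t: "0 \<le> t" and pt: "real p * t \<le> pi" and k: "k \<le> p" "2 * k \<noteq> p"
  shows "(sin t)\<^sup>2 \<le> (cmod (cis ((real p - 2 * real k) * t) - 1))\<^sup>2"
proof -
  define j where "j = \<bar>real p - 2 * real k\<bar>"
  have "real p \<noteq> 2 * real k" using k by linarith
  moreover have "j = real_of_int \<bar>int p - 2 * int k\<bar>" by (simp add: j_def)
  moreover have "\<bar>int p - 2 * int k\<bar> \<ge> 1" using k by linarith
  ultimately have j: "1 \<le> j" "j \<le> real p" using k by (auto simp: j_def)
  have jt: "t \<le> j * t" "j * t \<le> pi"
    using mult_right_mono[OF j(1) t] mult_right_mono[OF j(2) t] pt by auto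
  then have "cos (j * t) \<le> cos t" using t by (intro cos_monotone_0_pi_le) auto
  moreover have "(cmod (cis s - 1))\<^sup>2 = 2 - 2 * cos s" for s
    using sin_cos_squared_add[of s] unfolding cmod_power2
    by (simp add: power2_eq_square algebra_simps)
  moreover have "cos ((real p - 2 * real k) * t) = cos (j * t)"
  proof (cases "real p - 2 * real k \<ge> 0")
    case False
    then have "j * t = - ((real p - 2 * real k) * t)" by (simp add: j_def algebra_simps)
    then show ?thesis by simp
  qed (simp add: j_def)
  moreover have "(sin t)\<^sup>2 \<le> 2 - 2 * cos t"
    using zero_le_power2[of "1 - cos t"] power2_diff[of 1 "cos t"] sin_squared_eq[of t] by simp
  ultimately show ?thesis by simp
qed

text \<open>On the unit circle the two linear factors of the rotated weight vector have squared moduli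
  \<open>1 - y\<close> and \<open>1 + y\<close>; averaging \<open>sqrt (1 - y\<^sup>2) \<le> 1 - y\<^sup>2 / 2\<close> over roots of unity
  bounds the matrix coefficient.\<close>

lemma weight_zero_coefficient:
  assumes g: "cnorm (a, b) = 1" and l: "l > 0"
  shows "cmod (sip (2 * l) (qact (a, b) (hmono (2 * l) l)) (hmono (2 * l) l))
    \<le> 1 - (cmod a)\<^sup>2 * (cmod b)\<^sup>2"
proof -
  let ?p = "2 * l"
  let ?c = "complex_of_real (sqrt (?p choose l))"
  let ?w = "root_pt ?p"
  define s where "s = cnj a * cnj b"
  define y where "y j = 2 * Re (?w j * s)" for j
  define m where "m = (\<lambda>z::complex^2. (cnj a * z$1 - b * z$2) ^ l * (cnj b * z$1 + a * z$2) ^ l)"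
  have c: "?c \<noteq> 0" by (simp add: binomial_eq_0_iff)
  have "qact (a, b) (hmono ?p l) = (\<lambda>z. ?c * m z)"
    by (simp add: qact_def hmono_def capp_def ccnj_def m_def fun_eq_iff add.commute)
  then have eq: "sip ?p (qact (a, b) (hmono ?p l)) (hmono ?p l) = coef ?p m l"
    using c by (simp add: sip_mono_right coef_scale)
  have n: "(cmod a)\<^sup>2 + (cmod b)\<^sup>2 = 1" using g by (simp add: cnorm_def)
  have val: "cmod (m (vec2 (?w j) 1)) \<le> 1 - (y j)\<^sup>2 / 2" for j
  proof -
    define A B where "A = cmod (cnj a * ?w j - b)" and "B = cmod (cnj b * ?w j + a)"
    have w: "(Re (?w j))\<^sup>2 + (Im (?w j))\<^sup>2 = 1"
      using cmod_power2[of "?w j"] by simp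
    have cn: "(cmod (x * ?w j + z))\<^sup>2 = (cmod x)\<^sup>2 + (cmod z)\<^sup>2 + 2 * Re (x * ?w j * cnj z)" for x z
    proof -
      have "(cmod (x * ?w j + z))\<^sup>2 = (cmod (x * ?w j))\<^sup>2 + (cmod z)\<^sup>2 + 2 * Re (x * ?w j * cnj z)"
        unfolding cmod_power2 by (simp add: power2_eq_square algebra_simps)
      then show ?thesis by (simp add: norm_mult)
    qed
    have A2: "A\<^sup>2 = 1 - y j" using cn[of "cnj a" "- b"] n by (simp add: A_def y_def s_def algebra_simps)
    have B2: "B\<^sup>2 = 1 + y j" using cn[of "cnj b" a] n by (simp add: B_def y_def s_def algebra_simps)
    have "A \<ge> 0" "B \<ge> 0" by (simp_all add: A_def B_def)
    have y1: "(y j)\<^sup>2 \<le> 1"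
    proof -
      have "\<bar>y j\<bar> \<le> 1" using A2 B2 zero_le_power2[of A] zero_le_power2[of B] by linarith
      then show ?thesis by (simp add: abs_square_le_1)
    qed
    have AB: "(A * B)\<^sup>2 = 1 - (y j)\<^sup>2"
      unfolding power_mult_distrib A2 B2 by (simp add: power2_eq_square algebra_simps)
    have "(A * B)\<^sup>2 \<le> (1 - (y j)\<^sup>2 / 2)\<^sup>2"
      unfolding AB using zero_le_power2[of "(y j)\<^sup>2"] by (simp add: power2_eq_square algebra_simps)
    then have AB1: "A * B \<le> 1 - (y j)\<^sup>2 / 2" by (rule power2_le_imp_le) (use y1 in simp)
    have "cmod (m (vec2 (?w j) 1)) = (A * B) ^ l"
      by (simp add: m_def A_def B_def norm_mult norm_power power_mult_distrib)
    also have "\<dots> \<le> A * B"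
    proof -
      have "A * B \<le> 1" using AB1 zero_le_power2[of "y j"] by linarith
      then show ?thesis
        using power_decreasing[of 1 l "A * B"] l \<open>A \<ge> 0\<close> \<open>B \<ge> 0\<close> by simp
    qed
    finally show ?thesis using AB1 by simp
  qed
  have avg: "(\<Sum>j\<le>?p. (y j)\<^sup>2) = real (?p + 1) * (2 * (cmod s)\<^sup>2)"
  proof -
    have yj: "(y j)\<^sup>2 = 2 * (cmod s)\<^sup>2 + 2 * Re (?w j ^ 2 * s\<^sup>2)" for j
    proof -
      have "(y j)\<^sup>2 = 2 * (cmod (?w j * s))\<^sup>2 + 2 * Re ((?w j * s)\<^sup>2)"
        unfolding y_def cmod_power2 by (simp add: power2_eq_square algebra_simps)
      then show ?thesis by (simp add: norm_mult power_mult_distrib)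
    qed
    have "(\<Sum>j\<le>?p. Re (?w j ^ 2 * s\<^sup>2)) = Re ((\<Sum>j\<le>?p. ?w j ^ 2) * s\<^sup>2)"
      by (simp add: sum_distrib_right)
    also have "\<dots> = 0" using l by (simp add: sum_root_pt_power)
    finally have "(\<Sum>j\<le>?p. Re (?w j ^ 2 * s\<^sup>2)) = 0" .
    then show ?thesis unfolding yj sum.distrib sum_distrib_left[symmetric] by simp
  qed
  have "cmod (coef ?p m l) \<le> (\<Sum>j\<le>?p. cmod (m (vec2 (?w j) 1))) / real (?p + 1)"
  proof -
    have "cmod (\<Sum>j\<le>?p. m (vec2 (?w j) 1) * cnj (?w j) ^ l) \<le> (\<Sum>j\<le>?p. cmod (m (vec2 (?w j) 1)))"
      by (rule order_trans[OF norm_sum]) (simp add: norm_mult norm_power)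
    then show ?thesis
      unfolding coef_def norm_divide norm_of_nat by (rule divide_right_mono) simp
  qed
  also have "\<dots> \<le> (\<Sum>j\<le>?p. 1 - (y j)\<^sup>2 / 2) / real (?p + 1)"
    by (intro divide_right_mono sum_mono val) simp
  also have "(\<Sum>j\<le>?p. 1 - (y j)\<^sup>2 / 2) = real (?p + 1) - (\<Sum>j\<le>?p. (y j)\<^sup>2) / 2"
    unfolding sum_subtractf sum_divide_distrib by simp
  also have "\<dots> = real (?p + 1) * (1 - (cmod s)\<^sup>2)" unfolding avg by (simp add: algebra_simps)
  also have "\<dots> / real (?p + 1) = 1 - (cmod s)\<^sup>2" by (simp del: of_nat_add)
  finally show ?thesis unfolding eq by (simp add: s_def norm_mult power_mult_distrib)
qed

lemma cmul_commutator_norm: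
  assumes h: "cnorm h = 1"
  defines "c \<equiv> \<lambda>g. cmul (cmul (ccnj h) g) h"
  shows "cnorm (cmul (c g) (c k) - cmul (c k) (c g)) = cnorm (cmul g k - cmul k g)"
proof -
  have mul: "cmul (c g) (c k) = cmul (cmul (ccnj h) (cmul g k)) h" for g k
  proof -
    have "cmul (c g) (c k) = cmul (cmul (ccnj h) g) (cmul (cmul h (ccnj h)) (cmul k h))"
      by (simp add: c_def cmul_assoc)
    then show ?thesis by (simp add: cmul_ccnj h cmul_assoc)
  qed
  have diff: "cmul (cmul u x) v - cmul (cmul u y) v = cmul (cmul u (x - y)) v" for u v x y
    by (cases u; cases v; cases x; cases y) (simp add: cmul_def algebra_simps)
  show ?thesis unfolding mul diff cnorm_mult cnorm_ccnj h by simp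
qed

lemma cnorm_diff_cq:
  assumes "r \<noteq> 0" shows "cnorm (cq r q - cq r s) = qnorm (q - s) / r\<^sup>2"
proof -
  have "cq r q - cq r s = cq r (q - s)"
    by (cases q; cases s) (simp add: cq_def complex_eq_iff diff_divide_distrib)
  then show ?thesis by (simp add: cnorm_cq assms)
qed

lemma qnorm_pos: "q \<noteq> 0 \<Longrightarrow> qnorm q \<ge> 1"
proof -
  assume "q \<noteq> 0"
  obtain q0 q1 q2 q3 where q: "q = (q0, q1, q2, q3)" by (cases q)
  have "qnorm q \<noteq> 0"
    using \<open>q \<noteq> 0\<close> zero_le_power2[of q0] zero_le_power2[of q1] zero_le_power2[of q2] zero_le_power2[of q3]
    unfolding q qnorm_def by (auto simp: add_nonneg_eq_0_iff zero_prod_def)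
  moreover have "qnorm q \<ge> 0" unfolding q qnorm_def by simp
  ultimately show ?thesis by simp
qed

lemma centralizer_commutative:
  assumes e: "\<not> qreal e" and a: "qmul a e = qmul e a" and c: "qmul c e = qmul e c"
  shows "qmul a c = qmul c a"
proof -
  obtain a0 a1 a2 a3 where aa: "a = (a0, a1, a2, a3)" by (cases a)
  obtain c0 c1 c2 c3 where cc: "c = (c0, c1, c2, c3)" by (cases c)
  obtain e0 e1 e2 e3 where ee: "e = (e0, e1, e2, e3)" by (cases e)
  have a': "a2 * e3 = a3 * e2" "a3 * e1 = a1 * e3" "a1 * e2 = a2 * e1"
    using a by (auto simp: aa ee qmul_def algebra_simps)
  have c': "c2 * e3 = c3 * e2" "c3 * e1 = c1 * e3" "c1 * e2 = c2 * e1"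
    using c by (auto simp: cc ee qmul_def algebra_simps)
  have key: "(a2 * c3 - a3 * c2 = 0) \<and> (a3 * c1 - a1 * c3 = 0) \<and> (a1 * c2 - a2 * c1 = 0)"
    if e1: "e1 \<noteq> 0" and a': "a2 * e3 = a3 * e2" "a3 * e1 = a1 * e3" "a1 * e2 = a2 * e1"
      and c': "c2 * e3 = c3 * e2" "c3 * e1 = c1 * e3" "c1 * e2 = c2 * e1"
    for a1 a2 a3 c1 c2 c3 e1 e2 e3 :: int
  proof -
    have "e1 * (a3 * c1 - a1 * c3) = (a3 * e1) * c1 - a1 * (c3 * e1)" by (simp add: algebra_simps)
    also have "\<dots> = 0" unfolding a' c' by (simp add: algebra_simps)
    finally have 1: "a3 * c1 - a1 * c3 = 0" using e1 by simp
    have "e1 * (a1 * c2 - a2 * c1) = a1 * (c2 * e1) - (a2 * e1) * c1" by (simp add: algebra_simps)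
    also have "\<dots> = 0" unfolding a'(3)[symmetric] c'(3)[symmetric] by (simp add: algebra_simps)
    finally have 2: "a1 * c2 - a2 * c1 = 0" using e1 by simp
    have "e1 * (e1 * (a2 * c3 - a3 * c2)) = (a2 * e1) * (c3 * e1) - (a3 * e1) * (c2 * e1)"
      by (simp add: algebra_simps)
    also have "\<dots> = 0"
      unfolding a'(2) c'(2) a'(3)[symmetric] c'(3)[symmetric] by (simp add: algebra_simps)
    finally have "a2 * c3 - a3 * c2 = 0" using e1 by simp
    with 1 2 show ?thesis by blast
  qed
  have "e1 \<noteq> 0 \<or> e2 \<noteq> 0 \<or> e3 \<noteq> 0" using e by (auto simp: ee qreal_def)
  then have "(a2 * c3 - a3 * c2 = 0) \<and> (a3 * c1 - a1 * c3 = 0) \<and> (a1 * c2 - a2 * c1 = 0)"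
    using key[of e1 a2 e3 a3 e2 a1 c2 c3 c1] key[of e2 a3 e1 a1 e3 a2 c3 c1 c2]
      key[of e3 a1 e2 a2 e1 a3 c1 c2 c3] a' c' by auto
  then show ?thesis by (auto simp: aa cc qmul_def algebra_simps)
qed

section \<open>A lower bound for the spectral gap\<close>

lemma increasing_sets_stabilize:
  assumes "finite A" "\<And>k. S k \<subseteq> A" "\<And>k. S k \<subseteq> S (Suc k)" "S 0 \<noteq> {}"
  shows "\<exists>k\<le>card A. S (Suc k) = S k"
proof (rule ccontr)
  assume "\<not> ?thesis"
  then have ne: "S k \<subset> S (Suc k)" if "k \<le> card A" for k using assms(3)[of k] that by blast
  have fin: "finite (S k)" for k using assms(1,2) finite_subset by blast
  have "k < card (S k)" if "k \<le> Suc (card A)" for k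
    using that
  proof (induction k)
    case 0 then show ?case using assms(4) fin by (simp add: card_gt_0_iff)
  next
    case (Suc k)
    then show ?case using psubset_card_mono[OF fin ne[of k]] by simp
  qed
  from this[of "Suc (card A)"] show False using card_mono[OF assms(1,2)] by (meson Suc_lessD le_refl not_le)
qed

context twisted_mod4
begin

interpretation X: group X by (rule group_X)

lemma W_diff: "u \<in> W \<Longrightarrow> v \<in> W \<Longrightarrow> u - v \<in> W"
  using section_fun.subspace_diff[OF W_subspace] .

lemma nrm_diff_sq:
  assumes "u \<in> W" "v \<in> W"
  shows "(nrm (u - v))\<^sup>2 = (nrm u)\<^sup>2 + (nrm v)\<^sup>2 - 2 * Re (ips u v)"
proof -
  have "complex_of_real ((nrm (u - v))\<^sup>2) = ips (u - v) (u - v)"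
    using ip_self[of "u - v"] assms by (simp add: span_basis W_diff)
  also have "\<dots> = ips u u + ips v v - (ips u v + cnj (ips u v))"
    unfolding ip_diff ip_diff_right cnj_ip by simp
  also have "\<dots> = of_real ((nrm u)\<^sup>2) + of_real ((nrm v)\<^sup>2) - of_real (2 * Re (ips u v))"
    using ip_self[of u] ip_self[of v] assms by (simp only: span_basis complex_add_cnj)
  finally have "complex_of_real ((nrm (u - v))\<^sup>2)
      = of_real ((nrm u)\<^sup>2 + (nrm v)\<^sup>2 - 2 * Re (ips u v))" by simp
  then show ?thesis by (simp only: of_real_eq_iff)
qed

lemma card_gens_p0: "card (gens p\<^sub>0) = p\<^sub>0 + 1"
  by (rule card_gens[OF prime_p0 p0_mod4])

lemma Re_ips_op_le: "set w \<subseteq> gens p\<^sub>0 \<Longrightarrow> u \<in> W \<Longrightarrow> nrm u = 1 \<Longrightarrow> Re (ips (op w u) u) \<le> 1"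
  using ip_bound[of "op w u" u] nrm_op[of w u] op_in_W[of w u] complex_Re_le_cmod[of "ips (op w u) u"]
  by (simp add: span_basis)

lemma eigen_gen:
  fixes l :: real
  assumes u: "u \<in> W" "nrm u = 1" and l: "T u = section_scale (of_real l) u" and a: "a \<in> gens p\<^sub>0"
  shows "Re (ips (op [a] u) u) \<ge> 1 - (real p\<^sub>0 + 1 - l)"
proof -
  have "ips u u = 1" using ip_self[of u] u by (simp add: span_basis)
  then have "complex_of_real l = ips (T u) u" unfolding l ip_scale by simp
  also have "\<dots> = (\<Sum>a\<in>gens p\<^sub>0. ips (op [a] u) u)" by (simp add: laplacian_eq ip_sum_left)
  finally have "l = (\<Sum>a\<in>gens p\<^sub>0. Re (ips (op [a] u) u))" by (metis Re_complex_of_real Re_sum)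
  also have "\<dots> = Re (ips (op [a] u) u) + (\<Sum>c\<in>gens p\<^sub>0 - {a}. Re (ips (op [c] u) u))"
    using a by (simp add: sum.remove)
  also have "(\<Sum>c\<in>gens p\<^sub>0 - {a}. Re (ips (op [c] u) u)) \<le> (\<Sum>c\<in>gens p\<^sub>0 - {a}. 1)"
    using u by (intro sum_mono Re_ips_op_le) auto
  also have "\<dots> = p\<^sub>0" using a card_gens_p0 by simp
  finally show ?thesis by simp
qed

lemma eigenvalue_le:
  fixes l :: real
  assumes u: "u \<in> W" "nrm u = 1" and l: "T u = section_scale (of_real l) u"
  shows "\<bar>l\<bar> \<le> real p\<^sub>0 + 1"
proof -
  have "\<bar>l\<bar> = nrm (T u)" using u by (simp add: l nrm_scale)
  also have "\<dots> \<le> (\<Sum>a\<in>gens p\<^sub>0. nrm (op [a] u))" unfolding laplacian_eq by (rule nrm_sum)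
  also have "\<dots> = p\<^sub>0 + 1" using u card_gens_p0 by (simp add: nrm_op)
  finally show ?thesis by simp
qed

lemma eigen_word:
  fixes l :: real
  assumes u: "u \<in> W" "nrm u = 1" and l: "T u = section_scale (of_real l) u" and w: "set w \<subseteq> gens p\<^sub>0"
  shows "nrm (op w u - u) \<le> length w * sqrt (2 * (real p\<^sub>0 + 1 - l))"
  using w
proof (induction w)
  case Nil
  have "op [] u - u = 0" using u by (simp only: op_Nil diff_self)
  then show ?case by (simp only: nrm_0) simp
next
  case (Cons a w)
  then have a: "a \<in> gens p\<^sub>0" and w: "set w \<subseteq> gens p\<^sub>0" by auto
  interpret O: Vector_Spaces.linear section_scale section_scale "op [a]" by (rule lin_op)
  have opa: "op [a] u \<in> W" "op w u \<in> W" using a w u by (auto intro: op_in_W)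
  have "(nrm (op [a] u - u))\<^sup>2 = 2 - 2 * Re (ips (op [a] u) u)"
    using nrm_diff_sq[OF opa(1) u(1)] a u by (simp add: nrm_op)
  also have "\<dots> \<le> 2 * (real p\<^sub>0 + 1 - l)" using eigen_gen[OF u l a] by simp
  finally have 1: "nrm (op [a] u - u) \<le> sqrt (2 * (real p\<^sub>0 + 1 - l))" by (rule real_le_rsqrt)
  have "op (a # w) u - u = op [a] (op w u - u) + (op [a] u - u)"
    using op_append[of "[a]" w u] a w by (simp add: O.diff)
  then have "nrm (op (a # w) u - u) \<le> nrm (op [a] (op w u - u)) + nrm (op [a] u - u)"
    by (simp only: nrm_triangle)
  also have "nrm (op [a] (op w u - u)) = nrm (op w u - u)"
    using a by (intro nrm_op W_diff opa u) simp
  finally have "nrm (op (a # w) u - u) \<le> nrm (op w u - u) + nrm (op [a] u - u)" .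
  moreover have "length (a # w) * sqrt (2 * (real p\<^sub>0 + 1 - l))
      = length w * sqrt (2 * (real p\<^sub>0 + 1 - l)) + sqrt (2 * (real p\<^sub>0 + 1 - l))"
    by (simp add: distrib_right)
  ultimately show ?case using 1 Cons.IH[OF w] by linarith
qed

lemma gap_scalar:
  fixes l :: real
  assumes p: "p = 0" and u: "u \<in> W" "nrm u = 1"
    and l: "T u = section_scale (of_real l) u" and ne: "l \<noteq> real p\<^sub>0 + 1"
  shows "1 \<le> (real p\<^sub>1 ^ 4)\<^sup>2 * (2 * (real p\<^sub>0 + 1 - l))"
proof -
  let ?\<tau> = "sqrt (2 * (real p\<^sub>0 + 1 - l))"
  have eps: "real p\<^sub>0 + 1 - l \<ge> 0" using eigenvalue_le[OF u l] by simp
  have const: "qact q s = s" if s: "s \<in> Sym_pow p" for q s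
  proof -
    obtain c where "\<forall>z. s z = (\<Sum>k\<le>p. c k * (z$1) ^ k * (z$2) ^ (p - k))"
      using s unfolding Sym_pow_def by blast
    then show ?thesis by (simp add: p qact_def fun_eq_iff)
  qed
  have V1: "V g q v = V g cone v" if "g \<in> carrier X" "v \<in> W" for g q v
    using that by (auto simp: V_def fun_eq_iff W_iff const)
  define S where "S k = {gen_PGL p\<^sub>1 b (qprod w) | w. set w \<subseteq> gens p\<^sub>0 \<and> length w \<le> k}" for k
  have SX: "S k \<subseteq> carrier X" for k using class_word by (auto simp: S_def)
  have "S k \<subseteq> S (Suc k)" for k by (force simp: S_def)
  moreover have "gen_PGL p\<^sub>1 b (qprod []) \<in> S k" for k unfolding S_def by (intro CollectI exI[of _ "[]"]) simp
  ultimately obtain k where k: "k \<le> card (carrier X)" "S (Suc k) = S k"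
    using increasing_sets_stabilize[OF finite_X, of S] SX by blast
  have Sne: "S k \<noteq> {}" using \<open>\<And>k. gen_PGL p\<^sub>1 b (qprod []) \<in> S k\<close> by blast
  have finS: "finite (S k)" using finite_subset[OF SX finite_X] .
  define P where "P = (\<Sum>g\<in>S k. V g cone u)"
  have VW: "V g cone u \<in> W" if "g \<in> S k" for g using that SX u by (intro V_in_W) auto
  have PW: "P \<in> W" unfolding P_def by (rule section_fun.subspace_sum[OF W_subspace]) (rule VW)
  have inv: "op [a] P = P" if a: "a \<in> gens p\<^sub>0" for a
  proof -
    interpret O: Vector_Spaces.linear section_scale section_scale "op [a]" by (rule lin_op)
    let ?g = "gen_PGL p\<^sub>1 b (qprod [a])"
    have g: "?g \<in> carrier X" using class_word[of "[a]"] a by simp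
    have "op [a] P = (\<Sum>h\<in>S k. V (?g \<otimes>\<^bsub>X\<^esub> h) cone u)"
      unfolding P_def O.sum
    proof (intro sum.cong refl)
      fix h assume h: "h \<in> S k"
      then have hX: "h \<in> carrier X" using SX by blast
      show "op [a] (V h cone u) = V (?g \<otimes>\<^bsub>X\<^esub> h) cone u"
        unfolding op_def V_mult[OF g hX] by (rule V1) (use g hX u in auto)
    qed
    also have "\<dots> = P"
      unfolding P_def
    proof (rule sum.reindex_bij_betw)
      have inj: "inj_on (\<lambda>h. ?g \<otimes>\<^bsub>X\<^esub> h) (S k)"
        using SX g by (auto simp: inj_on_def subset_iff)
      have "?g \<otimes>\<^bsub>X\<^esub> h \<in> S k" if h: "h \<in> S k" for h
      proof -
        obtain w where w: "h = gen_PGL p\<^sub>1 b (qprod w)" "set w \<subseteq> gens p\<^sub>0" "length w \<le> k"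
          using h by (auto simp: S_def)
        have "?g \<otimes>\<^bsub>X\<^esub> h = gen_PGL p\<^sub>1 b (qprod (a # w))"
          using gen_PGL_mult[of "qprod [a]" 1 "qprod w" "length w"] a w(2)
          by (simp add: w(1) qnorm_qprod gens_norm)
        then have "?g \<otimes>\<^bsub>X\<^esub> h \<in> S (Suc k)"
          unfolding S_def using a w by (intro CollectI exI[of _ "a # w"]) auto
        then show ?thesis by (simp add: k(2))
      qed
      then show "bij_betw (\<lambda>h. ?g \<otimes>\<^bsub>X\<^esub> h) (S k) (S k)"
        using inj endo_inj_surj[OF finS _ inj] by (auto simp: bij_betw_def)
    qed
    finally show ?thesis .
  qed
  have "T P = section_scale (of_real (real p\<^sub>0 + 1)) P"
    using inv card_gens_p0 by (simp add: laplacian_eq fun_eq_iff sum_fun_apply section_scale_def)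
  then have "of_real (real p\<^sub>0 + 1) * ips P u = of_real l * ips P u"
    using T_self_adjoint[OF PW u(1)] l by (simp add: ip_scale ip_scale_right)
  then have "(complex_of_real (real p\<^sub>0 + 1) - of_real l) * ips P u = 0" by (simp add: algebra_simps)
  moreover have "complex_of_real (real p\<^sub>0 + 1) - of_real l \<noteq> 0"
    using ne by (metis eq_iff_diff_eq_0 of_real_eq_iff)
  ultimately have P0: "ips P u = 0" by simp
  have "k * ?\<tau> \<ge> 1"
  proof (rule ccontr)
    assume "\<not> k * ?\<tau> \<ge> 1"
    then have kt: "k * ?\<tau> < 1" by simp
    have "Re (ips (V g cone u) u) > 0" if g: "g \<in> S k" for g
    proof -
      obtain w where w: "g = gen_PGL p\<^sub>1 b (qprod w)" "set w \<subseteq> gens p\<^sub>0" "length w \<le> k"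
        using g by (auto simp: S_def)
      have gX: "g \<in> carrier X" using g SX by blast
      have "op w u = V g cone u" unfolding op_def w(1)[symmetric] by (rule V1[OF gX u(1)])
      moreover have "nrm (op w u - u) < 1"
      proof -
        have "length w * ?\<tau> \<le> k * ?\<tau>" using w(3) eps by (intro mult_right_mono) auto
        then show ?thesis using eigen_word[OF u l w(2)] kt by linarith
      qed
      moreover have "(nrm (op w u - u))\<^sup>2 = 2 - 2 * Re (ips (op w u) u)"
        using nrm_diff_sq[OF op_in_W[OF w(2) u(1)] u(1)] u w(2) by (simp add: nrm_op)
      moreover have "(nrm (op w u - u))\<^sup>2 < 1"
        using abs_square_less_1[of "nrm (op w u - u)"] calculation(2) by simp
      ultimately show ?thesis by simp
    qed
    then have "(\<Sum>g\<in>S k. Re (ips (V g cone u) u)) > 0" using finS Sne by (intro sum_pos) auto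
    then have "Re (ips P u) > 0" by (simp add: P_def ip_sum_left)
    then show False using P0 by simp
  qed
  moreover have "real k \<le> real p\<^sub>1 ^ 4" using k(1) card_X by (metis le_trans of_nat_le_iff of_nat_power)
  ultimately have "1 \<le> real p\<^sub>1 ^ 4 * ?\<tau>"
    using eps mult_right_mono[of "real k" "real p\<^sub>1 ^ 4" ?\<tau>] by simp
  then have "1\<^sup>2 \<le> (real p\<^sub>1 ^ 4 * ?\<tau>)\<^sup>2" by (intro power_mono) auto
  then show ?thesis using eps by (simp add: power_mult_distrib)
qed

end

lemma gens_ne_cnj:
  assumes "prime p" "odd p" "a \<in> gens p" shows "a \<noteq> qcnj a"
proof
  assume eq: "a = qcnj a"
  have "\<not> qreal (qprod [a])"
    by (rule reduced_not_real[OF assms(1,2)]) (use assms in \<open>auto simp: reduced_def\<close>)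
  then show False using eq by (cases a) (auto simp: qcnj_def qreal_def)
qed

lemma two_letter_words_reduced:
  assumes p: "prime p" "odd p" and a: "a \<in> gens p" and c: "c \<in> gens p" and ne: "c \<noteq> qcnj a"
    and w: "set w \<subseteq> {a, c}"
  shows "reduced w"
proof -
  have "a \<noteq> qcnj c" using ne by auto
  then have *: "y \<noteq> qcnj x" if "x \<in> {a, c}" "y \<in> {a, c}" for x y
    using that ne gens_ne_cnj[OF p a] gens_ne_cnj[OF p c] by auto
  show ?thesis
    using w unfolding reduced_def by (induction w rule: induct_list012) (use * in auto)
qed

lemma quat_pigeonhole:
  fixes r :: real
  assumes A: "finite A" and r: "r > 0" and N: "N > 0" and m: "m > 0"
    and norm: "\<And>q. q \<in> A \<Longrightarrow> qnorm q = r\<^sup>2" and card: "(2 * N + 1) ^ 4 * m ^ 4 < card A"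
  shows "\<exists>q\<in>A. \<exists>s\<in>A. q \<noteq> s \<and> qdvd (int m) (s - q) \<and> qnorm (s - q) \<le> 4 * r\<^sup>2 / (real N)\<^sup>2"
proof -
  define f where "f x = (\<lfloor>real_of_int x * N / r\<rfloor>, x mod int m)" for x
  define F where "F = (\<lambda>(x0, x1, x2, x3). (f x0, f x1, f x2, f x3))"
  let ?I = "{- int N..int N} \<times> {0..<int m}"
  have fI: "f x \<in> ?I" if "(real_of_int x)\<^sup>2 \<le> r\<^sup>2" for x
  proof -
    have "\<bar>real_of_int x\<bar> \<le> r" using that r by (simp add: abs_le_square_iff[symmetric])
    then have "\<bar>real_of_int x\<bar> * N \<le> r * N" by (intro mult_right_mono) auto
    then have "\<bar>real_of_int x * N / r\<bar> \<le> N" using r by (simp add: abs_mult field_simps)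
    then have "- real N \<le> real_of_int x * N / r" "real_of_int x * N / r < real N + 1" by linarith+
    then have "- int N \<le> \<lfloor>real_of_int x * N / r\<rfloor> \<and> \<lfloor>real_of_int x * N / r\<rfloor> \<le> int N"
      by (simp add: le_floor_iff floor_le_iff)
    then show ?thesis using m by (simp add: f_def)
  qed
  have "F ` A \<subseteq> ?I \<times> ?I \<times> ?I \<times> ?I"
  proof
    fix y assume "y \<in> F ` A"
    then obtain q where q: "q \<in> A" "y = F q" by blast
    obtain x0 x1 x2 x3 where x: "q = (x0, x1, x2, x3)" by (cases q)
    have "(real_of_int x0)\<^sup>2 + (real_of_int x1)\<^sup>2 + (real_of_int x2)\<^sup>2 + (real_of_int x3)\<^sup>2 = r\<^sup>2"
      using norm[OF q(1)] by (simp add: x qnorm_def)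
    then have "(real_of_int x0)\<^sup>2 \<le> r\<^sup>2" "(real_of_int x1)\<^sup>2 \<le> r\<^sup>2" "(real_of_int x2)\<^sup>2 \<le> r\<^sup>2"
      "(real_of_int x3)\<^sup>2 \<le> r\<^sup>2"
      using zero_le_power2[of "real_of_int x0"] zero_le_power2[of "real_of_int x1"]
        zero_le_power2[of "real_of_int x2"] zero_le_power2[of "real_of_int x3"] by linarith+
    from this[THEN fI] show "y \<in> ?I \<times> ?I \<times> ?I \<times> ?I" by (simp add: q(2) x F_def)
  qed
  then have "card (F ` A) \<le> card (?I \<times> ?I \<times> ?I \<times> ?I)" by (intro card_mono) auto
  also have "\<dots> = (2 * N + 1) ^ 4 * m ^ 4"
  proof -
    have "card {- int N..int N} = 2 * N + 1" by (simp add: nat_eq_iff)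
    then have "card ?I = (2 * N + 1) * m" by (simp only: card_cartesian_product) simp
    then have "card (?I \<times> ?I \<times> ?I \<times> ?I) = ((2 * N + 1) * m) ^ 4"
      by (simp only: card_cartesian_product power4_eq_xxxx mult.assoc)
    then show ?thesis by (simp only: power_mult_distrib)
  qed
  finally have "\<not> inj_on F A" using card pigeonhole[of F A] by linarith
  then obtain q s where qs: "q \<in> A" "s \<in> A" "q \<noteq> s" "F q = F s"
    unfolding inj_on_def by blast
  obtain x0 x1 x2 x3 where x: "q = (x0, x1, x2, x3)" by (cases q)
  obtain y0 y1 y2 y3 where y: "s = (y0, y1, y2, y3)" by (cases s)
  have eq: "f x0 = f y0" "f x1 = f y1" "f x2 = f y2" "f x3 = f y3"
    using qs(4) by (simp_all add: x y F_def)
  have d: "int m dvd v - u" if "f u = f v" for u v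
    using that by (simp add: f_def mod_eq_dvd_iff dvd_diff_commute)
  have b: "(real_of_int (v - u))\<^sup>2 \<le> r\<^sup>2 / (real N)\<^sup>2" if "f u = f v" for u v
  proof -
    have "\<lfloor>real_of_int u * N / r\<rfloor> = \<lfloor>real_of_int v * N / r\<rfloor>" using that by (simp add: f_def)
    then have "\<bar>real_of_int v * N / r - real_of_int u * N / r\<bar> \<le> 1"
      by linarith
    moreover have "real_of_int v * N / r - real_of_int u * N / r = real_of_int (v - u) / (r / N)"
      using r N by (simp add: field_simps)
    ultimately have "\<bar>real_of_int (v - u)\<bar> / (r / N) \<le> 1" using r by (simp only: abs_divide)
    moreover have "r / N > 0" using r N by simp
    ultimately have "\<bar>real_of_int (v - u)\<bar> \<le> r / N" by (simp only: divide_le_eq_1_pos)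
    then have "\<bar>real_of_int (v - u)\<bar>\<^sup>2 \<le> (r / N)\<^sup>2" by (intro power_mono) auto
    then show ?thesis by (simp add: power_divide)
  qed
  have "qdvd (int m) (s - q)" using eq[THEN d] by (simp add: x y qdvd_iff)
  moreover have "qnorm (s - q) \<le> 4 * r\<^sup>2 / (real N)\<^sup>2"
  proof -
    have "real_of_int (qnorm (s - q)) = (real_of_int (y0 - x0))\<^sup>2 + (real_of_int (y1 - x1))\<^sup>2
        + (real_of_int (y2 - x2))\<^sup>2 + (real_of_int (y3 - x3))\<^sup>2"
      by (simp add: x y qnorm_def)
    then show ?thesis using eq[THEN b] by linarith
  qed
  ultimately show ?thesis using qs by blast
qed

context twisted_mod4
begin

interpretation X: group X by (rule group_X)

lemma two_gens: obtains a c where "a \<in> gens p\<^sub>0" "c \<in> gens p\<^sub>0" "c \<noteq> a" "c \<noteq> qcnj a"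
proof -
  have "p\<^sub>0 \<ge> 2" using prime_ge_2_nat[OF prime_p0] .
  then have c3: "card (gens p\<^sub>0) > 2" by (simp add: card_gens_p0)
  then have "gens p\<^sub>0 \<noteq> {}" by auto
  then obtain a where a: "a \<in> gens p\<^sub>0" by blast
  have "\<not> gens p\<^sub>0 \<subseteq> {a, qcnj a}"
  proof
    assume "gens p\<^sub>0 \<subseteq> {a, qcnj a}"
    then have "card (gens p\<^sub>0) \<le> card {a, qcnj a}" by (intro card_mono) auto
    also have "\<dots> \<le> 2" by (simp add: card_insert_if)
    finally show False using c3 by simp
  qed
  then show ?thesis using a that by blast
qed

text \<open>Two words of the same length with nearly equal products, congruent modulo \<open>p\<^sub>1\<close>, give a
  word close to the identity that acts trivially on the vertices.\<close>

lemma near_identity_word: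
  assumes N: "N > 0" and n: "(2 * N + 1) ^ 4 * p\<^sub>1 ^ 4 < 2 ^ n"
    and a: "a \<in> gens p\<^sub>0" and c: "c \<in> gens p\<^sub>0" and ac: "c \<noteq> a" "c \<noteq> qcnj a"
  obtains e where "set e \<subseteq> gens p\<^sub>0" "length e = 2 * n" "\<not> qreal (qprod e)"
    "gen_PGL p\<^sub>1 b (qprod e) = \<one>\<^bsub>X\<^esub>"
    "Re (fst (cq (sqrt p\<^sub>0 ^ (2 * n)) (qprod e))) \<ge> 1 - 2 / (real N)\<^sup>2"
proof -
  define L where "L = {w. set w \<subseteq> {a, c} \<and> length w = n}"
  have cardL: "card L = 2 ^ n" unfolding L_def using ac(1) by (subst card_lists_length_eq) (auto simp: numeral_2_eq_2)
  have finL: "finite L" unfolding L_def by (rule finite_lists_length_eq) simp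
  have Lg: "set w \<subseteq> gens p\<^sub>0" "length w = n" "reduced w" if "w \<in> L" for w
    using that a c two_letter_words_reduced[OF prime_p0 odd_p0 a c ac(2)] by (auto simp: L_def)
  have nr: "\<not> qreal (qmul (qcnj (qprod u)) (qprod w))" if "u \<in> L" "w \<in> L" "u \<noteq> w" for u w
    using reduced_quotient_not_real[OF prime_p0 odd_p0] Lg[OF that(1)] Lg[OF that(2)] that(3) by simp
  have inj: "inj_on qprod L"
  proof (rule inj_onI, rule ccontr)
    fix u w assume uw: "u \<in> L" "w \<in> L" "qprod u = qprod w" "u \<noteq> w"
    have "qmul (qcnj (qprod u)) (qprod w) = (qnorm (qprod u), 0, 0, 0)"
      by (simp add: uw(3) qmul_cnj)
    then show False using nr[OF uw(1,2,4)] by (simp add: qreal_def)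
  qed
  define r where "r = sqrt p\<^sub>0 ^ n"
  have r: "r > 0" using p0_pos by (simp add: r_def)
  have r2: "r\<^sup>2 = real p\<^sub>0 ^ n" by (simp add: r_def real_sqrt_power[symmetric])
  have "\<exists>q\<in>qprod ` L. \<exists>s\<in>qprod ` L. q \<noteq> s \<and> qdvd (int p\<^sub>1) (s - q)
      \<and> qnorm (s - q) \<le> 4 * r\<^sup>2 / (real N)\<^sup>2"
  proof (rule quat_pigeonhole)
    show "finite (qprod ` L)" using finL by simp
    show "p\<^sub>1 > 0" using prime_gt_0_nat[OF prime_p1] .
    show "(2 * N + 1) ^ 4 * p\<^sub>1 ^ 4 < card (qprod ` L)" using n by (simp add: card_image[OF inj] cardL)
    fix q assume "q \<in> qprod ` L"
    then obtain w where "w \<in> L" "q = qprod w" by blast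
    then show "real_of_int (qnorm q) = r\<^sup>2" using qnorm_qprod[OF Lg(1)] Lg(2) by (simp add: r2)
  qed (use r N in auto)
  then obtain u w where uw: "u \<in> L" "w \<in> L" "qprod u \<noteq> qprod w"
    and d: "qdvd (int p\<^sub>1) (qprod w - qprod u)"
    and close: "qnorm (qprod w - qprod u) \<le> 4 * r\<^sup>2 / (real N)\<^sup>2" by blast
  have une: "u \<noteq> w" using uw(3) by auto
  define e where "e = rev (map qcnj u) @ w"
  have pe: "qprod e = qmul (qcnj (qprod u)) (qprod w)"
    by (simp add: e_def qprod_append qcnj_qprod)
  have eg: "set e \<subseteq> gens p\<^sub>0" using Lg[OF uw(1)] Lg[OF uw(2)] by (auto simp: e_def)
  have le: "length e = 2 * n" using Lg[OF uw(1)] Lg[OF uw(2)] by (simp add: e_def)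
  have nre: "\<not> qreal (qprod e)" unfolding pe by (rule nr[OF uw(1,2) une])
  have nu: "qnorm (qprod u) = int p\<^sub>0 ^ n" using qnorm_qprod[OF Lg(1)[OF uw(1)]] Lg(2)[OF uw(1)] by simp
  have cl: "gen_PGL p\<^sub>1 b (qprod e) = \<one>\<^bsub>X\<^esub>"
  proof -
    obtain e0 e1 e2 e3 where e: "qprod e = (e0, e1, e2, e3)" by (cases "qprod e")
    have "qprod e = qmul (qcnj (qprod u)) (qprod w - qprod u) + (int p\<^sub>0 ^ n, 0, 0, 0)"
    proof -
      have "qmul x (y - z) = qmul x y - qmul x z" for x y z
        by (cases x; cases y; cases z) (simp add: qmul_def algebra_simps)
      then show ?thesis by (simp add: pe qmul_cnj nu)
    qed
    moreover have "qdvd (int p\<^sub>1) (qmul (qcnj (qprod u)) (qprod w - qprod u))"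
      using d by (rule qdvd_mult)
    ultimately have "qdvd (int p\<^sub>1) (qprod e - (int p\<^sub>0 ^ n, 0, 0, 0))" by simp
    then have "int p\<^sub>1 dvd e1" "int p\<^sub>1 dvd e2" "int p\<^sub>1 dvd e3" by (simp_all add: e qdvd_iff)
    moreover have "qnorm (e0, e1, e2, e3) = int p\<^sub>0 ^ (2 * n)"
      using qnorm_qprod[OF eg] by (simp add: e le)
    ultimately show ?thesis unfolding e using gen_PGL_eq_one_iff by blast
  qed
  have re: "Re (fst (cq (sqrt p\<^sub>0 ^ (2 * n)) (qprod e))) \<ge> 1 - 2 / (real N)\<^sup>2"
  proof -
    let ?u = "cq r (qprod u)" and ?w = "cq r (qprod w)"
    have unit: "cnorm ?u = 1" "cnorm ?w = 1"
      using cnorm_word[OF Lg(1)[OF uw(1)]] cnorm_word[OF Lg(1)[OF uw(2)]] Lg(2) uw by (simp_all add: r_def)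
    have "cq (sqrt p\<^sub>0 ^ (2 * n)) (qprod e) = cmul (ccnj ?u) ?w"
    proof -
      have "sqrt p\<^sub>0 ^ (2 * n) = r * r" by (simp add: r_def mult_2 power_add)
      then show ?thesis using cq_mult[of r r "qcnj (qprod u)" "qprod w"] r by (simp add: cq_cnj pe)
    qed
    moreover have "cnorm (x - y) = cnorm x + cnorm y - 2 * Re (fst (cmul (ccnj y) x))" for x y
      by (cases x; cases y)
        (simp add: cquat_defs cmod_power2, simp add: power2_eq_square algebra_simps)
    moreover have "cnorm (?w - ?u) \<le> 4 / (real N)\<^sup>2"
      unfolding cnorm_diff_cq[OF less_imp_neq[OF r, symmetric]] using close r by (simp add: field_simps)
    ultimately show ?thesis using unit by simp
  qed
  show ?thesis by (rule that[OF eg le nre cl re])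
qed

lemma weight_projection:
  assumes v: "v \<in> W" and nv: "nrm v = 1" and p: "p > 0" and g: "g \<in> carrier X" and q: "cnorm (x, y) = 1"
    and D: "nrm (V \<one>\<^bsub>X\<^esub> (cis t, 0) v - v) \<le> \<delta>" and t: "0 \<le> t" "real p * t \<le> pi" and st: "sin t \<noteq> 0"
  shows "Re (ips (V g (x, y) v) v) \<le> 1 - (cmod x)\<^sup>2 * (cmod y)\<^sup>2 + 2 * (\<delta> / \<bar>sin t\<bar>)"
proof -
  let ?S = "V g (x, y)"
  interpret S: Vector_Spaces.linear section_scale section_scale ?S by (rule lin_V)
  define l where "l = p div 2"
  define f where "f z = (if even p then sip p (v z) (hmono p l) else 0)" for z
  define v0 where "v0 = (\<lambda>z. if z \<in> carrier X then (\<lambda>y. f z * hmono p l y) else 0)"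
  have lp: "l \<le> p" by (simp add: l_def)
  have v0W: "v0 \<in> W" unfolding W_iff v0_def using Sym_pow_scale[OF hmono_Sym_pow[OF lp]] by simp
  have ip0: "ips v0 (sec z k) = (if 2 * k = p then ips v (sec z k) else 0)" if "z \<in> carrier X" "k \<le> p" for z k
  proof -
    have "ips v0 (sec z k) = f z * of_bool (l = k)"
      unfolding ips_sec[OF that(1)] v0_def using that lp by (simp add: sip_scale sip_mono)
    moreover have "f z = sip p (v z) (hmono p l) \<and> (2 * k = p \<longleftrightarrow> l = k)" if "even p"
      using that by (auto simp: f_def l_def)
    moreover have "f z = 0 \<and> 2 * k \<noteq> p" if "odd p"
      using that by (auto simp: f_def)
    ultimately show ?thesis unfolding ips_sec[OF that(1)] by (cases "even p") auto
  qed
  have sqn: "(nrm u)\<^sup>2 = (\<Sum>z\<in>carrier X. \<Sum>k\<le>p. (cmod (ips u (sec z k)))\<^sup>2)" for u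
    unfolding nrm_def L2_set_def by (simp add: sum_nonneg sum_basis)
  have "(\<bar>sin t\<bar> * nrm (v - v0))\<^sup>2 \<le> (nrm (V \<one>\<^bsub>X\<^esub> (cis t, 0) v - v))\<^sup>2"
    unfolding power_mult_distrib sqn sum_distrib_left
  proof (intro sum_mono)
    fix z k assume z: "z \<in> carrier X" and k: "k \<in> {..p}"
    let ?c = "cis ((real p - 2 * real k) * t)"
    have secW: "sec z k \<in> W" using z k by (auto simp: W_iff sec_def hmono_Sym_pow Sym_pow_0)
    have "ips (V \<one>\<^bsub>X\<^esub> (cis t, 0) v) (sec z k)
        = ips v (V (inv\<^bsub>X\<^esub> \<one>\<^bsub>X\<^esub>) (ccnj (cis t, 0)) (sec z k))"
      by (rule V_adjoint) (use v secW in auto)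
    also have "V (inv\<^bsub>X\<^esub> \<one>\<^bsub>X\<^esub>) (ccnj (cis t, 0)) (sec z k) = section_scale (cnj ?c) (sec z k)"
      using V_diag_sec[of z k "- t"] z k by (simp add: ccnj_def cis_cnj)
    finally have ipV: "ips (V \<one>\<^bsub>X\<^esub> (cis t, 0) v) (sec z k) = ?c * ips v (sec z k)"
      by (simp add: ip_scale_right)
    have R: "(cmod (ips (V \<one>\<^bsub>X\<^esub> (cis t, 0) v - v) (sec z k)))\<^sup>2
        = (cmod (?c - 1))\<^sup>2 * (cmod (ips v (sec z k)))\<^sup>2"
    proof -
      have "ips (V \<one>\<^bsub>X\<^esub> (cis t, 0) v - v) (sec z k) = (?c - 1) * ips v (sec z k)"
        by (simp only: ip_diff ipV left_diff_distrib mult_1)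
      then show ?thesis by (simp only: norm_mult power_mult_distrib)
    qed
    show "\<bar>sin t\<bar>\<^sup>2 * (cmod (ips (v - v0) (sec z k)))\<^sup>2
        \<le> (cmod (ips (V \<one>\<^bsub>X\<^esub> (cis t, 0) v - v) (sec z k)))\<^sup>2"
    proof (cases "2 * k = p")
      case True
      then have "ips (v - v0) (sec z k) = 0" using z k by (simp add: ip_diff ip0)
      then show ?thesis by simp
    next
      case False
      then have "ips (v - v0) (sec z k) = ips v (sec z k)" using z k by (simp add: ip_diff ip0)
      then show ?thesis
        unfolding R using weight_separation[OF t] False k by (simp add: mult_right_mono)
    qed
  qed
  then have "\<bar>sin t\<bar> * nrm (v - v0) \<le> nrm (V \<one>\<^bsub>X\<^esub> (cis t, 0) v - v)"
    by (rule power2_le_imp_le) simp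
  then have sig: "nrm (v - v0) \<le> \<delta> / \<bar>sin t\<bar>" using D st by (simp add: field_simps)
  have "(nrm v0)\<^sup>2 \<le> (nrm v)\<^sup>2"
    unfolding sqn by (intro sum_mono) (simp add: ip0)
  then have n0: "(nrm v0)\<^sup>2 \<le> 1" "nrm v0 \<le> 1"
    using nv abs_square_le_1[of "nrm v0"] by simp_all
  have n: "(cmod x)\<^sup>2 + (cmod y)\<^sup>2 = 1" using q by (simp add: cnorm_def)
  have xy1: "(cmod x)\<^sup>2 * (cmod y)\<^sup>2 \<le> 1"
    using n zero_le_power2[of "cmod x"] zero_le_power2[of "cmod y"] by (intro mult_le_one) linarith+
  have main: "cmod (ips (?S v0) v0) \<le> 1 - (cmod x)\<^sup>2 * (cmod y)\<^sup>2"
  proof (cases "even p")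
    case False
    then have "v0 = 0" by (simp add: v0_def f_def fun_eq_iff)
    then show ?thesis using xy1 by (simp only: ip_0_right norm_zero)
  next
    case True
    then have pl: "p = 2 * l" by (simp add: l_def)
    define \<kappa> where "\<kappa> = sip p (qact (x, y) (hmono p l)) (hmono p l)"
    have \<kappa>: "cmod \<kappa> \<le> 1 - (cmod x)\<^sup>2 * (cmod y)\<^sup>2"
      unfolding \<kappa>_def using weight_zero_coefficient[OF q, of l] p pl by simp
    have f2: "(\<Sum>z\<in>carrier X. (cmod (f z))\<^sup>2) = (nrm v0)\<^sup>2"
    proof -
      have "ips v0 v0 = (\<Sum>z\<in>carrier X. of_real ((cmod (f z))\<^sup>2))"
        unfolding ips_def
      proof (intro sum.cong refl)
        fix z assume "z \<in> carrier X"
        then have "sip p (v0 z) (v0 z) = f z * sip p (hmono p l) (\<lambda>y. f z * hmono p l y)"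
          by (simp add: v0_def sip_scale)
        also have "sip p (hmono p l) (\<lambda>y. f z * hmono p l y) = cnj (f z * sip p (hmono p l) (hmono p l))"
          by (subst sip_cnj) (simp only: sip_scale)
        finally show "sip p (v0 z) (v0 z) = of_real ((cmod (f z))\<^sup>2)"
          using lp complex_norm_square[of "f z"] by (simp add: sip_mono)
      qed
      then have "complex_of_real ((nrm v0)\<^sup>2) = of_real (\<Sum>z\<in>carrier X. (cmod (f z))\<^sup>2)"
        using ip_self[of v0] v0W by (simp add: span_basis)
      then show ?thesis by (simp only: of_real_eq_iff)
    qed
    let ?h = "\<lambda>z. inv\<^bsub>X\<^esub> g \<otimes>\<^bsub>X\<^esub> z"
    have bij: "bij_betw ?h (carrier X) (carrier X)"
      using g by (intro bij_betw_byWitness[where f' = "\<lambda>z. g \<otimes>\<^bsub>X\<^esub> z"]) (auto simp: X.m_assoc[symmetric])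
    have "ips (?S v0) v0 = (\<Sum>z\<in>carrier X. f (?h z) * cnj (f z) * \<kappa>)"
      unfolding ips_def
    proof (intro sum.cong refl)
      fix z assume z: "z \<in> carrier X"
      have "sip p (?S v0 z) (v0 z) = f (?h z) * sip p (qact (x, y) (hmono p l)) (\<lambda>y. f z * hmono p l y)"
        using z g by (simp add: V_def v0_def qact_def sip_scale)
      also have "sip p (qact (x, y) (hmono p l)) (\<lambda>y. f z * hmono p l y)
          = cnj (f z * sip p (hmono p l) (qact (x, y) (hmono p l)))"
        by (subst sip_cnj) (simp only: sip_scale)
      also have "\<dots> = cnj (f z) * \<kappa>" unfolding \<kappa>_def complex_cnj_mult by (subst (2) sip_cnj) simp
      finally show "sip p (?S v0 z) (v0 z) = f (?h z) * cnj (f z) * \<kappa>" by simp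
    qed
    then have "cmod (ips (?S v0) v0) \<le> (\<Sum>z\<in>carrier X. cmod (f (?h z)) * cmod (f z) * cmod \<kappa>)"
      by (simp only:) (rule order_trans[OF norm_sum], simp add: norm_mult)
    also have "\<dots> \<le> (\<Sum>z\<in>carrier X. ((cmod (f (?h z)))\<^sup>2 + (cmod (f z))\<^sup>2) / 2 * cmod \<kappa>)"
    proof (intro sum_mono mult_right_mono)
      fix z
      show "cmod (f (?h z)) * cmod (f z) \<le> ((cmod (f (?h z)))\<^sup>2 + (cmod (f z))\<^sup>2) / 2"
        using zero_le_power2[of "cmod (f (?h z)) - cmod (f z)"]
        by (simp add: power2_eq_square algebra_simps)
    qed simp
    also have "\<dots> = ((\<Sum>z\<in>carrier X. (cmod (f (?h z)))\<^sup>2) + (\<Sum>z\<in>carrier X. (cmod (f z))\<^sup>2)) / 2 * cmod \<kappa>"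
      by (simp only: sum_distrib_right sum_divide_distrib sum.distrib[symmetric])
    also have "(\<Sum>z\<in>carrier X. (cmod (f (?h z)))\<^sup>2) = (\<Sum>z\<in>carrier X. (cmod (f z))\<^sup>2)"
      by (rule sum.reindex_bij_betw[OF bij])
    also have "((\<Sum>z\<in>carrier X. (cmod (f z))\<^sup>2) + (\<Sum>z\<in>carrier X. (cmod (f z))\<^sup>2)) / 2 * cmod \<kappa> = (nrm v0)\<^sup>2 * cmod \<kappa>"
      by (simp add: f2)
    also have "\<dots> \<le> 1 * cmod \<kappa>" using n0 by (intro mult_right_mono) auto
    finally show ?thesis using \<kappa> by simp
  qed
  have dW: "v - v0 \<in> W" by (rule W_diff[OF v v0W])
  have "ips (?S v) v = ips (?S v0) v0 + (ips (?S (v - v0)) v + ips (?S v0) (v - v0))"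
    unfolding S.diff ip_diff ip_diff_right by simp
  then have "Re (ips (?S v) v) \<le> cmod (ips (?S v0) v0 + (ips (?S (v - v0)) v + ips (?S v0) (v - v0)))"
    by (simp only: complex_Re_le_cmod)
  then have "Re (ips (?S v) v) \<le> cmod (ips (?S v0) v0) + (cmod (ips (?S (v - v0)) v) + cmod (ips (?S v0) (v - v0)))"
    using norm_triangle_ineq[of "ips (?S v0) v0" "ips (?S (v - v0)) v + ips (?S v0) (v - v0)"]
      norm_triangle_ineq[of "ips (?S (v - v0)) v" "ips (?S v0) (v - v0)"] by linarith
  also have "cmod (ips (?S (v - v0)) v) \<le> nrm (v - v0) * 1"
    using ip_bound[of "?S (v - v0)" v] V_in_W[OF g dW] nrm_V[OF g dW q] nv by (simp add: span_basis)
  also have "cmod (ips (?S v0) (v - v0)) \<le> 1 * nrm (v - v0)"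
  proof -
    have "cmod (ips (?S v0) (v - v0)) \<le> nrm v0 * nrm (v - v0)"
      using ip_bound[of "?S v0" "v - v0"] V_in_W[OF g v0W] nrm_V[OF g v0W q] by (simp add: span_basis)
    also have "\<dots> \<le> 1 * nrm (v - v0)" using n0 by (intro mult_right_mono) auto
    finally show ?thesis .
  qed
  finally show ?thesis using main sig by linarith
qed

end

context twisted_mod4
begin

interpretation X: group X by (rule group_X)

lemma noncommuting_gen:
  assumes "\<not> qreal e"
    and a: "a \<in> gens p\<^sub>0" and c: "c \<in> gens p\<^sub>0" and ac: "c \<noteq> a" "c \<noteq> qcnj a"
  obtains g where "g \<in> gens p\<^sub>0" "qmul g e \<noteq> qmul e g"
proof (cases "qmul a e = qmul e a \<and> qmul c e = qmul e c")
  case True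
  have ca: "qmul a c = qmul c a"
    by (rule centralizer_commutative[OF assms(1) conjunct1[OF True] conjunct2[OF True]])
  have eq: "qprod [a, c] = qprod [c, a]" unfolding qprod_simps qmul_one by (rule ca)
  have "reduced [a, c]" "reduced [c, a]"
    by (rule two_letter_words_reduced[OF prime_p0 odd_p0 a c ac(2)], simp)+
  then have "\<not> qreal (qmul (qcnj (qprod [a, c])) (qprod [c, a]))"
    by (intro reduced_quotient_not_real[OF prime_p0 odd_p0]) (use a c ac(1) in simp_all)
  then have False unfolding eq qmul_cnj by (simp add: qreal_def)
  then show ?thesis ..
next
  case False
  then consider "qmul a e \<noteq> qmul e a" | "qmul c e \<noteq> qmul e c" by blast
  then show ?thesis by cases (rule that[OF a], assumption, rule that[OF c], assumption)
qed

theorem gap_twisted: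
  fixes l :: real
  assumes p: "p > 0" and u: "u \<in> W" "nrm u = 1"
    and l: "T u = section_scale (of_real l) u"
    and n: "(2 * p + 1) ^ 4 * p\<^sub>1 ^ 4 < 2 ^ n"
  shows "1 \<le> 784 * (real n)\<^sup>2 * real p\<^sub>0 ^ (6 * n + 4) * (real p\<^sub>0 + 1 - l)"
proof -
  define \<epsilon> where "\<epsilon> = real p\<^sub>0 + 1 - l"
  define Q where "Q = real p\<^sub>0 ^ n"
  have eps: "\<epsilon> \<ge> 0" using eigenvalue_le[OF u l] by (simp add: \<epsilon>_def)
  have P1: "real p\<^sub>0 \<ge> 1" using p0_pos by simp
  have Q1: "Q \<ge> 1" using P1 by (simp add: Q_def)
  have n1: "n \<ge> 1" using n prime_gt_0_nat[OF prime_p1] by (cases n) auto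
  obtain a c where a: "a \<in> gens p\<^sub>0" and c: "c \<in> gens p\<^sub>0" and ac: "c \<noteq> a" "c \<noteq> qcnj a"
    by (rule two_gens)
  obtain e where eg: "set e \<subseteq> gens p\<^sub>0" and le: "length e = 2 * n" and nre: "\<not> qreal (qprod e)"
    and cl: "gen_PGL p\<^sub>1 b (qprod e) = \<one>\<^bsub>X\<^esub>"
    and re: "Re (fst (cq (sqrt p\<^sub>0 ^ (2 * n)) (qprod e))) \<ge> 1 - 2 / (real p)\<^sup>2"
    by (rule near_identity_word[OF p n a c ac])
  obtain e0 e1 e2 e3 where ee: "qprod e = (e0, e1, e2, e3)" by (cases "qprod e")
  obtain g where g: "g \<in> gens p\<^sub>0" and gcomm: "qmul g (qprod e) \<noteq> qmul (qprod e) g"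
    by (rule noncommuting_gen[OF nre a c ac])
  have sQ: "sqrt p\<^sub>0 ^ (2 * n) = Q" by (simp add: Q_def power_mult)
  define k where "k = cq Q (qprod e)"
  have k1: "cnorm k = 1" using cnorm_word[OF eg] by (simp add: k_def le sQ)
  obtain h t where h: "cnorm h = 1" and kh: "k = cmul (cmul h (cis t, 0)) (ccnj h)"
    and t: "0 \<le> t" "t \<le> pi" by (rule unit_diagonalize_pos[OF k1])
  have cost: "cos t = Re (fst k)" using Re_conjugate[OF h, of "(cis t, 0)"] by (simp add: kh)
  have pt: "real p * t \<le> pi" using re angle_bound[OF t p] by (simp add: cost k_def sQ)
  have sin_ge: "1 / Q \<le> \<bar>sin t\<bar>"
  proof -
    have tot: "real_of_int e0 ^ 2 + (real_of_int e1 ^ 2 + real_of_int e2 ^ 2 + real_of_int e3 ^ 2) = Q\<^sup>2"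
      using arg_cong[OF qnorm_qprod[OF eg], of real_of_int]
      by (simp add: ee qnorm_def le Q_def power_mult[symmetric] mult.commute)
    have "e1 \<noteq> 0 \<or> e2 \<noteq> 0 \<or> e3 \<noteq> 0" using nre by (auto simp: ee qreal_def)
    then have "1 \<le> e1\<^sup>2 + e2\<^sup>2 + e3\<^sup>2"
      using qnorm_pos[of "(0, e1, e2, e3)"] by (simp add: qnorm_def zero_prod_def)
    then have "real_of_int 1 \<le> real_of_int (e1\<^sup>2 + e2\<^sup>2 + e3\<^sup>2)" by (simp only: of_int_le_iff)
    then have S: "1 \<le> real_of_int e1 ^ 2 + real_of_int e2 ^ 2 + real_of_int e3 ^ 2" by simp
    have "cos t = e0 / Q" by (simp add: cost k_def ee cq_def)
    then have "(sin t)\<^sup>2 = (Q\<^sup>2 - real_of_int e0 ^ 2) / Q\<^sup>2"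
      using Q1 by (simp add: sin_squared_eq power_divide diff_divide_distrib)
    also have "\<dots> \<ge> 1 / Q\<^sup>2" using tot S by (intro divide_right_mono) auto
    finally have "(1 / Q)\<^sup>2 \<le> \<bar>sin t\<bar>\<^sup>2" by (simp add: power_divide)
    then show ?thesis by (rule power2_le_imp_le) simp
  qed
  then have st: "sin t \<noteq> 0" using Q1 by auto
  define gh where "gh = cq (sqrt p\<^sub>0) g"
  have gh1: "cnorm gh = 1" using cnorm_word[of "[g]"] g by (simp add: gh_def)
  obtain x y where xy: "cmul (cmul (ccnj h) gh) h = (x, y)" by (cases "cmul (cmul (ccnj h) gh) h")
  have xy1: "cnorm (x, y) = 1" unfolding xy[symmetric] cnorm_mult cnorm_ccnj h gh1 by simp
  define \<gamma> where "\<gamma> = gen_PGL p\<^sub>1 b g"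
  have \<gamma>: "\<gamma> \<in> carrier X" using class_word[of "[g]"] g by (simp add: \<gamma>_def)
  have op_g: "op [g] = V \<gamma> gh" by (simp add: op_def \<gamma>_def gh_def)
  have op_e: "op e = V \<one>\<^bsub>X\<^esub> k" unfolding op_def cl le sQ k_def ..
  have hh: "cmul h (ccnj h) = cone" "cmul (ccnj h) h = cone" using h by (simp_all add: cmul_ccnj)
  define v where "v = V \<one>\<^bsub>X\<^esub> (ccnj h) u"
  have v: "v \<in> W" "nrm v = 1" using u h by (simp_all add: v_def V_in_W nrm_V)
  have "nrm (V \<one>\<^bsub>X\<^esub> (cis t, 0) v - v) \<le> 2 * n * sqrt (2 * \<epsilon>)"
  proof -
    interpret H: Vector_Spaces.linear section_scale section_scale "V \<one>\<^bsub>X\<^esub> (ccnj h)" by (rule lin_V)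
    have "cmul (cis t, 0) (ccnj h) = cmul (ccnj h) k"
      unfolding kh by (simp add: cmul_assoc[symmetric] hh)
    then have "V \<one>\<^bsub>X\<^esub> (cis t, 0) v = V \<one>\<^bsub>X\<^esub> (ccnj h) (op e u)"
      by (simp add: v_def op_e V_mult)
    then have "V \<one>\<^bsub>X\<^esub> (cis t, 0) v - v = V \<one>\<^bsub>X\<^esub> (ccnj h) (op e u - u)"
      by (simp only: v_def H.diff)
    moreover have "nrm (V \<one>\<^bsub>X\<^esub> (ccnj h) (op e u - u)) = nrm (op e u - u)"
      by (rule nrm_V) (use h op_in_W[OF eg u(1)] u in \<open>auto intro: W_diff\<close>)
    ultimately show ?thesis using eigen_word[OF u l eg] by (simp add: le \<epsilon>_def)
  qed
  from weight_projection[OF v p \<gamma> xy1 this t(1) pt st]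
  have wp: "Re (ips (V \<gamma> (x, y) v) v)
      \<le> 1 - (cmod x)\<^sup>2 * (cmod y)\<^sup>2 + 2 * (2 * n * sqrt (2 * \<epsilon>) / \<bar>sin t\<bar>)" .
  have "ips (V \<gamma> (x, y) v) v = ips (op [g] u) u"
  proof -
    have "cmul (x, y) (ccnj h) = cmul (ccnj h) gh"
      unfolding xy[symmetric] by (simp add: cmul_assoc hh)
    then have "V \<gamma> (x, y) v = V \<one>\<^bsub>X\<^esub> (ccnj h) (op [g] u)"
      using \<gamma> by (simp add: v_def op_g V_mult)
    then show ?thesis
      unfolding v_def using V_unitary[of "\<one>\<^bsub>X\<^esub>" "op [g] u" u "ccnj h"] h u op_in_W[of "[g]" u] g by simp
  qed
  then have low: "1 - \<epsilon> \<le> Re (ips (V \<gamma> (x, y) v) v)" using eigen_gen[OF u l g] by (simp add: \<epsilon>_def)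
  have x2: "(cmod x)\<^sup>2 \<ge> 1 / p\<^sub>0"
  proof -
    obtain g0 g1 g2 g3 where gg: "g = (g0, g1, g2, g3)" by (cases g)
    have "g0 \<ge> 1" using g by (simp add: gg gens_iff)
    have "Re x = Re (fst gh)" using Re_conjugate[of "ccnj h" gh] h xy by simp
    also have "\<dots> = g0 / sqrt p\<^sub>0" by (simp add: gh_def gg cq_def)
    finally have "(Re x)\<^sup>2 = (real_of_int g0)\<^sup>2 / p\<^sub>0" by (simp add: power_divide)
    moreover have "(real_of_int g0)\<^sup>2 \<ge> 1" using \<open>g0 \<ge> 1\<close> by simp
    ultimately have "(Re x)\<^sup>2 \<ge> 1 / p\<^sub>0" by (simp add: divide_right_mono)
    then show ?thesis using zero_le_power2[of "Im x"] unfolding cmod_power2 by linarith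
  qed
  have y2: "4 * (cmod y)\<^sup>2 \<ge> 1 / (p\<^sub>0 * Q\<^sup>2)"
  proof -
    have ck: "cmul (cmul (ccnj h) k) h = (cis t, 0)"
      unfolding kh by (simp add: cmul_assoc hh) (simp add: cmul_assoc[symmetric] hh)
    have "cmul (x, y) (cis t, 0) - cmul (cis t, 0) (x, y) = (0, - (2 * \<i> * of_real (sin t)) * y)"
      by (simp add: cmul_def complex_eq_iff algebra_simps)
    then have "cnorm (cmul (x, y) (cis t, 0) - cmul (cis t, 0) (x, y)) = 4 * (sin t)\<^sup>2 * (cmod y)\<^sup>2"
      by (simp add: cnorm_def norm_mult power_mult_distrib)
    also have "\<dots> \<le> 4 * 1 * (cmod y)\<^sup>2"
      by (intro mult_right_mono mult_left_mono) (auto simp: abs_square_le_1)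
    finally have "cnorm (cmul gh k - cmul k gh) \<le> 4 * (cmod y)\<^sup>2"
      using cmul_commutator_norm[OF h, of gh k] by (simp add: xy ck)
    moreover have "cnorm (cmul gh k - cmul k gh)
        = qnorm (qmul g (qprod e) - qmul (qprod e) g) / (sqrt p\<^sub>0 * Q)\<^sup>2"
    proof -
      have nz: "sqrt p\<^sub>0 \<noteq> 0" "Q \<noteq> 0" using p0_pos Q1 by auto
      have "cmul gh k = cq (sqrt p\<^sub>0 * Q) (qmul g (qprod e))"
        "cmul k gh = cq (sqrt p\<^sub>0 * Q) (qmul (qprod e) g)"
        using nz by (simp_all add: gh_def k_def cq_mult mult.commute)
      then show ?thesis using cnorm_diff_cq nz by simp
    qed
    moreover have "qnorm (qmul g (qprod e) - qmul (qprod e) g) \<ge> 1"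
      using gcomm by (intro qnorm_pos) simp
    then have "real_of_int (qnorm (qmul g (qprod e) - qmul (qprod e) g)) / (sqrt p\<^sub>0 * Q)\<^sup>2 \<ge> 1 / (sqrt p\<^sub>0 * Q)\<^sup>2"
      by (intro divide_right_mono) auto
    ultimately show ?thesis by (simp add: power_mult_distrib)
  qed
  have key: "1 / (4 * (p\<^sub>0\<^sup>2 * Q\<^sup>2)) \<le> \<epsilon> + 4 * n * Q * sqrt (2 * \<epsilon>)"
  proof -
    have "1 / (4 * (p\<^sub>0\<^sup>2 * Q\<^sup>2)) = (1 / p\<^sub>0) * (1 / (p\<^sub>0 * Q\<^sup>2) / 4)" by (simp add: power2_eq_square)
    also have "\<dots> \<le> (cmod x)\<^sup>2 * (cmod y)\<^sup>2" 
    proof (rule mult_mono[OF x2])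
      show "1 / (p\<^sub>0 * Q\<^sup>2) / 4 \<le> (cmod y)\<^sup>2" using divide_right_mono[OF y2, of 4] by simp
    qed simp_all
    also have "\<dots> \<le> \<epsilon> + 2 * (2 * n * sqrt (2 * \<epsilon>) / \<bar>sin t\<bar>)" using wp low by linarith
    also have "2 * (2 * n * sqrt (2 * \<epsilon>) / \<bar>sin t\<bar>) \<le> 4 * n * Q * sqrt (2 * \<epsilon>)"
    proof -
      have "1 / \<bar>sin t\<bar> \<le> Q" using sin_ge st Q1 by (simp add: field_simps)
      then have "(4 * n * sqrt (2 * \<epsilon>)) * (1 / \<bar>sin t\<bar>) \<le> (4 * n * sqrt (2 * \<epsilon>)) * Q"
        using eps by (intro mult_left_mono) auto
      then show ?thesis by (simp add: mult_ac)
    qed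
    finally show ?thesis by simp
  qed
  show ?thesis
  proof (cases "\<epsilon> \<ge> 1")
    case True
    have "784 * (real n)\<^sup>2 * real p\<^sub>0 ^ (6 * n + 4) \<ge> 1"
      using n1 P1 by (intro mult_ge1_I one_le_power) auto
    then have "1 * 1 \<le> 784 * (real n)\<^sup>2 * real p\<^sub>0 ^ (6 * n + 4) * \<epsilon>"
      using True by (intro mult_mono) auto
    then show ?thesis by (simp add: \<epsilon>_def)
  next
    case False
    define s where "s = sqrt \<epsilon>"
    have s: "s \<ge> 0" "s\<^sup>2 = \<epsilon>" "s \<le> 1" using eps False by (simp_all add: s_def)
    have "\<epsilon> \<le> s" using s mult_left_le_one_le[of s s] by (simp add: power2_eq_square)
    have nQ: "1 \<le> n * Q" using n1 Q1 mult_mono[of 1 "real n" 1 Q] by simp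
    have "sqrt (2 * \<epsilon>) \<le> (3 / 2) * s"
    proof -
      have "sqrt 2 \<le> 3 / 2" by (rule real_le_lsqrt) (simp_all add: power2_eq_square)
      moreover have "sqrt (2 * \<epsilon>) = sqrt 2 * s" by (simp only: s_def real_sqrt_mult)
      ultimately show ?thesis using mult_right_mono[of "sqrt 2" "3 / 2" s] s(1) by simp
    qed
    then have "4 * n * Q * sqrt (2 * \<epsilon>) \<le> 4 * n * Q * ((3 / 2) * s)" using Q1 by (intro mult_left_mono) auto
    also have "\<dots> = 6 * (n * Q * s)" by simp
    finally have "1 / (4 * (p\<^sub>0\<^sup>2 * Q\<^sup>2)) \<le> s + 6 * (n * Q * s)" using key \<open>\<epsilon> \<le> s\<close> by linarith
    moreover have "s \<le> n * Q * s" using mult_right_mono[OF nQ s(1)] by simp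
    ultimately have "1 / (4 * (p\<^sub>0\<^sup>2 * Q\<^sup>2)) \<le> 7 * (n * Q * s)" by linarith
    then have "1 \<le> 7 * (n * Q * s) * (4 * (p\<^sub>0\<^sup>2 * Q\<^sup>2))" using p0_pos Q1 by (simp add: divide_le_eq)
    then have "1 \<le> 28 * n * p\<^sub>0\<^sup>2 * Q ^ 3 * s" by (simp add: power2_eq_square power3_eq_cube mult_ac)
    then have "1\<^sup>2 \<le> (28 * n * p\<^sub>0\<^sup>2 * Q ^ 3 * s)\<^sup>2" by (intro power_mono) auto
    also have "\<dots> = 784 * (real n)\<^sup>2 * real p\<^sub>0 ^ (6 * n + 4) * \<epsilon>"
    proof -
      have "(Q ^ 3)\<^sup>2 = real p\<^sub>0 ^ (6 * n)" by (simp add: Q_def power_mult[symmetric] mult.commute)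
      then show ?thesis by (simp add: power_mult_distrib s(2) power_add power_mult[symmetric])
    qed
    finally show ?thesis by (simp add: \<epsilon>_def)
  qed
qed

end

section \<open>The logarithm against the spectral measure\<close>

fun root_sum :: "real \<Rightarrow> nat \<Rightarrow> real \<Rightarrow> real" where
  "root_sum q 0 x = 2"
| "root_sum q (Suc 0) x = x"
| "root_sum q (Suc (Suc n)) x = x * root_sum q (Suc n) x - q * root_sum q n x"

lemma root_sum_eq:
  fixes x :: real and y z :: complex
  assumes "y + z = of_real x" "y * z = of_real q"
  shows "complex_of_real (root_sum q m x) = y ^ m + z ^ m"
proof (induction m rule: induct_nat_012)
  case (ge2 n)
  have "y ^ Suc (Suc n) + z ^ Suc (Suc n) = (y + z) * (y ^ Suc n + z ^ Suc n) - (y * z) * (y ^ n + z ^ n)"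
    by (simp add: algebra_simps)
  then show ?case using ge2 assms by simp
qed (simp_all add: assms)

lemma root_sum_sph: "root_sum q (Suc (Suc (Suc m))) x = root_sum q (Suc m) x + sph q (Suc (Suc (Suc m))) x - q * sph q (Suc m) x"
proof (induction m rule: induct_nat_012)
  case 0 show ?case by (simp add: algebra_simps)
next
  case 1 show ?case by (simp add: algebra_simps)
next
  case (ge2 n)
  let ?p = "\<lambda>k. root_sum q k x" and ?s = "\<lambda>k. sph q k x"
  have p: "?p (Suc (Suc k)) = x * ?p (Suc k) - q * ?p k" for k by simp
  have s: "?s (Suc (Suc (Suc k))) = x * ?s (Suc (Suc k)) - q * ?s (Suc k)" for k by simp
  have "?p (Suc (Suc (Suc (Suc (Suc n))))) = x * ?p (Suc (Suc (Suc (Suc n)))) - q * ?p (Suc (Suc (Suc n)))"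
    by (rule p)
  also have "\<dots> = (x * ?p (Suc (Suc n)) - q * ?p (Suc n))
      + (x * ?s (Suc (Suc (Suc (Suc n)))) - q * ?s (Suc (Suc (Suc n))))
      - q * (x * ?s (Suc (Suc n)) - q * ?s (Suc n))"
    unfolding ge2 by (simp only: algebra_simps)
  also have "\<dots> = ?p (Suc (Suc (Suc n))) + ?s (Suc (Suc (Suc (Suc (Suc n))))) - q * ?s (Suc (Suc (Suc n)))"
    unfolding s[of "Suc (Suc n)"] s[of n] p[of "Suc n"] ..
  finally show ?case .
qed

lemma quadratic_roots:
  fixes q x :: real
  assumes q: "q > 1" and x: "\<bar>x\<bar> \<le> q + 1"
  obtains y z :: complex and \<rho> :: real
  where "y + z = of_real x" "y * z = of_real q" "cmod y \<le> \<rho>" "cmod z \<le> \<rho>"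
    "sqrt q \<le> \<rho>" "\<rho> \<le> q"
    "\<And>k. root_sum q (2 * k) x \<ge> - 2 * q ^ k" "\<And>k. \<rho> > sqrt q \<Longrightarrow> root_sum q (2 * k) x \<ge> \<rho> ^ (2 * k)"
proof (cases "x\<^sup>2 \<ge> 4 * q")
  case True
  define d where "d = sqrt (x\<^sup>2 - 4 * q)"
  have d: "d \<ge> 0" "d\<^sup>2 = x\<^sup>2 - 4 * q" using True by (simp_all add: d_def)
  define y z where "y = (x + d) / 2" and "z = (x - d) / 2"
  have yz: "y + z = x" "y * z = q"
    using d(2) by (simp_all add: y_def z_def field_simps power2_eq_square)
  define \<rho> where "\<rho> = max \<bar>y\<bar> \<bar>z\<bar>"
  have "d \<le> q - 1"
  proof (rule power2_le_imp_le)
    have "x\<^sup>2 \<le> (q + 1)\<^sup>2" using x abs_le_square_iff[of x "q + 1"] q by simp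
    then show "d\<^sup>2 \<le> (q - 1)\<^sup>2" unfolding d(2) by (simp add: power2_eq_square algebra_simps)
  qed (use q in simp)
  then have \<rho>q: "\<rho> \<le> q" using x d(1) by (auto simp: \<rho>_def y_def z_def)
  have "q \<le> \<rho>\<^sup>2"
  proof -
    have "q = \<bar>y\<bar> * \<bar>z\<bar>" using yz(2) q by (simp flip: abs_mult)
    also have "\<dots> \<le> \<rho> * \<rho>" by (intro mult_mono) (auto simp: \<rho>_def)
    finally show ?thesis by (simp add: power2_eq_square)
  qed
  then have s: "sqrt q \<le> \<rho>" by (intro real_le_lsqrt) (use q in \<open>auto simp: \<rho>_def\<close>)
  have root_sum: "root_sum q m x = y ^ m + z ^ m" for m
  proof -
    have "complex_of_real (root_sum q m x) = of_real y ^ m + of_real z ^ m"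
      using yz by (intro root_sum_eq) (simp_all flip: of_real_add of_real_mult)
    also have "\<dots> = of_real (y ^ m + z ^ m)" by simp
    finally show ?thesis by (simp only: of_real_eq_iff)
  qed
  have big: "root_sum q (2 * k) x \<ge> \<rho> ^ (2 * k)" for k
  proof -
    have "\<bar>y\<bar> ^ (2 * k) = y ^ (2 * k)" "\<bar>z\<bar> ^ (2 * k) = z ^ (2 * k)"
      by (simp_all add: power_mult)
    moreover have "\<rho> = \<bar>y\<bar> \<or> \<rho> = \<bar>z\<bar>" by (auto simp: \<rho>_def)
    moreover have "y ^ (2 * k) \<ge> 0" "z ^ (2 * k) \<ge> 0" by (simp_all add: power_mult)
    ultimately show ?thesis unfolding root_sum by auto
  qed
  show ?thesis
  proof (rule that[of "of_real y" "of_real z" \<rho>])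
    fix k
    have "\<rho> \<ge> 0" by (simp add: \<rho>_def)
    then have "0 \<le> root_sum q (2 * k) x" using big[of k] zero_le_power[of \<rho> "2 * k"] by linarith
    then show "- 2 * q ^ k \<le> root_sum q (2 * k) x" using q zero_le_power[of q k] by linarith
  qed (use yz s \<rho>q big in \<open>simp_all add: \<rho>_def flip: of_real_add of_real_mult\<close>)
next
  case False
  define d where "d = sqrt (4 * q - x\<^sup>2)"
  have d: "d\<^sup>2 = 4 * q - x\<^sup>2" using False by (simp add: d_def)
  define y where "y = Complex (x / 2) (d / 2)"
  have yz: "y + cnj y = of_real x" "y * cnj y = of_real q"
    using d by (simp_all add: y_def complex_eq_iff power2_eq_square) (simp add: field_simps)
  have c: "cmod y = sqrt q"
    using d by (simp add: y_def cmod_def power_divide diff_divide_distrib)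
  show ?thesis
  proof (rule that[of y "cnj y" "sqrt q"])
    show "sqrt q \<le> q" using q by (intro real_le_lsqrt) (auto simp: power2_eq_square)
    fix k
    have "\<bar>root_sum q (2 * k) x\<bar> = cmod (y ^ (2 * k) + cnj y ^ (2 * k))"
      by (simp add: root_sum_eq[OF yz, symmetric] del: complex_cnj_power)
    also have "\<dots> \<le> cmod y ^ (2 * k) + cmod y ^ (2 * k)"
      by (rule order_trans[OF norm_triangle_ineq]) (simp add: norm_power)
    also have "\<dots> = 2 * q ^ k" using q by (simp add: c power_mult)
    finally show "- 2 * q ^ k \<le> root_sum q (2 * k) x" by simp
  qed (use yz c in simp_all)
qed

lemma ln_norm_tail:
  fixes w :: complex and \<theta> :: real
  assumes w: "cmod w \<le> \<theta>" and \<theta>: "\<theta> < 1"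
  shows "\<bar>ln (cmod (1 - w)) + (\<Sum>m=1..K. Re (w ^ m) / m)\<bar> \<le> \<theta> ^ Suc K / (1 - \<theta>)"
proof -
  have \<theta>0: "\<theta> \<ge> 0" using w norm_ge_zero[of w] by linarith
  have w1: "cmod (- w) < 1" using w \<theta> by simp
  have "(\<lambda>n. - ((- (- w)) ^ n) / of_nat n) sums Ln (1 + - w)"
    by (rule Ln_series'[OF w1])
  from sums_minus[OF this] have S: "(\<lambda>n. w ^ n / of_nat n) sums (- Ln (1 - w))" by simp
  define f where "f n = w ^ n / of_nat n" for n
  have fb: "cmod (f (n + Suc K)) \<le> \<theta> ^ (n + Suc K)" for n
  proof -
    have "cmod (f (n + Suc K)) = cmod w ^ (n + Suc K) / real (n + Suc K)"
      by (simp only: f_def norm_divide norm_power norm_of_nat)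
    also have "\<dots> \<le> cmod w ^ (n + Suc K) / 1" by (intro divide_left_mono) auto
    also have "\<dots> \<le> \<theta> ^ (n + Suc K)" using w by (simp add: power_mono del: power_Suc)
    finally show ?thesis .
  qed
  have gs: "(\<lambda>n. \<theta> ^ (n + Suc K)) sums (\<theta> ^ Suc K / (1 - \<theta>))"
  proof -
    have "(\<lambda>n. \<theta> ^ n) sums (1 / (1 - \<theta>))" using \<theta> \<theta>0 by (intro geometric_sums) simp
    from sums_mult[OF this, of "\<theta> ^ Suc K"] show ?thesis by (simp add: power_add mult_ac)
  qed
  have "(\<lambda>n. f (n + Suc K)) sums (- Ln (1 - w) - (\<Sum>n<Suc K. f n))"
    using S unfolding f_def[symmetric] by (rule sums_split_initial_segment)
  then have "cmod (- Ln (1 - w) - (\<Sum>n<Suc K. f n)) \<le> \<theta> ^ Suc K / (1 - \<theta>)"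
    using norm_suminf_le[of "\<lambda>n. f (n + Suc K)" "\<lambda>n. \<theta> ^ (n + Suc K)"] fb gs
    by (metis sums_summable sums_unique)
  then have "\<bar>Re (- Ln (1 - w) - (\<Sum>n<Suc K. f n))\<bar> \<le> \<theta> ^ Suc K / (1 - \<theta>)"
    using abs_Re_le_cmod order_trans by blast
  moreover have "Re (- Ln (1 - w) - (\<Sum>n<Suc K. f n)) = - (ln (cmod (1 - w)) + (\<Sum>m=1..K. Re (w ^ m) / m))"
  proof -
    have "1 - w \<noteq> 0" using w1 by auto
    then have "Re (Ln (1 - w)) = ln (cmod (1 - w))" by simp
    moreover have "(\<Sum>n<Suc K. f n) = (\<Sum>m=1..K. f m)"
    proof -
      have "{..<Suc K} = insert 0 {1..K}" by auto
      then show ?thesis by (simp add: f_def)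
    qed
    moreover have "Re (f m) = Re (w ^ m) / m" for m by (simp add: f_def)
    ultimately show ?thesis by simp
  qed
  ultimately show ?thesis by simp
qed

definition ln_approx :: "real \<Rightarrow> nat \<Rightarrow> real \<Rightarrow> real" where
  "ln_approx q K x = ln q - (\<Sum>m=1..K. root_sum q m x / (q ^ m * m))"

lemma ln_approx_close:
  assumes q: "q > 1" and yz: "y + z = of_real x" "y * z = of_real q"
    and b: "cmod y \<le> \<theta> * q" "cmod z \<le> \<theta> * q" and \<theta>: "\<theta> < 1" and x: "x \<le> q + 1"
  shows "\<bar>ln (q + 1 - x) - ln_approx q K x\<bar> \<le> 2 * (\<theta> ^ Suc K / (1 - \<theta>))"
proof -
  let ?y = "y / of_real q" and ?z = "z / of_real q"
  have yq: "cmod ?y \<le> \<theta>" "cmod ?z \<le> \<theta>" using b q by (simp_all add: norm_divide field_simps)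
  have prod: "(1 - ?y) * (1 - ?z) = of_real ((q + 1 - x) / q)"
  proof -
    have "(1 - ?y) * (1 - ?z) = 1 - (y + z) / of_real q + (y * z) / (of_real q * of_real q)"
      using q by (simp add: field_simps)
    also have "\<dots> = of_real ((q + 1 - x) / q)" unfolding yz using q by (simp add: field_simps)
    finally show ?thesis .
  qed
  have nz: "cmod (1 - ?y) > 0" "cmod (1 - ?z) > 0" using yq \<theta> by auto
  have "cmod (1 - ?y) * cmod (1 - ?z) = (q + 1 - x) / q"
    unfolding norm_mult[symmetric] prod norm_of_real using q x by simp
  then have pos: "(q + 1 - x) / q > 0" using nz by (metis mult_pos_pos)
  then have "ln ((q + 1 - x) / q) = ln (cmod (1 - ?y)) + ln (cmod (1 - ?z))"
    using nz \<open>cmod (1 - ?y) * cmod (1 - ?z) = (q + 1 - x) / q\<close> by (metis ln_mult_pos)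
  moreover have "ln ((q + 1 - x) / q) = ln (q + 1 - x) - ln q"
    using pos q by (intro ln_divide_pos) (simp_all add: zero_less_divide_iff)
  moreover have "(\<Sum>m=1..K. root_sum q m x / (q ^ m * m)) = (\<Sum>m=1..K. Re (?y ^ m) / m) + (\<Sum>m=1..K. Re (?z ^ m) / m)"
    unfolding sum.distrib[symmetric]
  proof (intro sum.cong refl)
    fix m
    have "complex_of_real (root_sum q m x / q ^ m) = ?y ^ m + ?z ^ m"
      using root_sum_eq[OF yz, of m] by (simp add: power_divide add_divide_distrib)
    then have "root_sum q m x / q ^ m = Re (?y ^ m) + Re (?z ^ m)"
      by (metis Re_complex_of_real plus_complex.simps(1))
    then show "root_sum q m x / (q ^ m * m) = Re (?y ^ m) / m + Re (?z ^ m) / m"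
      by (metis add_divide_distrib divide_divide_eq_left)
  qed
  ultimately have "ln (q + 1 - x) - ln_approx q K x = (ln (cmod (1 - ?y)) + (\<Sum>m=1..K. Re (?y ^ m) / m))
      + (ln (cmod (1 - ?z)) + (\<Sum>m=1..K. Re (?z ^ m) / m))"
    unfolding ln_approx_def by linarith
  then show ?thesis using ln_norm_tail[OF yq(1) \<theta>, of K] ln_norm_tail[OF yq(2) \<theta>, of K] by linarith
qed

lemma ln_approx_bound:
  assumes q: "q > 1" and yz: "y + z = of_real x" "y * z = of_real q"
    and b: "cmod y \<le> q" "cmod z \<le> q"
  shows "\<bar>ln_approx q K x\<bar> \<le> ln q + 2 * K"
proof -
  have "\<bar>root_sum q m x / (q ^ m * m)\<bar> \<le> 2" if "m \<in> {1..K}" for m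
  proof -
    have "\<bar>root_sum q m x\<bar> = cmod (y ^ m + z ^ m)" by (simp add: root_sum_eq[OF yz, symmetric])
    also have "\<dots> \<le> cmod y ^ m + cmod z ^ m"
      by (rule order_trans[OF norm_triangle_ineq]) (simp add: norm_power)
    also have "\<dots> \<le> q ^ m + q ^ m" using b by (intro add_mono power_mono) auto
    also have "\<dots> \<le> 2 * (q ^ m * m)" using that q by simp
    finally have *: "\<bar>root_sum q m x\<bar> \<le> 2 * (q ^ m * m)" .
    have "q ^ m * m > 0" using q that by simp
    then show ?thesis using * by (simp add: divide_le_eq)
  qed
  then have "\<bar>\<Sum>m=1..K. root_sum q m x / (q ^ m * m)\<bar> \<le> (\<Sum>m=1..K. 2)"
    by (intro order_trans[OF sum_abs] sum_mono)
  then have "\<bar>\<Sum>m=1..K. root_sum q m x / (q ^ m * m)\<bar> \<le> 2 * K" by simp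
  then show ?thesis unfolding ln_approx_def using q ln_ge_zero[of q] by linarith
qed

definition kesten_limit :: "real \<Rightarrow> real" where
  "kesten_limit q = q * ln q - 1/2 * (q - 1) * ln (q - 1) - 1/2 * (q - 1) * ln (q + 1)"

lemma kesten_limit_approx:
  assumes q: "q > 1" and \<theta>: "1 / q \<le> \<theta>" "\<theta> < 1"
  shows "\<bar>ln q - (\<Sum>m=1..K. (if even m then 1 - q else 0) / (q ^ m * m)) - kesten_limit q\<bar>
    \<le> (q - 1) * (\<theta> ^ Suc K / (1 - \<theta>))"
proof -
  define S where "S w = (\<Sum>m=1..K. Re (w ^ m) / m)" for w :: complex
  let ?w = "complex_of_real (1 / q)"
  have c1: "cmod ?w \<le> \<theta>" "cmod (- ?w) \<le> \<theta>" using q \<theta> by (simp_all add: norm_divide)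
  have n1: "cmod (1 - ?w) = (q - 1) / q"
  proof -
    have "1 - ?w = of_real ((q - 1) / q)" using q by (simp add: field_simps)
    then show ?thesis using q by (simp only: norm_of_real) simp
  qed
  have n2: "cmod (1 - - ?w) = (q + 1) / q"
  proof -
    have "1 - - ?w = of_real ((q + 1) / q)" using q by (simp add: field_simps)
    then show ?thesis using q by (simp only: norm_of_real) simp
  qed
  have t1: "\<bar>(ln (q - 1) - ln q) + S ?w\<bar> \<le> \<theta> ^ Suc K / (1 - \<theta>)"
    using ln_norm_tail[OF c1(1) \<theta>(2), of K] q unfolding n1 S_def by (simp add: ln_divide_pos)
  have t2: "\<bar>(ln (q + 1) - ln q) + S (- ?w)\<bar> \<le> \<theta> ^ Suc K / (1 - \<theta>)"
    using ln_norm_tail[OF c1(2) \<theta>(2), of K] q unfolding n2 S_def by (simp add: ln_divide_pos)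
  have "(\<Sum>m=1..K. (if even m then 1 - q else 0) / (q ^ m * m)) = (1 - q) / 2 * (S ?w + S (- ?w))"
    unfolding S_def sum.distrib[symmetric] sum_distrib_left
  proof (intro sum.cong refl)
    fix m
    have Rw: "Re (?w ^ m) = 1 / q ^ m" by (simp add: power_divide flip: of_real_power)
    have "(- ?w) ^ m = of_real ((- (1 / q)) ^ m)" by simp
    then have Rm: "Re ((- ?w) ^ m) = (- (1 / q)) ^ m" by (simp only: Re_complex_of_real)
    show "(if even m then 1 - q else 0) / (q ^ m * m)
        = (1 - q) / 2 * (Re (?w ^ m) / m + Re ((- ?w) ^ m) / m)"
    proof (cases "even m")
      case True
      then have "(- (1 / q)) ^ m = 1 / q ^ m" by (simp add: power_divide)
      then have "Re (?w ^ m) / m + Re ((- ?w) ^ m) / m = 2 * (1 / (q ^ m * m))"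
        unfolding Rw Rm by simp
      moreover have "(1 - q) / 2 * (2 * (1 / X)) = (1 - q) / X" for X :: real
        by (cases "X = 0") (simp_all add: field_simps)
      ultimately show ?thesis using True by (simp only: if_True)
    next
      case False
      then have "(- (1 / q)) ^ m = - (1 / q ^ m)" by (simp add: power_divide)
      then show ?thesis
        unfolding Rw Rm using False by simp
    qed
  qed
  then have "ln q - (\<Sum>m=1..K. (if even m then 1 - q else 0) / (q ^ m * m)) - kesten_limit q
      = (q - 1) / 2 * (((ln (q - 1) - ln q) + S ?w) + ((ln (q + 1) - ln q) + S (- ?w)))"
    unfolding kesten_limit_def by (simp add: field_simps)
  also have "\<bar>\<dots>\<bar> = (q - 1) / 2 * \<bar>((ln (q - 1) - ln q) + S ?w) + ((ln (q + 1) - ln q) + S (- ?w))\<bar>"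
    using q by (simp add: abs_mult)
  also have "\<dots> \<le> (q - 1) / 2 * (2 * (\<theta> ^ Suc K / (1 - \<theta>)))"
  proof (rule mult_left_mono)
    show "\<bar>((ln (q - 1) - ln q) + S ?w) + ((ln (q + 1) - ln q) + S (- ?w))\<bar> \<le> 2 * (\<theta> ^ Suc K / (1 - \<theta>))"
      using t1 t2 by linarith
  qed (use q in simp)
  finally show ?thesis by simp
qed

lemma average_root_sum:
  fixes q \<delta> :: real and \<mu> :: "'a \<Rightarrow> real"
  assumes q: "q \<ge> 1" and \<delta>: "\<And>j. 1 \<le> j \<Longrightarrow> j \<le> K \<Longrightarrow> \<bar>\<Sum>b\<in>B. sph q j (\<mu> b)\<bar> \<le> card B * \<delta>"
    and m: "1 \<le> m" "m \<le> K"
  shows "\<bar>(\<Sum>b\<in>B. root_sum q m (\<mu> b)) - card B * (if even m then 1 - q else 0)\<bar> \<le> card B * (m * ((1 + q) * \<delta>))"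
  using m
proof (induction m rule: induct_nat_012)
  case 1
  have "\<bar>\<Sum>b\<in>B. \<mu> b\<bar> \<le> card B * \<delta>" using \<delta>[of 1] 1 by simp
  moreover have "card B * \<delta> \<ge> 0" using calculation by linarith
  then have "card B * \<delta> \<le> (1 + q) * (card B * \<delta>)" using q mult_right_mono[of 1 "1 + q" "card B * \<delta>"] by simp
  ultimately show ?case by (simp add: mult_ac)
next
  case (ge2 n)
  define S where "S j = (\<Sum>b\<in>B. sph q j (\<mu> b))" for j
  define P where "P j = (\<Sum>b\<in>B. root_sum q j (\<mu> b))" for j
  have S: "\<bar>S j\<bar> \<le> card B * \<delta>" if "1 \<le> j" "j \<le> K" for j using \<delta>[OF that] by (simp add: S_def)
  have nn: "card B * \<delta> \<ge> 0" using S[of 1] ge2.prems by linarith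
  show ?case
  proof (cases n)
    case 0
    have "P 2 = S 2 + card B * (1 - q)"
      unfolding P_def S_def
      by (simp add: numeral_2_eq_2 sum.distrib sum_subtractf algebra_simps)
    moreover have "\<bar>S 2\<bar> \<le> card B * \<delta>" using S[of 2] ge2.prems 0 by simp
    moreover have "card B * \<delta> \<le> (2 * (1 + q)) * (card B * \<delta>)"
      using q nn mult_right_mono[of 1 "2 * (1 + q)" "card B * \<delta>"] by simp
    ultimately have "\<bar>P 2 - card B * (1 - q)\<bar> \<le> card B * (real 2 * ((1 + q) * \<delta>))"
      by (simp add: mult_ac)
    then show ?thesis using 0 by (simp add: P_def numeral_2_eq_2)
  next
    case (Suc k)
    have "P (Suc (Suc n)) = P n + S (Suc (Suc n)) - q * S n"
      unfolding P_def S_def Suc root_sum_sph by (simp only: sum.distrib sum_subtractf sum_distrib_left)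
    moreover have "\<bar>P n - card B * (if even n then 1 - q else 0)\<bar> \<le> card B * (n * ((1 + q) * \<delta>))"
      using ge2 Suc by (simp add: P_def)
    moreover have "\<bar>S (Suc (Suc n))\<bar> \<le> card B * \<delta>" "\<bar>S n\<bar> \<le> card B * \<delta>" using S ge2.prems Suc by auto
    moreover have "\<bar>q * S n\<bar> \<le> q * (card B * \<delta>)"
      using calculation(4) q by (simp add: abs_mult mult_left_mono)
    moreover have "card B * (n * ((1 + q) * \<delta>)) + card B * \<delta> + q * (card B * \<delta>)
        \<le> card B * (real (Suc (Suc n)) * ((1 + q) * \<delta>))"
      using q nn mult_nonneg_nonneg[of "1 + q" "card B * \<delta>"] by (simp add: algebra_simps)
    ultimately show ?thesis unfolding P_def[symmetric] by (simp split: if_splits)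
  qed
qed simp

locale spectral_data =
  fixes q C :: real and M :: nat and B :: "'a set" and \<mu> :: "'a \<Rightarrow> real"
  assumes q: "q \<ge> 2" and C: "C \<ge> 1" and M: "M > 0"
    and B: "finite B" "B \<noteq> {}" and \<mu>: "\<And>b. b \<in> B \<Longrightarrow> \<bar>\<mu> b\<bar> \<le> q + 1"
    and sph_sum: "\<And>m. m \<ge> 1 \<Longrightarrow> \<bar>\<Sum>b\<in>B. sph q m (\<mu> b)\<bar> \<le> card B * (C ^ m / M)"
    and gap: "\<And>b n. b \<in> B \<Longrightarrow> \<mu> b \<noteq> q + 1 \<Longrightarrow> n \<ge> 1 \<Longrightarrow> (3 * M) ^ 8 < 2 ^ n \<Longrightarrow>
       1 \<le> q ^ (16 * n) * (q + 1 - \<mu> b)"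
begin

lemma sph_sum_uniform:
  assumes "1 \<le> j" "j \<le> K" shows "\<bar>\<Sum>b\<in>B. sph q j (\<mu> b)\<bar> \<le> card B * (C ^ K / M)"
proof -
  have "C ^ j / M \<le> C ^ K / M" using C assms by (intro divide_right_mono power_increasing) auto
  then have "card B * (C ^ j / M) \<le> card B * (C ^ K / M)" by (intro mult_left_mono) auto
  then show ?thesis using sph_sum[OF assms(1)] by linarith
qed

lemma average_ln_approx:
  "\<bar>(\<Sum>b\<in>B. ln_approx q K (\<mu> b)) / card B
      - (ln q - (\<Sum>m=1..K. (if even m then 1 - q else 0) / (q ^ m * m)))\<bar>
    \<le> K * ((1 + q) * (C ^ K / M))"
proof -
  define N where "N = real (card B)"
  have N: "N > 0" using B by (simp add: N_def card_gt_0_iff)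
  define A where "A m = (\<Sum>b\<in>B. root_sum q m (\<mu> b)) / N" for m
  define \<delta> where "\<delta> = (1 + q) * (C ^ K / M)"
  have \<delta>: "\<delta> \<ge> 0" using q C by (simp add: \<delta>_def)
  have A: "\<bar>A m - (if even m then 1 - q else 0)\<bar> \<le> m * \<delta>" if "m \<in> {1..K}" for m
  proof -
    have *: "\<bar>(\<Sum>b\<in>B. root_sum q m (\<mu> b)) - N * (if even m then 1 - q else 0)\<bar> \<le> N * (m * \<delta>)"
      unfolding N_def \<delta>_def
      by (rule average_root_sum[where q = q and K = K and B = B and \<mu> = \<mu> and \<delta> = "C ^ K / M" and m = m]) (use q that sph_sum_uniform in auto)
    have "\<bar>A m - (if even m then 1 - q else 0)\<bar>
        = \<bar>((\<Sum>b\<in>B. root_sum q m (\<mu> b)) - N * (if even m then 1 - q else 0)) / N\<bar>"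
      using N by (simp add: A_def diff_divide_distrib)
    also have "\<dots> \<le> m * \<delta>" using * N by (simp add: abs_divide divide_le_eq mult_ac)
    finally show ?thesis .
  qed
  have "(\<Sum>b\<in>B. ln_approx q K (\<mu> b)) / N = ln q - (\<Sum>m=1..K. A m / (q ^ m * m))"
  proof -
    have "(\<Sum>b\<in>B. ln_approx q K (\<mu> b)) = N * ln q - (\<Sum>m=1..K. (\<Sum>b\<in>B. root_sum q m (\<mu> b)) / (q ^ m * m))"
      unfolding ln_approx_def sum_subtractf N_def
      by (subst sum.swap) (simp add: sum_divide_distrib)
    then show ?thesis using N
      by (simp add: diff_divide_distrib sum_divide_distrib A_def mult_ac)
  qed
  then have "(\<Sum>b\<in>B. ln_approx q K (\<mu> b)) / N
      - (ln q - (\<Sum>m=1..K. (if even m then 1 - q else 0) / (q ^ m * m)))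
    = - (\<Sum>m=1..K. (A m - (if even m then 1 - q else 0)) / (q ^ m * m))"
    by (simp add: diff_divide_distrib sum_subtractf)
  also have "\<bar>\<dots>\<bar> \<le> (\<Sum>m=1..K. \<delta>)"
    unfolding abs_minus_cancel
  proof (rule order_trans[OF sum_abs], rule sum_mono)
    fix m assume m: "m \<in> {1..K}"
    then have qm: "q ^ m * m > 0" "1 \<le> q ^ m" using q by auto
    have "\<bar>A m - (if even m then 1 - q else 0)\<bar> \<le> m * \<delta>" by (rule A[OF m])
    also have "\<dots> \<le> q ^ m * (m * \<delta>)" using qm(2) \<delta> mult_right_mono[of 1 "q ^ m" "m * \<delta>"] by simp
    finally show "\<bar>(A m - (if even m then 1 - q else 0)) / (q ^ m * m)\<bar> \<le> \<delta>"
      using qm(1) by (simp add: abs_divide divide_le_eq mult_ac)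
  qed
  also have "\<dots> = K * \<delta>" by simp
  finally show ?thesis by (simp add: N_def \<delta>_def)
qed

text \<open>With \<open>r = q\<^sup>1\<^sup>/\<^sup>4\<close>, an eigenvalue is close to tempered if its larger root is at most
  \<open>r\<^sup>3\<close>; the even power sums bound the number of the remaining ones.\<close>

lemma exceptional_fraction:
  fixes D :: nat
  assumes r: "r > 1" "r ^ 4 = q" and k: "k \<ge> 1" and D: "4 * (1 + q) * C\<^sup>2 \<le> D" "D ^ k \<le> M"
    and X: "X \<subseteq> B" "\<And>b. b \<in> X \<Longrightarrow> root_sum q (2 * k) (\<mu> b) \<ge> r ^ (6 * k)"
    and all: "\<And>b. b \<in> B \<Longrightarrow> root_sum q (2 * k) (\<mu> b) \<ge> - 2 * q ^ k"
  shows "card X / card B \<le> 3 / (r\<^sup>2) ^ k"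
proof -
  define N where "N = real (card B)"
  have N: "N > 0" using B by (simp add: N_def card_gt_0_iff)
  let ?\<delta> = "C ^ (2 * k) / M"
  have P: "(\<Sum>b\<in>B. root_sum q (2 * k) (\<mu> b)) \<le> N * (1 - q) + N * (real (2 * k) * ((1 + q) * ?\<delta>))"
    using average_root_sum[where q = q and K = "2 * k" and B = B and \<mu> = \<mu> and \<delta> = ?\<delta> and m = "2 * k"] sph_sum_uniform q k by (simp add: N_def)
  have "real (2 * k) * ((1 + q) * ?\<delta>) \<le> 1"
  proof -
    have "real (2 * k) \<le> 4 ^ k"
    proof -
      have "2 * k < 2 ^ (2 * k)" by (rule less_exp)
      then have "real (2 * k) \<le> real (2 ^ (2 * k))" by linarith
      then show ?thesis by (simp add: power_mult)
    qed
    moreover have "1 + q \<le> (1 + q) ^ k" using q k by (intro self_le_power) auto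
    ultimately have "real (2 * k) * (1 + q) * C ^ (2 * k) \<le> 4 ^ k * (1 + q) ^ k * (C\<^sup>2) ^ k"
      using q C by (intro mult_mono) (auto simp: power_mult)
    also have "\<dots> = (4 * (1 + q) * C\<^sup>2) ^ k" by (simp only: power_mult_distrib)
    also have "\<dots> \<le> real D ^ k" using D(1) q C by (intro power_mono) auto
    also have "\<dots> \<le> M" using D(2) by (metis of_nat_le_iff of_nat_power)
    finally show ?thesis using M by (simp add: divide_le_eq)
  qed
  then have "N * (real (2 * k) * ((1 + q) * ?\<delta>)) \<le> N * 1" using N by (intro mult_left_mono) auto
  then have P': "(\<Sum>b\<in>B. root_sum q (2 * k) (\<mu> b)) \<le> N * (2 - q)" using P by (simp add: algebra_simps)
  have "r ^ (6 * k) * card X = (\<Sum>b\<in>X. r ^ (6 * k))" by simp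
  also have "\<dots> \<le> (\<Sum>b\<in>X. root_sum q (2 * k) (\<mu> b) + 2 * q ^ k)"
    using X(2) q by (intro sum_mono) (smt (verit) zero_le_power)
  also have "\<dots> \<le> (\<Sum>b\<in>B. root_sum q (2 * k) (\<mu> b) + 2 * q ^ k)"
    using X(1) B(1) all by (intro sum_mono2) force+
  also have "\<dots> = (\<Sum>b\<in>B. root_sum q (2 * k) (\<mu> b)) + N * (2 * q ^ k)" by (simp add: sum.distrib N_def)
  also have "\<dots> \<le> N * (2 - q) + N * (2 * q ^ k)" using P' by simp
  also have "\<dots> \<le> N * (3 * q ^ k)"
  proof -
    have "2 - q \<le> q ^ k" using q one_le_power[of q k] by linarith
    then have "N * (2 - q) \<le> N * q ^ k" using N by (intro mult_left_mono) auto
    then show ?thesis by simp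
  qed
  finally have "r ^ (6 * k) * card X \<le> N * (3 * q ^ k)" .
  moreover have "r ^ (6 * k) = (r\<^sup>2) ^ k * q ^ k"
    by (simp add: r(2)[symmetric] flip: power_mult power_add)
  ultimately have "q ^ k * ((r\<^sup>2) ^ k * card X) \<le> q ^ k * (3 * N)" by (simp add: mult_ac)
  moreover have "q ^ k > 0" using q by simp
  ultimately have "(r\<^sup>2) ^ k * card X \<le> 3 * N" by (simp only: mult_le_cancel_left_pos)
  moreover have "(r\<^sup>2) ^ k > 0" using r by simp
  ultimately show ?thesis using N by (simp add: N_def field_simps)
qed

lemma ln_det_average:
  fixes D :: nat
  assumes r: "r > 1" "r ^ 4 = q" and k: "k \<ge> 1" and D: "4 * (1 + q) * C\<^sup>2 \<le> D" "D ^ k \<le> M"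
    and n: "n \<ge> 1" "(3 * M) ^ 8 < 2 ^ n"
  shows "\<bar>(\<Sum>b\<in>{b \<in> B. \<mu> b \<noteq> q + 1}. ln (q + 1 - \<mu> b)) / card B - kesten_limit q\<bar>
    \<le> (q + 1) * ((1 / r) ^ Suc K / (1 - 1 / r)) + K * ((1 + q) * (C ^ K / M))
      + 3 / (r\<^sup>2) ^ k * (ln (2 * (q + 1)) + 16 * n * ln q + (ln q + 2 * K))"
proof -
  define N where "N = real (card B)"
  have N: "N > 0" using B by (simp add: N_def card_gt_0_iff)
  have q1: "q > 1" using q by simp
  define tail where "tail = (1 / r) ^ Suc K / (1 - 1 / r)"
  have r1: "0 < 1 / r" "1 / r < 1" using r by auto
  have tail0: "tail \<ge> 0" using r1 by (simp add: tail_def)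
  define g where "g b = (if \<mu> b \<noteq> q + 1 then ln (q + 1 - \<mu> b) else 0)" for b
  define Q where "Q b y z \<rho> \<longleftrightarrow> y + z = complex_of_real (\<mu> b) \<and> y * z = of_real q \<and> cmod y \<le> \<rho> \<and>
      cmod z \<le> \<rho> \<and> sqrt q \<le> \<rho> \<and> \<rho> \<le> q \<and> (\<forall>k. root_sum q (2 * k) (\<mu> b) \<ge> - 2 * q ^ k) \<and>
      (\<rho> > sqrt q \<longrightarrow> (\<forall>k. root_sum q (2 * k) (\<mu> b) \<ge> \<rho> ^ (2 * k)))" for b y z \<rho>
  have "\<exists>y z \<rho>. Q b y z \<rho>" if "b \<in> B" for b
    unfolding Q_def by (rule quadratic_roots[OF q1 \<mu>[OF that]]) blast
  then obtain y z \<rho> where "\<And>b. b \<in> B \<Longrightarrow> Q b (y b) (z b) (\<rho> b)" by metis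
  then have roots: "\<And>b. b \<in> B \<Longrightarrow> y b + z b = complex_of_real (\<mu> b)"
    "\<And>b. b \<in> B \<Longrightarrow> y b * z b = of_real q" "\<And>b. b \<in> B \<Longrightarrow> cmod (y b) \<le> \<rho> b"
    "\<And>b. b \<in> B \<Longrightarrow> cmod (z b) \<le> \<rho> b" "\<And>b. b \<in> B \<Longrightarrow> sqrt q \<le> \<rho> b" "\<And>b. b \<in> B \<Longrightarrow> \<rho> b \<le> q"
    "\<And>b k. b \<in> B \<Longrightarrow> root_sum q (2 * k) (\<mu> b) \<ge> - 2 * q ^ k"
    "\<And>b k. b \<in> B \<Longrightarrow> \<rho> b > sqrt q \<Longrightarrow> root_sum q (2 * k) (\<mu> b) \<ge> \<rho> b ^ (2 * k)"
    unfolding Q_def by blast+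
  have sq: "sqrt q = r\<^sup>2"
    using r by (intro real_sqrt_unique) (simp_all flip: power_mult)
  have r3: "r\<^sup>2 < r ^ 3" using r by (intro power_strict_increasing) auto
  have q43: "q = r * r ^ 3" using r(2) by (simp add: numeral_eq_Suc)
  define X where "X = {b \<in> B. \<rho> b > r ^ 3}"
  have XB: "X \<subseteq> B" by (auto simp: X_def)
  have frac: "card X / N \<le> 3 / (r\<^sup>2) ^ k"
    unfolding N_def
  proof (rule exceptional_fraction[OF r k D XB])
    fix b assume b: "b \<in> X"
    then have "r ^ (6 * k) \<le> \<rho> b ^ (2 * k)"
      using power_mono[of "r ^ 3" "\<rho> b" "2 * k"] r by (simp add: X_def flip: power_mult)
    also have "\<dots> \<le> root_sum q (2 * k) (\<mu> b)" using b r3 sq by (intro roots(8)) (auto simp: X_def)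
    finally show "root_sum q (2 * k) (\<mu> b) \<ge> r ^ (6 * k)" .
  qed (rule roots(7))
  define h where "h = ln (2 * (q + 1)) + 16 * n * ln q + (ln q + 2 * K)"
  have h_eq: "h = ln (2 * (q + 1)) + 16 * real n * ln q + (ln q + 2 * real K)" by (simp add: h_def)
  have lnq: "ln q \<ge> 0" "ln (2 * (q + 1)) \<ge> 0" using q by (auto intro!: ln_ge_zero)
  have near: "\<bar>g b - ln_approx q K (\<mu> b)\<bar> \<le> 2 * tail" if b: "b \<in> B" "b \<notin> X" for b
  proof -
    have \<rho>3: "\<rho> b \<le> r ^ 3" using b by (simp add: X_def)
    have "1 / r * q = r ^ 3" using r q43 by simp
    then have yz: "cmod (y b) \<le> 1 / r * q" "cmod (z b) \<le> 1 / r * q"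
      using roots(3,4)[OF b(1)] \<rho>3 by linarith+
    have "\<mu> b \<noteq> q + 1"
    proof
      assume "\<mu> b = q + 1"
      have "cmod (complex_of_real (\<mu> b)) \<le> cmod (y b) + cmod (z b)"
        unfolding roots(1)[OF b(1), symmetric] by (rule norm_triangle_ineq)
      then have "q + 1 \<le> cmod (y b) + cmod (z b)" using \<open>\<mu> b = q + 1\<close> q by simp
      moreover have "cmod (y b) * cmod (z b) = q" using roots(2)[OF b(1)] q by (simp flip: norm_mult)
      moreover have "cmod (y b) < q" "cmod (z b) < q"
        using yz r1 q mult_strict_right_mono[of "1 / r" 1 q] by linarith+
      ultimately have "(q - cmod (y b)) * (q - cmod (z b)) \<le> 0"
        using q mult_left_mono[of "q + 1" "cmod (y b) + cmod (z b)" q] by (simp add: algebra_simps)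
      moreover have "(q - cmod (y b)) * (q - cmod (z b)) > 0"
        using \<open>cmod (y b) < q\<close> \<open>cmod (z b) < q\<close> by simp
      ultimately show False by simp
    qed
    moreover have "\<mu> b \<le> q + 1" using \<mu>[OF b(1)] by simp
    ultimately show ?thesis
      using ln_approx_close[OF q1 roots(1,2)[OF b(1)] yz r1(2), of K] by (simp add: g_def tail_def)
  qed
  have far: "\<bar>g b - ln_approx q K (\<mu> b)\<bar> \<le> h" if b: "b \<in> B" for b
  proof -
    have "\<bar>ln_approx q K (\<mu> b)\<bar> \<le> ln q + 2 * K"
      using roots(3,4,6)[OF b] by (intro ln_approx_bound[OF q1 roots(1,2)[OF b]]) linarith+
    moreover have "\<bar>g b\<bar> \<le> ln (2 * (q + 1)) + 16 * n * ln q"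
    proof (cases "\<mu> b = q + 1")
      case True
      then show ?thesis using lnq by (simp add: g_def)
    next
      case False
      define w where "w = q + 1 - \<mu> b"
      have w: "w > 0" "w \<le> 2 * (q + 1)" using \<mu>[OF b] False by (auto simp: w_def)
      have "1 \<le> q ^ (16 * n) * w" using gap[OF b False n] by (simp add: w_def)
      then have "0 \<le> ln (q ^ (16 * n) * w)" by simp
      also have "\<dots> = 16 * n * ln q + ln w" using q w by (simp add: ln_mult_pos ln_realpow)
      finally have "- ln w \<le> 16 * n * ln q" by simp
      moreover have "ln w \<le> ln (2 * (q + 1))" using w by simp
      moreover have "0 \<le> 16 * n * ln q" using lnq by simp
      ultimately have "\<bar>ln w\<bar> \<le> ln (2 * (q + 1)) + 16 * n * ln q" using lnq by linarith
      then show ?thesis using False by (simp add: g_def w_def)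
    qed
    ultimately show ?thesis unfolding h_def by linarith
  qed
  have h0: "h \<ge> 0" using lnq by (simp add: h_def)
  have D1: "\<bar>(\<Sum>b\<in>B. g b - ln_approx q K (\<mu> b))\<bar> \<le> N * (2 * tail) + card X * h"
  proof -
    have "\<bar>(\<Sum>b\<in>B. g b - ln_approx q K (\<mu> b))\<bar> \<le> (\<Sum>b\<in>B. 2 * tail + (if b \<in> X then h else 0))"
    proof (rule order_trans[OF sum_abs], rule sum_mono)
      fix b assume "b \<in> B"
      then show "\<bar>g b - ln_approx q K (\<mu> b)\<bar> \<le> 2 * tail + (if b \<in> X then h else 0)"
        using near[of b] far[of b] tail0 by (cases "b \<in> X") auto
    qed
    also have "\<dots> = N * (2 * tail) + (\<Sum>b\<in>B. if b \<in> X then h else 0)"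
      by (simp add: sum.distrib N_def)
    also have "(\<Sum>b\<in>B. if b \<in> X then h else 0) = (\<Sum>b\<in>X. h)"
      using B(1) XB by (simp add: sum.If_cases Int_absorb1)
    finally show ?thesis by simp
  qed
  have gsum: "(\<Sum>b\<in>{b \<in> B. \<mu> b \<noteq> q + 1}. ln (q + 1 - \<mu> b)) = (\<Sum>b\<in>B. g b)"
    unfolding g_def using B(1) by (simp add: sum.If_cases Int_def)
  have "(\<Sum>b\<in>B. g b) / N - kesten_limit q = (\<Sum>b\<in>B. g b - ln_approx q K (\<mu> b)) / N
      + ((\<Sum>b\<in>B. ln_approx q K (\<mu> b)) / N - (ln q - (\<Sum>m=1..K. (if even m then 1 - q else 0) / (q ^ m * m))))
      + (ln q - (\<Sum>m=1..K. (if even m then 1 - q else 0) / (q ^ m * m)) - kesten_limit q)"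
    by (simp add: sum_subtractf diff_divide_distrib)
  moreover have "\<bar>(\<Sum>b\<in>B. g b - ln_approx q K (\<mu> b)) / N\<bar> \<le> 2 * tail + 3 / (r\<^sup>2) ^ k * h"
  proof -
    have "\<bar>(\<Sum>b\<in>B. g b - ln_approx q K (\<mu> b)) / N\<bar> \<le> (N * (2 * tail) + card X * h) / N"
      using D1 N by (simp add: abs_divide divide_right_mono)
    also have "\<dots> = 2 * tail + card X / N * h" using N by (simp add: add_divide_distrib)
    also have "\<dots> \<le> 2 * tail + 3 / (r\<^sup>2) ^ k * h" by (intro add_left_mono mult_right_mono frac h0)
    finally show ?thesis .
  qed
  moreover have "\<bar>(\<Sum>b\<in>B. ln_approx q K (\<mu> b)) / N - (ln q - (\<Sum>m=1..K. (if even m then 1 - q else 0) / (q ^ m * m)))\<bar>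
      \<le> K * ((1 + q) * (C ^ K / M))"
    unfolding N_def by (rule average_ln_approx)
  moreover have "\<bar>ln q - (\<Sum>m=1..K. (if even m then 1 - q else 0) / (q ^ m * m)) - kesten_limit q\<bar> \<le> (q - 1) * tail"
    unfolding tail_def
  proof (rule kesten_limit_approx[OF q1 _ r1(2)])
    have "1 \<le> r ^ 3" using r by simp
    then have "r \<le> q" unfolding q43 using r mult_left_mono[of 1 "r ^ 3" r] by simp
    then show "1 / q \<le> 1 / r" using r by (intro divide_left_mono) auto
  qed
  moreover have "(q + 1) * tail = 2 * tail + (q - 1) * tail" by (simp add: algebra_simps)
  ultimately show ?thesis unfolding gsum N_def[symmetric] tail_def[symmetric] h_eq[symmetric] by linarith
qed

end

lemma power_decay:
  fixes s :: real
  assumes "s > 1"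
  shows "(\<lambda>k. 3 / s ^ k * (\<alpha> + \<beta> * (real k + 1))) \<longlonglongrightarrow> 0"
proof -
  have x: "\<bar>1 / s\<bar> < 1" using assms by simp
  have "(\<lambda>k. 3 * (\<alpha> + \<beta>) * (1 / s) ^ k + 3 * \<beta> * (real k * (1 / s) ^ k)) \<longlonglongrightarrow> 3 * (\<alpha> + \<beta>) * 0 + 3 * \<beta> * 0"
    by (intro tendsto_intros LIMSEQ_abs_realpow_zero2 powser_times_n_limit_0) (use x in auto)
  moreover have "3 / s ^ k * (\<alpha> + \<beta> * (real k + 1)) = 3 * (\<alpha> + \<beta>) * (1 / s) ^ k + 3 * \<beta> * (real k * (1 / s) ^ k)" for k
    using assms by (simp add: power_divide field_simps)
  ultimately show ?thesis by simp
qed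

lemma ln_det_uniform_limit:
  fixes q C \<epsilon> :: real
  assumes q: "q \<ge> 2" and C: "C \<ge> 1" and \<epsilon>: "\<epsilon> > 0"
  shows "\<exists>M0. \<forall>M\<ge>M0. \<forall>(B :: 'a set) \<mu>. spectral_data q C M B \<mu> \<longrightarrow>
    \<bar>(\<Sum>b\<in>{b \<in> B. \<mu> b \<noteq> q + 1}. ln (q + 1 - \<mu> b)) / card B - kesten_limit q\<bar> \<le> \<epsilon>"
proof -
  define r where "r = sqrt (sqrt q)"
  have r: "r > 1" using q by (simp add: r_def)
  have "r ^ 4 = (r\<^sup>2)\<^sup>2" by (simp flip: power_mult)
  then have r4: "r ^ 4 = q" using q by (simp add: r_def)
  have "(\<lambda>K. (q + 1) * ((1 / r) ^ Suc K / (1 - 1 / r))) \<longlonglongrightarrow> (q + 1) * (0 / (1 - 1 / r))"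
    by (intro tendsto_intros LIMSEQ_Suc[OF LIMSEQ_abs_realpow_zero2]) (use r in auto)
  then have "eventually (\<lambda>K. (q + 1) * ((1 / r) ^ Suc K / (1 - 1 / r)) < \<epsilon> / 3) sequentially"
    using \<epsilon> by (intro order_tendstoD(2)) auto
  then obtain K where K: "(q + 1) * ((1 / r) ^ Suc K / (1 - 1 / r)) < \<epsilon> / 3"
    by (auto simp: eventually_sequentially)
  have "(\<lambda>M. K * ((1 + q) * (C ^ K / real M))) \<longlonglongrightarrow> K * ((1 + q) * 0)"
    by (intro tendsto_mult_left tendsto_divide_0[OF tendsto_const] filterlim_real_at_infinity_sequentially)
  then have "eventually (\<lambda>M. K * ((1 + q) * (C ^ K / real M)) < \<epsilon> / 3) sequentially"
    using \<epsilon> by (intro order_tendstoD(2)) auto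
  then obtain M1 where M1: "\<And>M. M \<ge> M1 \<Longrightarrow> K * ((1 + q) * (C ^ K / real M)) < \<epsilon> / 3"
    by (auto simp: eventually_sequentially)
  obtain D :: nat where D: "4 * (1 + q) * C\<^sup>2 \<le> D" using real_arch_simple by blast
  have "1 * 1 \<le> (1 + q) * C\<^sup>2" using q C by (intro mult_mono) (auto intro: one_le_power)
  then have D2: "D \<ge> 2" using D by linarith
  define c where "c = (3 * D) ^ 8"
  have c: "(3 * D) ^ 8 < 2 ^ c" unfolding c_def by (rule less_exp)
  define \<alpha> \<beta> where "\<alpha> = ln (2 * (q + 1)) + (ln q + 2 * K)" and "\<beta> = 16 * c * ln q"
  have "(\<lambda>k. 3 / (r\<^sup>2) ^ k * (\<alpha> + \<beta> * (real k + 1))) \<longlonglongrightarrow> 0"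
    by (rule power_decay) (use r in simp)
  then have "eventually (\<lambda>k. 3 / (r\<^sup>2) ^ k * (\<alpha> + \<beta> * (real k + 1)) < \<epsilon> / 3) sequentially"
    using \<epsilon> by (intro order_tendstoD(2)) auto
  then obtain k0 where k0: "\<And>k. k \<ge> k0 \<Longrightarrow> 3 / (r\<^sup>2) ^ k * (\<alpha> + \<beta> * (real k + 1)) < \<epsilon> / 3"
    by (auto simp: eventually_sequentially)
  show ?thesis
  proof (intro exI[of _ "max M1 (D ^ Suc k0)"] allI impI)
    fix M and B :: "'a set" and \<mu>
    assume Mle: "max M1 (D ^ Suc k0) \<le> M" and "spectral_data q C M B \<mu>"
    then interpret spectral_data q C M B \<mu> by simp
    obtain k where k: "D ^ k \<le> M" "M < D ^ (k + 1)" using ex_power_ivl1[OF D2, of M] M by fastforce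
    have "D ^ Suc k0 \<le> M" using Mle by (rule max.boundedE)
    then have "D ^ Suc k0 < D ^ (k + 1)" using k(2) by (rule le_less_trans)
    then have "Suc k0 < k + 1" using D2 by (subst (asm) power_strict_increasing_iff) auto
    then have "k \<ge> k0" "k \<ge> 1" by auto
    define n where "n = c * (k + 1)"
    have "c \<ge> 1" using D2 by (simp add: c_def)
    then have n1: "n \<ge> 1" by (simp add: n_def)
    have "(3 * M) ^ 8 < 2 ^ n"
    proof -
      have "(3 * M) ^ 8 \<le> (3 * D ^ (k + 1)) ^ 8" using k(2) by (intro power_mono) auto
      also have "\<dots> \<le> ((3 * D) ^ (k + 1)) ^ 8"
        by (intro power_mono) (auto simp: power_mult_distrib intro!: mult_right_mono)
      also have "\<dots> = ((3 * D) ^ 8) ^ (k + 1)" by (simp only: power_mult[symmetric] mult.commute)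
      also have "\<dots> < (2 ^ c) ^ (k + 1)" using c by (intro power_strict_mono) auto
      also have "\<dots> = 2 ^ n" by (simp only: n_def power_mult)
      finally show ?thesis .
    qed
    note bound = ln_det_average[OF r r4 \<open>k \<ge> 1\<close> D k(1) n1 this, of K]
    have eq: "ln (2 * (q + 1)) + 16 * real n * ln q + (ln q + 2 * real K) = \<alpha> + \<beta> * (real k + 1)"
      by (simp add: \<alpha>_def \<beta>_def n_def algebra_simps)
    moreover have "K * ((1 + q) * (C ^ K / real M)) < \<epsilon> / 3" using M1[of M] Mle by simp
    ultimately show "\<bar>(\<Sum>b\<in>{b \<in> B. \<mu> b \<noteq> q + 1}. ln (q + 1 - \<mu> b)) / card B - kesten_limit q\<bar> \<le> \<epsilon>"
      using K k0[OF \<open>k \<ge> k0\<close>] bound[unfolded eq] by linarith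
  qed
qed

section \<open>The regularised determinant\<close>

context twisted_mod4
begin

lemma p0_ge_5: "p\<^sub>0 \<ge> 5"
proof -
  have "p\<^sub>0 mod 4 = 1" using p0_mod4 by (simp add: cong_def)
  moreover have "p\<^sub>0 \<ge> 2" using prime_ge_2_nat[OF prime_p0] .
  ultimately show ?thesis by presburger
qed

lemma lin_sphere_op: "lin (sphere_op m)"
proof -
  interpret O: Vector_Spaces.linear section_scale section_scale "op w" for w by (rule lin_op)
  show ?thesis
    by unfold_locales (simp_all add: sphere_op_def O.add O.scale sum.distrib section_fun.scale_sum_right)
qed

lemma sphere_op_in_W: "u \<in> W \<Longrightarrow> sphere_op m u \<in> W"
  unfolding sphere_op_def
  by (rule section_fun.subspace_sum[OF W_subspace]) (rule op_in_W[OF words_gens])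

lemma trace_sphere_op:
  assumes "m \<ge> 1"
  shows "cmod (trace (sphere_op m)) \<le> card basis * ((real p\<^sub>0 * (real p\<^sub>0 + 1)) ^ m / max p\<^sub>1 p)"
proof -
  have "trace (sphere_op m) = (\<Sum>w\<in>words p\<^sub>0 m. trace (op w))"
    unfolding trace_def sphere_op_def ip_sum_left by (rule sum.swap)
  then have "cmod (trace (sphere_op m)) \<le> (\<Sum>w\<in>words p\<^sub>0 m. card basis * real p\<^sub>0 ^ m / max p\<^sub>1 p)"
    using assms trace_op_bound by (simp only:) (rule sum_norm_le, simp)
  also have "\<dots> = card (words p\<^sub>0 m) * (card basis * real p\<^sub>0 ^ m / max p\<^sub>1 p)" by simp
  also have "\<dots> \<le> (real p\<^sub>0 + 1) ^ m * (card basis * real p\<^sub>0 ^ m / max p\<^sub>1 p)"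
  proof (rule mult_right_mono)
    have "real (card (words p\<^sub>0 m)) \<le> real ((p\<^sub>0 + 1) ^ m)"
      using card_words_le[of p\<^sub>0 m] unfolding card_gens_p0 by (rule of_nat_mono)
    then show "real (card (words p\<^sub>0 m)) \<le> (real p\<^sub>0 + 1) ^ m" by (simp add: add.commute)
  qed simp
  finally show ?thesis by (simp add: power_mult_distrib mult_ac)
qed

lemma spectral_gap:
  fixes l :: real
  assumes u: "u \<in> W" "nrm u = 1" and l: "T u = section_scale (of_real l) u" and ne: "l \<noteq> real p\<^sub>0 + 1"
    and n: "n \<ge> 1" "(3 * max p\<^sub>1 p) ^ 8 < 2 ^ n"
  shows "1 \<le> real p\<^sub>0 ^ (16 * n) * (real p\<^sub>0 + 1 - l)"
proof -
  define M where "M = max p\<^sub>1 p"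
  have p1: "p\<^sub>1 > 0" using prime_gt_0_nat[OF prime_p1] .
  have eps: "real p\<^sub>0 + 1 - l \<ge> 0" using eigenvalue_le[OF u l] by simp
  have q5: "real p\<^sub>0 \<ge> 5" using p0_ge_5 by simp
  have n': "real ((3 * M) ^ 8) \<le> 2 ^ n"
    using n(2) unfolding M_def[symmetric] by (metis less_imp_le of_nat_le_iff of_nat_numeral of_nat_power)
  show ?thesis
  proof (cases "p = 0")
    case True
    have "1 \<le> (real p\<^sub>1 ^ 4)\<^sup>2 * (2 * (real p\<^sub>0 + 1 - l))" by (rule gap_scalar[OF True u l ne])
    also have "\<dots> = 2 * real p\<^sub>1 ^ 8 * (real p\<^sub>0 + 1 - l)" by (simp flip: power_mult)
    also have "\<dots> \<le> real p\<^sub>0 ^ (16 * n) * (real p\<^sub>0 + 1 - l)"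
    proof (rule mult_right_mono[OF _ eps])
      have "2 * real p\<^sub>1 ^ 8 \<le> 3 ^ 8 * real M ^ 8"
        by (intro mult_mono power_mono) (auto simp: M_def)
      also have "\<dots> = real ((3 * M) ^ 8)" by (simp add: power_mult_distrib)
      also have "\<dots> \<le> 2 ^ n" by (rule n')
      also have "\<dots> \<le> real p\<^sub>0 ^ n" using q5 by (intro power_mono) auto
      also have "\<dots> \<le> real p\<^sub>0 ^ (16 * n)" using q5 by (intro power_increasing) auto
      finally show "2 * real p\<^sub>1 ^ 8 \<le> real p\<^sub>0 ^ (16 * n)" .
    qed
    finally show ?thesis .
  next
    case False
    then have p: "p > 0" by simp
    have "(2 * p + 1) ^ 4 * p\<^sub>1 ^ 4 \<le> (3 * M) ^ 4 * (3 * M) ^ 4"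
      using p by (intro mult_mono power_mono) (auto simp: M_def)
    also have "\<dots> = (3 * M) ^ 8" by (simp flip: power_add)
    also have "\<dots> < 2 ^ n" using n(2) by (simp only: M_def)
    finally have "1 \<le> 784 * (real n)\<^sup>2 * real p\<^sub>0 ^ (6 * n + 4) * (real p\<^sub>0 + 1 - l)"
      by (rule gap_twisted[OF p u l])
    also have "\<dots> \<le> real p\<^sub>0 ^ (16 * n) * (real p\<^sub>0 + 1 - l)"
    proof (rule mult_right_mono[OF _ eps])
      have "(784 :: real) \<le> 5 ^ 5" by simp
      also have "\<dots> \<le> real p\<^sub>0 ^ 5" using q5 by (intro power_mono) auto
      finally have a: "784 \<le> real p\<^sub>0 ^ 5" .
      have "real n \<le> 2 ^ n" using less_exp[of n] by (metis less_imp_le of_nat_le_iff of_nat_numeral of_nat_power)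
      then have "(real n)\<^sup>2 \<le> (2 ^ n)\<^sup>2" by (intro power_mono) auto
      also have "\<dots> = (2\<^sup>2) ^ n" by (simp only: power_mult[symmetric] mult.commute)
      also have "\<dots> = 4 ^ n" by simp
      also have "\<dots> \<le> real p\<^sub>0 ^ n" using q5 by (intro power_mono) auto
      finally have "784 * (real n)\<^sup>2 * real p\<^sub>0 ^ (6 * n + 4) \<le> real p\<^sub>0 ^ 5 * real p\<^sub>0 ^ n * real p\<^sub>0 ^ (6 * n + 4)"
        using a by (intro mult_right_mono mult_mono) auto
      also have "\<dots> = real p\<^sub>0 ^ (5 + n + (6 * n + 4))" by (simp only: power_add)
      also have "\<dots> \<le> real p\<^sub>0 ^ (16 * n)" using q5 n(1) by (intro power_increasing) auto
      finally show "784 * (real n)\<^sup>2 * real p\<^sub>0 ^ (6 * n + 4) \<le> real p\<^sub>0 ^ (16 * n)" .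
    qed
    finally show ?thesis .
  qed
qed

theorem spectral_data_exists:
  obtains B :: "section_fun set" and \<mu> where
    "spectral_data (real p\<^sub>0) (real p\<^sub>0 * (real p\<^sub>0 + 1)) (max p\<^sub>1 p) B \<mu>"
    "dim_sections p\<^sub>0 p\<^sub>1 p = card B"
    "ln_det p\<^sub>0 p\<^sub>1 b p = of_real (\<Sum>u\<in>{u \<in> B. \<mu> u \<noteq> real p\<^sub>0 + 1}. ln (real p\<^sub>0 + 1 - \<mu> u))"
proof -
  interpret X: group X by (rule group_X)
  obtain B \<mu> where B: "orthonormal B" "section_fun.span B = section_fun.span basis"
    and eig: "\<And>u. u \<in> B \<Longrightarrow> T u = section_scale (of_real (\<mu> u)) u"
    by (rule spectral_theorem[OF lin_T]) (auto simp: span_basis T_in_W T_self_adjoint)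
  have fin: "finite B" using B(1) by (simp add: orthonormal_def)
  have BW: "u \<in> W" if "u \<in> B" for u using that B(2) section_fun.span_base span_basis by blast
  have nB: "nrm u = 1" if "u \<in> B" for u
  proof -
    have "complex_of_real ((nrm u)\<^sup>2) = 1"
      using ip_self[of u] BW[OF that] B(1) that by (simp add: span_basis orthonormal_def)
    then have "(nrm u)\<^sup>2 = 1" by (metis of_real_1 of_real_eq_iff)
    then show ?thesis using nrm_nonneg[of u] by (simp add: power2_eq_1_iff)
  qed
  have dim: "section_fun.dim W = card B"
    using card_orthonormal_basis[OF B(1)] B(2) by (simp add: span_basis)
  have card_eq: "card basis = card B"
    using card_orthonormal_basis[OF orthonormal_E] dim by (simp add: span_basis)
  have "\<one>\<^bsub>X\<^esub> \<in> carrier X" by simp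
  then have "card (carrier X) > 0" using finite_X by (auto simp: card_gt_0_iff)
  then have "card B > 0" using card_basis card_eq by simp
  then have Bne: "B \<noteq> {}" by auto
  have data: "spectral_data (real p\<^sub>0) (real p\<^sub>0 * (real p\<^sub>0 + 1)) (max p\<^sub>1 p) B \<mu>"
  proof
    show "2 \<le> real p\<^sub>0" using p0_ge_5 by simp
    have "real p\<^sub>0 \<ge> 1" using p0_ge_5 by simp
    then show "1 \<le> real p\<^sub>0 * (real p\<^sub>0 + 1)" by (intro mult_ge1_I) auto
    show "0 < max p\<^sub>1 p" using prime_gt_0_nat[OF prime_p1] by simp
    show "finite B" "B \<noteq> {}" by (fact fin, fact Bne)
    show "\<bar>\<mu> u\<bar> \<le> real p\<^sub>0 + 1" if "u \<in> B" for u
      by (rule eigenvalue_le[OF BW[OF that] nB[OF that] eig[OF that]])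
    show "\<bar>\<Sum>u\<in>B. sph (real p\<^sub>0) m (\<mu> u)\<bar> \<le> card B * ((real p\<^sub>0 * (real p\<^sub>0 + 1)) ^ m / max p\<^sub>1 p)"
      if "1 \<le> m" for m
    proof -
      have "trace (sphere_op m) = (\<Sum>u\<in>B. ips (sphere_op m u) u)"
        unfolding trace_def
        by (rule trace_basis_independent[OF orthonormal_E B(1) B(2)[symmetric] lin_sphere_op])
          (simp add: B(2) span_basis sphere_op_in_W)
      also have "\<dots> = (\<Sum>u\<in>B. of_real (sph (real p\<^sub>0) m (\<mu> u)))"
      proof (intro sum.cong refl)
        fix u assume u: "u \<in> B"
        have "ips u u = 1" using B(1) u by (simp add: orthonormal_def)
        then show "ips (sphere_op m u) u = of_real (sph (real p\<^sub>0) m (\<mu> u))"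
          unfolding sphere_op_eigen[OF BW[OF u] eig[OF u]] ip_scale by simp
      qed
      also have "\<dots> = of_real (\<Sum>u\<in>B. sph (real p\<^sub>0) m (\<mu> u))" by simp
      finally have "cmod (trace (sphere_op m)) = \<bar>\<Sum>u\<in>B. sph (real p\<^sub>0) m (\<mu> u)\<bar>"
        by (simp only: norm_of_real)
      then show ?thesis using trace_sphere_op[OF that] card_eq by simp
    qed
    show "1 \<le> real p\<^sub>0 ^ (16 * n) * (real p\<^sub>0 + 1 - \<mu> u)"
      if "u \<in> B" "\<mu> u \<noteq> real p\<^sub>0 + 1" "1 \<le> n" "(3 * max p\<^sub>1 p) ^ 8 < 2 ^ n" for u n
      by (rule spectral_gap[OF BW[OF that(1)] nB[OF that(1)] eig[OF that(1)] that(2-4)])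
  qed
  have "ln_det p\<^sub>0 p\<^sub>1 b p
      = (\<Sum>u\<in>{u \<in> B. complex_of_real (\<mu> u) \<noteq> of_nat p\<^sub>0 + 1}. ln (of_nat p\<^sub>0 + 1 - of_real (\<mu> u)))"
    using sum_over_spectrum[OF lin_T B(1) eig, where c = "of_nat p\<^sub>0 + 1"
        and F = "\<lambda>l. ln (of_nat p\<^sub>0 + 1 - l)"]
    unfolding ln_det_def eigenvalues_def eig_mult_def eigenspace_def B(2) span_basis by simp
  also have "\<dots> = (\<Sum>u\<in>{u \<in> B. \<mu> u \<noteq> real p\<^sub>0 + 1}. of_real (ln (real p\<^sub>0 + 1 - \<mu> u)))"
  proof (rule sum.cong)
    have e: "complex_of_real x = of_nat p\<^sub>0 + 1 \<longleftrightarrow> x = real p\<^sub>0 + 1" for x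
      by (metis of_real_1 of_real_add of_real_eq_iff of_real_of_nat_eq)
    show "{u \<in> B. complex_of_real (\<mu> u) \<noteq> of_nat p\<^sub>0 + 1} = {u \<in> B. \<mu> u \<noteq> real p\<^sub>0 + 1}"
      by (simp add: e)
    fix u assume "u \<in> {u \<in> B. \<mu> u \<noteq> real p\<^sub>0 + 1}"
    then have u: "u \<in> B" "\<mu> u \<noteq> real p\<^sub>0 + 1" by auto
    have "\<bar>\<mu> u\<bar> \<le> real p\<^sub>0 + 1" by (rule eigenvalue_le[OF BW[OF u(1)] nB[OF u(1)] eig[OF u(1)]])
    then have "real p\<^sub>0 + 1 - \<mu> u > 0" using u(2) by linarith
    then have "ln (complex_of_real (real p\<^sub>0 + 1 - \<mu> u)) = of_real (ln (real p\<^sub>0 + 1 - \<mu> u))"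
      by (rule Ln_of_real)
    then show "ln (of_nat p\<^sub>0 + 1 - complex_of_real (\<mu> u)) = of_real (ln (real p\<^sub>0 + 1 - \<mu> u))" by simp
  qed
  finally show ?thesis using that[OF data] dim by (simp add: dim_sections_def)
qed

end

lemma twisted_mod4I:
  assumes "prime p\<^sub>0" "[p\<^sub>0 = 1] (mod 4)" "prime p\<^sub>1" "[p\<^sub>1 = 1] (mod 4)" "p\<^sub>1 \<noteq> p\<^sub>0" "[b\<^sup>2 = -1] (mod int p\<^sub>1)"
  shows "twisted_mod4 p\<^sub>0 p\<^sub>1 b"
proof -
  have "odd p\<^sub>1" using assms(4) unfolding cong_def by presburger
  then show ?thesis using assms by unfold_locales auto
qed

theorem theorem1p8:
  fixes p\<^sub>0 :: nat and b :: "nat \<Rightarrow> int"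
  assumes "prime p\<^sub>0" and "[p\<^sub>0 = 1] (mod 4)"
    and "\<And>p\<^sub>1. prime p\<^sub>1 \<Longrightarrow> [p\<^sub>1 = 1] (mod 4) \<Longrightarrow> p\<^sub>1 \<noteq> p\<^sub>0 \<Longrightarrow> [(b p\<^sub>1)\<^sup>2 = -1] (mod int p\<^sub>1)"
  shows "(\<lambda>k::nat.
      SUP (p\<^sub>1, p) \<in> {(p\<^sub>1, p). prime p\<^sub>1 \<and> [p\<^sub>1 = 1] (mod 4) \<and> p\<^sub>1 \<noteq> p\<^sub>0 \<and> max p\<^sub>1 p \<ge> k}.
        ereal (cmod (ln_det p\<^sub>0 p\<^sub>1 (b p\<^sub>1) p / of_nat (dim_sections p\<^sub>0 p\<^sub>1 p)
          - of_real (real p\<^sub>0 * ln (real p\<^sub>0)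
              - 1/2 * (real p\<^sub>0 - 1) * ln (real p\<^sub>0 - 1)
              - 1/2 * (real p\<^sub>0 - 1) * ln (real p\<^sub>0 + 1)))))
    \<longlonglongrightarrow> 0"
proof -
  let ?F = "\<lambda>(p\<^sub>1, p). ereal (cmod (ln_det p\<^sub>0 p\<^sub>1 (b p\<^sub>1) p / of_nat (dim_sections p\<^sub>0 p\<^sub>1 p)
          - of_real (real p\<^sub>0 * ln (real p\<^sub>0)
              - 1/2 * (real p\<^sub>0 - 1) * ln (real p\<^sub>0 - 1)
              - 1/2 * (real p\<^sub>0 - 1) * ln (real p\<^sub>0 + 1))))"
  let ?A = "\<lambda>k. {(p\<^sub>1, p). prime p\<^sub>1 \<and> [p\<^sub>1 = 1] (mod 4) \<and> p\<^sub>1 \<noteq> p\<^sub>0 \<and> max p\<^sub>1 p \<ge> k}"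
  have small: "\<exists>M0. \<forall>x\<in>?A M0. ?F x \<le> ereal \<epsilon>" if \<epsilon>: "\<epsilon> > 0" for \<epsilon>
  proof -
    have q: "real p\<^sub>0 \<ge> 2" using prime_ge_2_nat[OF assms(1)] by simp
    then have C: "real p\<^sub>0 * (real p\<^sub>0 + 1) \<ge> 1" by (intro mult_ge1_I) auto
    obtain M0 where M0: "\<And>M (B :: section_fun set) \<mu>. M0 \<le> M \<Longrightarrow>
        spectral_data (real p\<^sub>0) (real p\<^sub>0 * (real p\<^sub>0 + 1)) M B \<mu> \<Longrightarrow>
        \<bar>(\<Sum>u\<in>{u \<in> B. \<mu> u \<noteq> real p\<^sub>0 + 1}. ln (real p\<^sub>0 + 1 - \<mu> u)) / card B - kesten_limit (real p\<^sub>0)\<bar> \<le> \<epsilon>"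
      using ln_det_uniform_limit[OF q C \<epsilon>] by blast
    have bd: "?F (p\<^sub>1, p) \<le> ereal \<epsilon>" if "(p\<^sub>1, p) \<in> ?A M0" for p\<^sub>1 p
    proof -
      have p1: "prime p\<^sub>1" "[p\<^sub>1 = 1] (mod 4)" "p\<^sub>1 \<noteq> p\<^sub>0" "M0 \<le> max p\<^sub>1 p" using that by auto
      interpret twisted_mod4 p\<^sub>0 p\<^sub>1 "b p\<^sub>1" p
        by (rule twisted_mod4I[OF assms(1,2) p1(1,2,3) assms(3)[OF p1(1,2,3)]])
      obtain B :: "section_fun set" and \<mu> where
        data: "spectral_data (real p\<^sub>0) (real p\<^sub>0 * (real p\<^sub>0 + 1)) (max p\<^sub>1 p) B \<mu>"
        and dim: "dim_sections p\<^sub>0 p\<^sub>1 p = card B"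
        and det: "ln_det p\<^sub>0 p\<^sub>1 (b p\<^sub>1) p = of_real (\<Sum>u\<in>{u \<in> B. \<mu> u \<noteq> real p\<^sub>0 + 1}. ln (real p\<^sub>0 + 1 - \<mu> u))"
        by (rule spectral_data_exists)
      let ?S = "\<Sum>u\<in>{u \<in> B. \<mu> u \<noteq> real p\<^sub>0 + 1}. ln (real p\<^sub>0 + 1 - \<mu> u)"
      have "?F (p\<^sub>1, p) = ereal (cmod (of_real (?S / card B - kesten_limit (real p\<^sub>0))))"
        unfolding prod.case dim det kesten_limit_def of_real_diff of_real_divide of_real_of_nat_eq ..
      also have "\<dots> \<le> ereal \<epsilon>"
        unfolding norm_of_real ereal_less_eq(3) by (rule M0[OF p1(4) data])
      finally show ?thesis .
    qed
    show ?thesis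
    proof (intro exI[of _ M0] ballI)
      fix x assume x: "x \<in> ?A M0"
      obtain p\<^sub>1 p where eq: "x = (p\<^sub>1, p)" by (cases x)
      show "?F x \<le> ereal \<epsilon>" unfolding eq by (rule bd) (use x in \<open>simp only: eq\<close>)
    qed
  qed
  have "\<exists>p\<^sub>1 :: nat. prime p\<^sub>1 \<and> [p\<^sub>1 = 1] (mod 4) \<and> p\<^sub>1 \<noteq> p\<^sub>0"
  proof (cases "p\<^sub>0 = 5")
    case True
    then show ?thesis by (intro exI[of _ 13]) (simp add: cong_def)
  next
    case False
    then show ?thesis by (intro exI[of _ 5]) (simp add: cong_def)
  qed
  then obtain p\<^sub>1 :: nat where p1: "prime p\<^sub>1" "[p\<^sub>1 = 1] (mod 4)" "p\<^sub>1 \<noteq> p\<^sub>0" by blast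
  have nonneg: "0 \<le> (SUP x\<in>?A k. ?F x)" for k
  proof (rule SUP_upper2)
    show "(p\<^sub>1, k) \<in> ?A k" using p1 by simp
    show "0 \<le> ?F (p\<^sub>1, k)" by simp
  qed
  show ?thesis
  proof (rule order_tendstoI)
    fix a :: ereal assume "a < 0"
    then show "eventually (\<lambda>k. a < (SUP x\<in>?A k. ?F x)) sequentially"
      using nonneg less_le_trans by (intro always_eventually allI) blast
  next
    fix a :: ereal assume "0 < a"
    then obtain e :: real where e: "0 < ereal e" "ereal e < a" using ereal_dense2 by blast
    then obtain M0 where M0: "\<forall>x\<in>?A M0. ?F x \<le> ereal e"
      using small[of e] unfolding ereal_less(2) by blast
    have "(SUP x\<in>?A k. ?F x) < a" if "k \<ge> M0" for k
    proof -
      have "(SUP x\<in>?A k. ?F x) \<le> ereal e"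
      proof (rule SUP_least)
        fix x assume "x \<in> ?A k"
        then have "x \<in> ?A M0" using that by auto
        then show "?F x \<le> ereal e" using M0 by blast
      qed
      then show ?thesis using e(2) by (rule le_less_trans)
    qed
    then show "eventually (\<lambda>k. (SUP x\<in>?A k. ?F x) < a) sequentially"
      unfolding eventually_sequentially by blast
  qed
qed

end
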